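(* Let $\{X_i,i\in\mathbf{Z}\}$ be $(m,\alpha)$-short range dependent random variables with constants $m\geq 8$ and $\alpha>2$, and suppose $\{X_i\}$ is weakly stationary; let $X_1,\dots,X_T$ be observed. Let $p$ be a positive integer with $p=O(1)$, and suppose there exists a constant $c>0$ such that the smallest eigenvalue of $\Sigma=\{\sigma_{|j-k|}\}_{j,k=1,\dots,p}$ is greater than $c$, where $\sigma_j=\mathbf{E}X_0X_{-j}$. Let $Z_{i,j}=\sum_{k=0}^p b_{jk}(X_iX_{i-k}-\sigma_k)$, $j=1,\dots,p$, with the coefficients $b_{jk}$ defined in the context, and assume that there is a constant $C>0$ such that $$\Big\Vert\frac{1}{\sqrt T}\sum_{i=1}^T Z_{i,j}\Big\Vert_2>C\quad\text{for all } j=1,\dots,p.$$ Let $a_1,\dots,a_p$ be the AR coefficients of order $p$ of $\{X_i\}$ and $\widehat a_1,\dots,\widehat a_p$ their Yule-Walker estimators. Then $$\sup_{x\in\mathbf{R}}\Big|Prob\Big(\max_{j=1,\dots,p}|\sqrt T(\widehat a_j-a_j)|\leq x\Big)-Prob\Big(\max_{j=1,\dots,p}|\xi_j|\leq x\Big)\Big|=o(1),$$ where $\xi_1,\dots,\xi_p$ are jointly normal random variables with $\mathbf{E}\xi_j=0$ and $\mathbf{E}\xi_{j_1}\xi_{j_2}=\frac1T\sum_{i_1=1}^T\sum_{i_2=1}^T\mathbf{E}Z_{i_1,j_1}Z_{i_2,j_2}$.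
   Context: Asymptotic framework: for each sample size $T$ there is a process $\{X_i\}_{i\in\mathbf{Z}}$ (which may be different for different $T$; this dependence is suppressed). All order notation is as $T\to\infty$; "constants" do not depend on $T$. For a random variable $X$ and $m\ge1$, $\Vert X\Vert_m=(\mathbf{E}|X|^m)^{1/m}$. Weakly stationary with mean zero: $\mathbf{E}X_i=0$ and $\mathbf{E}X_iX_{i-j}$ does not depend on $i$. Short range dependence: let $e_i$, $i\in\mathbf{Z}$, be independent (not necessarily identically distributed) random variables and $X_i=g_i(\dots,e_{i-2},e_{i-1},e_i)$ with measurable functions $g_i$, which may depend on $i$ and on $T$. Let $e_i^\dagger$, $i\in\mathbf{Z}$, be mutually independent, independent of all the $e_j$, with $e_i^\dagger$ distributed as $e_i$. For $k\ge0$ set $X_i(k)=g_i(\dots,e_{i-k-1},e^\dagger_{i-k},e_{i-k+1},\dots,e_i)$, and $X_i(k)=X_i$ for $k<0$. Let $\delta_m(k)=\sup_{i\in\mathbf{Z}}\Vert X_i-X_i(k)\Vert_m$. For constants $m\geq4$, $\alpha>1$, the $X_i$ are called $(m,\alpha)$-short range dependent if $\mathbf{E}X_i=0$ for all $i$, $\sup_{i}\Vert X_i\Vert_m=O(1)$, and $\sup_{k=0,1,\dots}(1+k)^\alpha\sum_{l=k}^\infty\delta_m(l)=O(1)$. AR coefficients of order $p$: the solution $a_1,\dots,a_p$ of the Yule-Walker system $\sigma_k=\sum_{j=1}^p a_j\sigma_{|k-j|}$, $k=1,\dots,p$. Yule-Walker estimators: with $\widehat\sigma_j=\frac1T\sum_{i=j+1}^T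 X_iX_{i-j}$, they solve $\widehat\sigma_k=\sum_{j=1}^p\widehat a_j\widehat\sigma_{|j-k|}$, $k=1,\dots,p$ (i.e. $\widehat a=\widehat\Sigma^{\dagger}\widehat\gamma$ with $\widehat\Sigma=\{\widehat\sigma_{|j-k|}\}_{j,k=1,\dots,p}$, $\widehat\gamma=(\widehat\sigma_1,\dots,\widehat\sigma_p)^T$ and $\dagger$ the Moore-Penrose pseudo-inverse). Coefficients $b_{jk}$: let $\mathbf{e}_i\in\mathbf{R}^p$ be the $i$-th standard unit vector, $\gamma=(\sigma_1,\dots,\sigma_p)^T$, and for $i=0,\dots,p-1$ let $T_i$ be the $p\times p$ matrix (not to be confused with the sample size $T$) whose $(j,k)$ entry is $1$ if $|j-k|=i$ and $0$ otherwise. Set $\mathbf{b}_0=-\Sigma^{-2}\gamma$, $\mathbf{b}_i=\Sigma^{-1}\mathbf{e}_i-\Sigma^{-1}T_i\Sigma^{-1}\gamma$ for $i=1,\dots,p-1$, and $\mathbf{b}_p=\Sigma^{-1}\mathbf{e}_p$. Then $B=\{b_{jk}\}_{j=1,\dots,p,\,k=0,1,\dots,p}=(\mathbf{b}_0,\mathbf{b}_1,\dots,\mathbf{b}_p)\in\mathbf{R}^{p\times(p+1)}$. *)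

theory Defs
  imports
    "HOL-Probability.Probability"
    "HOL-Library.Landau_Symbols"
    "Jordan_Normal_Form.Spectral_Radius"
begin

unbundle no vec_syntax

text \<open>Extended-valued, so that an infinite moment gives the norm \<open>\<infinity>\<close>.\<close>

definition Lnorm :: "'a measure \<Rightarrow> real \<Rightarrow> ('a \<Rightarrow> real) \<Rightarrow> ennreal" where
  "Lnorm M m Y = (let I = (\<integral>\<^sup>+ \<omega>. ennreal (\<bar>Y \<omega>\<bar> powr m) \<partial>M) in
     if I = \<infinity> then \<infinity> else ennreal (enn2real I powr (1 / m)))"

definition weakly_stationary :: "'a measure \<Rightarrow> (int \<Rightarrow> 'a \<Rightarrow> real) \<Rightarrow> bool" where
  "weakly_stationary M X \<longleftrightarrow>
     (\<forall>i. has_bochner_integral M (X i) 0) \<and>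
     (\<forall>i. integrable M (\<lambda>\<omega>. (X i \<omega>)\<^sup>2)) \<and>
     (\<forall>i i' j. (\<integral>\<omega>. X i \<omega> * X (i - j) \<omega> \<partial>M) = (\<integral>\<omega>. X i' \<omega> * X (i' - j) \<omega> \<partial>M))"

definition acov :: "'a measure \<Rightarrow> (int \<Rightarrow> 'a \<Rightarrow> real) \<Rightarrow> nat \<Rightarrow> real" where
  "acov M X j = (\<integral>\<omega>. X 0 \<omega> * X (- int j) \<omega> \<partial>M)"

text \<open>The history \<open>(\<dots>, e\<^sub>i\<^sub>-\<^sub>1, e\<^sub>i)\<close> is encoded as the sequence \<open>n \<mapsto> e (i - n)\<close>.\<close>

definition causal_representation ::
  "'a measure \<Rightarrow> (int \<Rightarrow> 'a \<Rightarrow> real) \<Rightarrow> (int \<Rightarrow> 'a \<Rightarrow> real) \<Rightarrow> (int \<Rightarrow> (nat \<Rightarrow> real) \<Rightarrow> real) \<Rightarrow> bool" where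
  "causal_representation M X e g \<longleftrightarrow>
     prob_space.indep_vars M (\<lambda>_. borel) e UNIV \<and>
     (\<forall>i. g i \<in> borel_measurable (\<Pi>\<^sub>M n\<in>UNIV. borel)) \<and>
     (\<forall>i. \<forall>\<omega>\<in>space M. X i \<omega> = g i (\<lambda>n. e (i - int n) \<omega>))"

text \<open>The innovations and their independent copy are realised on the product space \<open>M \<Otimes>\<^sub>M M\<close>: there
  \<open>e\<^sub>j(\<omega>, \<omega>') = e\<^sub>j(\<omega>)\<close> and \<open>e\<^sub>j\<^sup>\<dagger>(\<omega>, \<omega>') = e\<^sub>j(\<omega>')\<close>. In this way \<open>M\<close> itself does not have to carry an
  independent copy, and \<open>\<delta>\<^sub>m(k)\<close> depends only on the joint law of the innovations in any case. The
  required independence and equality in distribution are proved below.\<close>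

definition innov :: "(int \<Rightarrow> 'a \<Rightarrow> real) \<Rightarrow> int \<Rightarrow> 'a \<times> 'a \<Rightarrow> real" where
  "innov e j = (\<lambda>w. e j (fst w))"

definition innov_copy :: "(int \<Rightarrow> 'a \<Rightarrow> real) \<Rightarrow> int \<Rightarrow> 'a \<times> 'a \<Rightarrow> real" where
  "innov_copy e j = (\<lambda>w. e j (snd w))"

lemma indep_innov_copy:
  assumes M: "prob_space M" and e: "prob_space.indep_vars M (\<lambda>_. borel) e UNIV"
  shows "prob_space.indep_vars (M \<Otimes>\<^sub>M M) (\<lambda>_. borel) (case_sum (innov e) (innov_copy e)) UNIV"
proof -
  interpret prob_space M by fact
  interpret P: pair_prob_space M M ..
  have em[measurable]: "e j \<in> borel_measurable M" for j
    using e by (auto simp: indep_vars_def2)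
  have m: "case_sum (innov e) (innov_copy e) i \<in> borel_measurable (M \<Otimes>\<^sub>M M)" for i
    by (cases i) (auto simp: innov_def innov_copy_def)
  have prob_times: "P.prob (U \<times> V) = prob U * prob V" if "U \<in> events" "V \<in> events" for U V
    using that by (simp add: measure_def emeasure_pair_measure_Times enn2real_mult)
  show ?thesis
  proof (subst P.indep_vars_def2, intro conjI ballI m P.indep_setsI)
    fix i :: "int + int"
    show "{case_sum (innov e) (innov_copy e) i -` A \<inter> space (M \<Otimes>\<^sub>M M) |A. A \<in> sets borel} \<subseteq> P.events"
      using measurable_sets[OF m] by auto
  next
    fix A :: "int + int \<Rightarrow> ('a \<times> 'a) set" and J :: "(int + int) set"
    assume J: "J \<noteq> {}" "J \<subseteq> UNIV" "finite J"
      and A: "\<forall>j\<in>J. A j \<in> {case_sum (innov e) (innov_copy e) j -` A \<inter> space (M \<Otimes>\<^sub>M M) |A. A \<in> sets borel}"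
    then obtain B where B: "\<And>j. j \<in> J \<Longrightarrow> B j \<in> sets borel"
        "\<And>j. j \<in> J \<Longrightarrow> A j = case_sum (innov e) (innov_copy e) j -` B j \<inter> space (M \<Otimes>\<^sub>M M)"
      by (simp add: Ball_def) metis
    define K L where "K = {j. Inl j \<in> J}" and "L = {j. Inr j \<in> J}"
    have Jeq: "J = Inl ` K \<union> Inr ` L"
      proof (rule Set.set_eqI)
      fix x show "x \<in> J \<longleftrightarrow> x \<in> Inl ` K \<union> Inr ` L"
        unfolding K_def L_def by (cases x) auto
    qed
    have fin: "finite K" "finite L"
      using J(3) unfolding Jeq by (auto simp: finite_image_iff)
    define E where "E s j = e j -` B (s j) \<inter> space M" for s :: "int \<Rightarrow> int + int" and j
    define F where "F s H = (\<Inter>j\<in>H. E s j) \<inter> space M" for s :: "int \<Rightarrow> int + int" and H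
    have E: "E Inl j \<in> events" if "j \<in> K" for j
      using that B(1)[of "Inl j"] unfolding E_def K_def by (auto intro: measurable_sets[OF em])
    have E': "E Inr j \<in> events" if "j \<in> L" for j
      using that B(1)[of "Inr j"] unfolding E_def L_def by (auto intro: measurable_sets[OF em])
    have indep: "prob (F s H) = (\<Prod>j\<in>H. prob (E s j))"
      if "finite H" "\<And>j. j \<in> H \<Longrightarrow> B (s j) \<in> sets borel" for s H
    proof (cases "H = {}")
      case True
      then show ?thesis by (simp add: F_def prob_space)
    next
      case False
      have "F s H = (\<Inter>j\<in>H. E s j)"
        using False by (auto simp: F_def E_def)
      moreover have "prob (\<Inter>j\<in>H. E s j) = (\<Prod>j\<in>H. prob (E s j))"
        unfolding E_def by (rule indep_varsD[OF e]) (use that False in auto)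
      ultimately show ?thesis by simp
    qed
    have Fs: "F Inl K \<in> events" "F Inr L \<in> events"
      unfolding F_def using E E' fin
      by (cases "K = {}"; cases "L = {}"; auto intro!: sets.Int sets.finite_INT)+
    have "(\<Inter>j\<in>J. A j) = F Inl K \<times> F Inr L"
    proof (rule Set.set_eqI)
      fix w :: "'a \<times> 'a"
      have "w \<in> (\<Inter>j\<in>J. A j) \<longleftrightarrow> w \<in> space (M \<Otimes>\<^sub>M M) \<and>
          (\<forall>j\<in>J. case_sum (innov e) (innov_copy e) j w \<in> B j)"
        using J(1) B(2) by auto
      also have "\<dots> \<longleftrightarrow> w \<in> F Inl K \<times> F Inr L"
        by (cases w) (auto simp: F_def E_def Jeq ball_Un innov_def innov_copy_def space_pair_measure)
      finally show "w \<in> (\<Inter>j\<in>J. A j) \<longleftrightarrow> w \<in> F Inl K \<times> F Inr L" .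
    qed
    then have "P.prob (\<Inter>j\<in>J. A j) = prob (F Inl K) * prob (F Inr L)"
      using Fs by (simp add: prob_times)
    also have "\<dots> = (\<Prod>j\<in>K. prob (E Inl j)) * (\<Prod>j\<in>L. prob (E Inr j))"
      by (subst (1 2) indep) (use fin B(1) in \<open>auto simp: K_def L_def\<close>)
    also have "(\<Prod>j\<in>K. prob (E Inl j)) = (\<Prod>j\<in>K. P.prob (A (Inl j)))"
    proof (rule prod.cong)
      fix j assume j: "j \<in> K"
      then have "A (Inl j) = E Inl j \<times> space M"
        using B(2)[of "Inl j"] by (auto simp: K_def E_def innov_def space_pair_measure)
      then show "prob (E Inl j) = P.prob (A (Inl j))"
        using E[OF j] by (simp add: prob_times prob_space)
    qed simp
    also have "(\<Prod>j\<in>L. prob (E Inr j)) = (\<Prod>j\<in>L. P.prob (A (Inr j)))"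
    proof (rule prod.cong)
      fix j assume j: "j \<in> L"
      then have "A (Inr j) = space M \<times> E Inr j"
        using B(2)[of "Inr j"] by (auto simp: L_def E_def innov_copy_def space_pair_measure)
      then show "prob (E Inr j) = P.prob (A (Inr j))"
        using E'[OF j] by (simp add: prob_times prob_space)
    qed simp
    also have "(\<Prod>j\<in>K. P.prob (A (Inl j))) * (\<Prod>j\<in>L. P.prob (A (Inr j))) = (\<Prod>j\<in>J. P.prob (A j))"
      unfolding Jeq using fin
      by (subst prod.union_disjoint) (auto simp: prod.reindex)
    finally show "P.prob (\<Inter>j\<in>J. A j) = (\<Prod>j\<in>J. P.prob (A j))" .
  qed
qed

lemma distr_innov:
  assumes M: "prob_space M" and e: "e j \<in> borel_measurable M"
  shows "distr (M \<Otimes>\<^sub>M M) borel (innov e j) = distr M borel (e j)"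
    and "distr (M \<Otimes>\<^sub>M M) borel (innov_copy e j) = distr M borel (e j)"
proof -
  interpret prob_space M by fact
  interpret P: pair_prob_space M M ..
  have fst: "distr (M \<Otimes>\<^sub>M M) M fst = M"
    by (rule distr_pair_fst)
  have snd: "distr (M \<Otimes>\<^sub>M M) M snd = M"
    by (subst P.distr_pair_swap) (simp add: distr_distr comp_def case_prod_beta' distr_pair_fst)
  show "distr (M \<Otimes>\<^sub>M M) borel (innov e j) = distr M borel (e j)"
    using e by (subst (2) fst[symmetric]) (simp add: distr_distr comp_def innov_def)
  show "distr (M \<Otimes>\<^sub>M M) borel (innov_copy e j) = distr M borel (e j)"
    using e by (subst (2) snd[symmetric]) (simp add: distr_distr comp_def innov_copy_def)
qed

definition coupled ::
  "(int \<Rightarrow> 'a \<Rightarrow> real) \<Rightarrow> (int \<Rightarrow> (nat \<Rightarrow> real) \<Rightarrow> real) \<Rightarrow> int \<Rightarrow> nat \<Rightarrow> 'a \<times> 'a \<Rightarrow> real" where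
  "coupled e g i k w =
     g i (\<lambda>n. if n = k then innov_copy e (i - int n) w else innov e (i - int n) w)"

definition dep_measure ::
  "'a measure \<Rightarrow> (int \<Rightarrow> 'a \<Rightarrow> real) \<Rightarrow> (int \<Rightarrow> 'a \<Rightarrow> real) \<Rightarrow> (int \<Rightarrow> (nat \<Rightarrow> real) \<Rightarrow> real) \<Rightarrow>
     real \<Rightarrow> nat \<Rightarrow> ennreal" where
  "dep_measure M X e g m k =
     (SUP i. Lnorm (M \<Otimes>\<^sub>M M) m (\<lambda>w. X i (fst w) - coupled e g i k w))"

text \<open>All conditions \<open>O(1)\<close> are asymptotic in the sample size \<open>T\<close>; the innovations and the
  functions \<open>g\<close> may depend on \<open>T\<close>.\<close>

definition short_range_dependent ::
  "(nat \<Rightarrow> 'a measure) \<Rightarrow> (nat \<Rightarrow> int \<Rightarrow> 'a \<Rightarrow> real) \<Rightarrow> real \<Rightarrow> real \<Rightarrow> bool" where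
  "short_range_dependent M X m \<alpha> \<longleftrightarrow>
     4 \<le> m \<and> 1 < \<alpha> \<and>
     (\<forall>T\<ge>1. \<forall>i. has_bochner_integral (M T) (X T i) 0) \<and>
     (\<exists>C\<^sub>1::real. \<forall>\<^sub>F T in sequentially. (SUP i. Lnorm (M T) m (X T i)) \<le> ennreal C\<^sub>1) \<and>
     (\<exists>e g. (\<forall>T\<ge>1. causal_representation (M T) (X T) (e T) (g T)) \<and>
       (\<exists>C\<^sub>2::real. \<forall>\<^sub>F T in sequentially.
          (SUP k. ennreal ((1 + real k) powr \<alpha>) * (\<Sum>l. dep_measure (M T) (X T) (e T) (g T) m (k + l)))
            \<le> ennreal C\<^sub>2))"

text \<open>Matrices and vectors of the library are indexed from \<open>0\<close>; coefficients \<open>a\<^sub>j\<close>, \<open>b\<^sub>j\<^sub>k\<close>, \<open>Z\<^sub>i\<^sub>,\<^sub>j\<close> keep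
  their range \<open>j = 1, \<dots>, p\<close>.\<close>

definition toeplitz :: "nat \<Rightarrow> (nat \<Rightarrow> real) \<Rightarrow> real mat" where
  "toeplitz p s = Matrix.mat p p (\<lambda>(j, k). s (nat \<bar>int j - int k\<bar>))"

definition lag_vec :: "nat \<Rightarrow> (nat \<Rightarrow> real) \<Rightarrow> real vec" where
  "lag_vec p s = Matrix.vec p (\<lambda>j. s (j + 1))"

definition pseudo_inverse :: "real mat \<Rightarrow> real mat" where
  "pseudo_inverse A = (THE G. G \<in> carrier_mat (dim_col A) (dim_row A) \<and>
     A * G * A = A \<and> G * A * G = G \<and>
     transpose_mat (A * G) = A * G \<and> transpose_mat (G * A) = G * A)"

definition ar_coeffs :: "nat \<Rightarrow> (nat \<Rightarrow> real) \<Rightarrow> (nat \<Rightarrow> real) \<Rightarrow> bool" where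
  "ar_coeffs p s a \<longleftrightarrow>
     (\<forall>k\<in>{1..p}. s k = (\<Sum>j=1..p. a j * s (nat \<bar>int k - int j\<bar>)))"

definition sample_acov :: "nat \<Rightarrow> (int \<Rightarrow> 'a \<Rightarrow> real) \<Rightarrow> 'a \<Rightarrow> nat \<Rightarrow> real" where
  "sample_acov T X \<omega> j = 1 / real T * (\<Sum>i=j+1..T. X (int i) \<omega> * X (int i - int j) \<omega>)"

definition yule_walker :: "nat \<Rightarrow> nat \<Rightarrow> (int \<Rightarrow> 'a \<Rightarrow> real) \<Rightarrow> nat \<Rightarrow> 'a \<Rightarrow> real" where
  "yule_walker T p X j \<omega> =
     (pseudo_inverse (toeplitz p (sample_acov T X \<omega>)) *\<^sub>v lag_vec p (sample_acov T X \<omega>)) $ (j - 1)"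

text \<open>\<open>b_col p s k\<close> is the column \<open>\<^bold>b\<^sub>k\<close> of \<open>B\<close>, with \<open>\<Sigma> = toeplitz p s\<close> assumed invertible.\<close>

definition diag_mat_lag :: "nat \<Rightarrow> nat \<Rightarrow> real mat" where
  "diag_mat_lag p i = Matrix.mat p p (\<lambda>(j, k). if nat \<bar>int j - int k\<bar> = i then 1 else 0)"

definition b_col :: "nat \<Rightarrow> (nat \<Rightarrow> real) \<Rightarrow> nat \<Rightarrow> real vec" where
  "b_col p s k =
     (let S = the (mat_inverse (toeplitz p s)); \<gamma> = lag_vec p s in
      if k = 0 then - ((S * S) *\<^sub>v \<gamma>)
      else if k < p then S *\<^sub>v unit_vec p (k - 1) - (S * diag_mat_lag p k * S) *\<^sub>v \<gamma>
      else S *\<^sub>v unit_vec p (p - 1))"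

definition b_coeff :: "nat \<Rightarrow> (nat \<Rightarrow> real) \<Rightarrow> nat \<Rightarrow> nat \<Rightarrow> real" where
  "b_coeff p s j k = b_col p s k $ (j - 1)"

definition Z_lin :: "'a measure \<Rightarrow> (int \<Rightarrow> 'a \<Rightarrow> real) \<Rightarrow> nat \<Rightarrow> int \<Rightarrow> nat \<Rightarrow> 'a \<Rightarrow> real" where
  "Z_lin M X p i j \<omega> =
     (\<Sum>k=0..p. b_coeff p (acov M X) j k * (X i \<omega> * X (i - int k) \<omega> - acov M X k))"

text \<open>The covariance matrix may be singular, so normal includes almost surely constant.\<close>

definition normal_rv :: "'b measure \<Rightarrow> ('b \<Rightarrow> real) \<Rightarrow> bool" where
  "normal_rv N Y \<longleftrightarrow>
     (\<exists>\<mu> s. 0 < s \<and> distributed N lborel Y (\<lambda>x. ennreal (normal_density \<mu> s x))) \<or>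
     (\<exists>\<mu>. Y \<in> borel_measurable N \<and> (AE \<omega> in N. Y \<omega> = \<mu>))"

definition jointly_normal :: "'b measure \<Rightarrow> nat \<Rightarrow> (nat \<Rightarrow> 'b \<Rightarrow> real) \<Rightarrow> bool" where
  "jointly_normal N p \<xi> \<longleftrightarrow> (\<forall>c. normal_rv N (\<lambda>\<omega>. \<Sum>j=1..p. c j * \<xi> j \<omega>))"

end

theory Submission
  imports Defs "HOL-Real_Asymp.Real_Asymp"
begin

text \<open>Write \<open>Y\<^sub>i\<close> for a fixed linear combination of \<open>Z\<^sub>i\<^sub>,\<^sub>1, \<dots>, Z\<^sub>i\<^sub>,\<^sub>p\<close>. Replacing all innovations up to time \<open>i - l\<close>
  by an independent copy changes \<open>Y\<^sub>i\<close> by \<open>O(l\<^sup>-\<^sup>2)\<close> in \<open>L\<^sup>2\<close>, by a telescoping sum over the single replacements. Hence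
  covariances decay like \<open>l\<^sup>-\<^sup>2\<close>, and blocks of length \<open>T\<^sup>0\<^sup>.\<^sup>3\<close> separated by gaps of length \<open>T\<^sup>0\<^sup>.\<^sup>2\<^sup>5\<close> are nearly
  independent, so \<open>E exp(i T\<^sup>-\<^sup>1\<^sup>/\<^sup>2 \<Sum>Y\<^sub>i)\<close> is close to \<open>exp(- Var / 2)\<close> whether or not the variance degenerates. The
  Yule-Walker error is \<open>T\<^sup>-\<^sup>1\<^sup>/\<^sup>2 \<Sum>Z\<^sub>i\<^sub>,\<^sub>j\<close> up to a term that vanishes in probability. Therefore all expectations of
  cosines of linear combinations agree in the limit for the error vector and for \<open>\<xi>\<close>. Indicators of cubes are
  approximated by products of even trigonometric polynomials, and since every \<open>\<xi>\<^sub>j\<close> has variance at least \<open>C\<^sup>2\<close>,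
  the law of \<open>max |\<xi>\<^sub>j|\<close> has a bounded density, which makes the comparison uniform.\<close>

subsection \<open>Moment bounds\<close>

text \<open>The process, the order \<open>p\<close> and the covariances all change with
  \<open>T\<close>, so there is no limit law and no continuity theorem to invoke. Every estimate
  compares two quantities at the same \<open>T\<close>, with an error built from constants
  \<open>K\<close>, \<open>c\<close>, \<open>C\<close>, \<open>D\<close> that serve all large
  \<open>T\<close>. The variance is never asked to converge, and it has to stay away from zero only
  in the Lipschitz bound for the law of the maximum. Cosines alone suffice because a cube is
  symmetric in each coordinate. Eighth moments of \<open>X\<close> give fourth moments of the
  products, and these control the third absolute moment of a block sum in its Taylor expansion.
  Dependence is handled on the law of the innovations, by exchanging coordinates of two independent
  copies; no conditional expectations occur. On the algebraic side the coefficients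
  \<open>b_coeff\<close> are the partial derivatives of \<Sigma>^{-1} \<gamma> in the
  autocovariances, so that \<open>Z_lin\<close> is the first-order term of a delta method.\<close>

definition Lp_le :: "'a measure \<Rightarrow> nat \<Rightarrow> ('a \<Rightarrow> real) \<Rightarrow> real \<Rightarrow> bool" where
  "Lp_le M n f K \<longleftrightarrow> f \<in> borel_measurable M \<and> 0 \<le> K \<and>
     integrable M (\<lambda>x. \<bar>f x\<bar> ^ n) \<and> (\<integral>x. \<bar>f x\<bar> ^ n \<partial>M) \<le> K ^ n"

text \<open>The inequalities \<open>Lp_le_add\<close>, \<open>Lp_le_mult\<close> and
  \<open>Lp_le_Lnorm\<close> all end by integrating a pointwise majorant; integrability of
  \<open>h\<close> supplies that of the moment.\<close>

lemma Lp_leI_bound: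
  assumes f: "f \<in> borel_measurable M" and K: "0 \<le> K"
    and h: "integrable M h" "(\<integral>x. h x \<partial>M) \<le> K ^ n" "\<And>x. x \<in> space M \<Longrightarrow> \<bar>f x\<bar> ^ n \<le> h x"
  shows "Lp_le M n f K"
proof -
  have i: "integrable M (\<lambda>x. \<bar>f x\<bar> ^ n)"
    by (rule Bochner_Integration.integrable_bound[OF h(1)])
       (use f in measurable, auto intro!: AE_I2 order_trans[OF h(3)])
  have "(\<integral>x. \<bar>f x\<bar> ^ n \<partial>M) \<le> (\<integral>x. h x \<partial>M)"
    by (rule integral_mono[OF i h(1) h(3)])
  with i f K h(2) show ?thesis unfolding Lp_le_def by auto
qed

lemma Lp_le_mono: "Lp_le M n f K \<Longrightarrow> K \<le> K' \<Longrightarrow> Lp_le M n f K'"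
  unfolding Lp_le_def by (auto intro: order_trans[OF _ power_mono])

lemma Lp_le_nonneg: "Lp_le M n f K \<Longrightarrow> 0 \<le> K"
  by (simp add: Lp_le_def)

lemma Lp_le_measurable: "Lp_le M n f K \<Longrightarrow> f \<in> borel_measurable M"
  by (simp add: Lp_le_def)

text \<open>A bound with arbitrary slack suffices. The larger constants are positive, so later
  proofs may divide by them and need no separate case for a vanishing norm. Recording an upper bound
  instead of the norm keeps measurability, integrability and the estimate together.\<close>

lemma Lp_le_closure:
  assumes "0 \<le> K" "\<And>K'. K < K' \<Longrightarrow> Lp_le M n f K'"
  shows "Lp_le M n f K"
proof -
  have "Lp_le M n f (K + 1)" using assms by auto
  moreover have "(\<integral>x. \<bar>f x\<bar> ^ n \<partial>M) \<le> K ^ n"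
  proof (rule tendsto_lowerbound)
    show "((\<lambda>k. k ^ n) \<longlongrightarrow> K ^ n) (at_right K)" by (intro tendsto_intros)
    show "\<forall>\<^sub>F k in at_right K. (\<integral>x. \<bar>f x\<bar> ^ n \<partial>M) \<le> k ^ n"
      using assms(2) unfolding Lp_le_def by (auto simp: eventually_at_filter)
  qed simp
  ultimately show ?thesis using assms unfolding Lp_le_def by auto
qed

lemma Lp_le_cong:
  assumes "\<And>x. x \<in> space M \<Longrightarrow> f x = g x" shows "Lp_le M n f K \<longleftrightarrow> Lp_le M n g K"
  unfolding Lp_le_def using assms
  by (simp cong: measurable_cong Bochner_Integration.integrable_cong Bochner_Integration.integral_cong)

lemma Lp_le_distr:
  assumes [measurable]: "g \<in> measurable M N" "f \<in> borel_measurable N"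
  shows "Lp_le (distr M N g) n f K \<longleftrightarrow> Lp_le M n (\<lambda>x. f (g x)) K"
  unfolding Lp_le_def by (simp add: integrable_distr_eq integral_distr)

lemma Lp_le_cmult:
  assumes "Lp_le M n f K" shows "Lp_le M n (\<lambda>x. c * f x) (\<bar>c\<bar> * K)"
  using assms unfolding Lp_le_def
  by (auto simp: abs_mult power_mult_distrib intro!: mult_left_mono)

lemma Lp_le_minus: "Lp_le M n f K \<Longrightarrow> Lp_le M n (\<lambda>x. - f x) K"
  unfolding Lp_le_def by auto

lemma convex_power_abs:
  fixes t a b :: real assumes "0 \<le> t" "t \<le> 1" "0 \<le> a" "0 \<le> b"
  shows "(t * a + (1 - t) * b) ^ n \<le> t * a ^ n + (1 - t) * b ^ n"
proof -
  have "convex_on {0..} (\<lambda>x::real. x ^ n)"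
    by (cases "even n") (auto intro: convex_power_odd convex_on_subset[OF convex_power_even])
  from convex_onD[OF this, of "1-t" a b] assms show ?thesis by (simp add: algebra_simps)
qed

text \<open>Minkowski's inequality from convexity of the power: with \<open>A' + B' = K\<close> the
  sum is at most \<open>K\<close> times a convex combination of \<open>\<bar>f x\<bar> / A'\<close>
  and \<open>\<bar>g x\<bar> / B'\<close>, whose \<open>n\<close>-th moments are at most 1.\<close>

lemma Lp_le_add:
  assumes f: "Lp_le M n f A" and g: "Lp_le M n g B"
  shows "Lp_le M n (\<lambda>x. f x + g x) (A + B)"
proof (rule Lp_le_closure)
  have f0: "0 \<le> A" "0 \<le> B" and [measurable]: "f \<in> borel_measurable M" "g \<in> borel_measurable M"
    using f g by (auto simp: Lp_le_def)
  then show "0 \<le> A + B" by simp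
  fix K assume K: "A + B < K"
  \<comment> \<open>Each function receives half of the slack, so both constants become positive and
    add up to \<open>K\<close>.\<close>
  define e where "e = (K - (A + B)) / 2"
  define A' B' t where "A' = A + e" and "B' = B + e" and "t = A' / K"
  have pos: "A' > 0" "B' > 0" "K = A' + B'" "K > 0"
    using K f0 by (auto simp: A'_def B'_def e_def field_simps)
  have t: "0 \<le> t" "t \<le> 1" "1 - t = B' / K" using pos by (auto simp: t_def field_simps)
  have "A ^ n \<le> A' ^ n" "B ^ n \<le> B' ^ n"
    using f0 K by (auto simp: A'_def B'_def e_def intro!: power_mono)
  then have i: "integrable M (\<lambda>x. \<bar>f x\<bar> ^ n)" "(\<integral>x. \<bar>f x\<bar> ^ n \<partial>M) \<le> A' ^ n"
     "integrable M (\<lambda>x. \<bar>g x\<bar> ^ n)" "(\<integral>x. \<bar>g x\<bar> ^ n \<partial>M) \<le> B' ^ n"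
    using f g by (auto simp: Lp_le_def)
  let ?h = "\<lambda>x. K ^ n * (t * (\<bar>f x\<bar> ^ n / A' ^ n) + (1 - t) * (\<bar>g x\<bar> ^ n / B' ^ n))"
  show "Lp_le M n (\<lambda>x. f x + g x) K"
  proof (rule Lp_leI_bound[where h = ?h])
    show "integrable M ?h" using i by auto
    have "(\<integral>x. ?h x \<partial>M) = K ^ n * (t * ((\<integral>x. \<bar>f x\<bar> ^ n \<partial>M) / A' ^ n) + (1 - t) * ((\<integral>x. \<bar>g x\<bar> ^ n \<partial>M) / B' ^ n))"
      using i by simp
    also have "\<dots> \<le> K ^ n * (t * 1 + (1 - t) * 1)"
      by (intro mult_left_mono add_mono) (use i t pos in \<open>auto\<close>)
    finally show "(\<integral>x. ?h x \<partial>M) \<le> K ^ n" by simp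
    fix x
    have "\<bar>f x + g x\<bar> \<le> K * (t * (\<bar>f x\<bar> / A') + (1 - t) * (\<bar>g x\<bar> / B'))"
    proof -
      have "K * (t * (\<bar>f x\<bar> / A')) = \<bar>f x\<bar>" "K * ((1 - t) * (\<bar>g x\<bar> / B')) = \<bar>g x\<bar>"
        using pos unfolding t(3) by (simp_all add: t_def)
      then show ?thesis unfolding distrib_left by simp
    qed
    then have "\<bar>f x + g x\<bar> ^ n \<le> (K * (t * (\<bar>f x\<bar> / A') + (1 - t) * (\<bar>g x\<bar> / B'))) ^ n"
      by (rule power_mono) simp
    also have "\<dots> \<le> K ^ n * (t * (\<bar>f x\<bar> / A') ^ n + (1 - t) * (\<bar>g x\<bar> / B') ^ n)"
      unfolding power_mult_distrib[of K]
      by (intro mult_left_mono convex_power_abs) (use t pos in auto)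
    finally show "\<bar>f x + g x\<bar> ^ n \<le> ?h x" by (simp add: power_divide)
  qed (use pos in auto)
qed

lemma Lp_le_diff: "Lp_le M n f A \<Longrightarrow> Lp_le M n g B \<Longrightarrow> Lp_le M n (\<lambda>x. f x - g x) (A + B)"
  using Lp_le_add[OF _ Lp_le_minus, of M n f A g B] by simp

lemma Lp_le_zero: "n > 0 \<Longrightarrow> Lp_le M n (\<lambda>x. 0) 0"
  by (simp add: Lp_le_def power_0_left)

lemma Lp_le_sum:
  assumes "n > 0" "\<And>i. i \<in> I \<Longrightarrow> Lp_le M n (f i) (K i)"
  shows "Lp_le M n (\<lambda>x. \<Sum>i\<in>I. f i x) (\<Sum>i\<in>I. K i)"
  using assms(2) by (induction I rule: infinite_finite_induct) (auto intro!: Lp_le_add Lp_le_zero assms(1))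

text \<open>Cauchy-Schwarz in normalised form: the scaled factors satisfy
  \<open>u * v \<le> (u ^ 2 + v ^ 2) / 2\<close>, and both squares have mean at most 1.\<close>

lemma Lp_le_mult:
  assumes f: "Lp_le M (2 * n) f A" and g: "Lp_le M (2 * n) g B"
  shows "Lp_le M n (\<lambda>x. f x * g x) (A * B)"
proof -
  have f0: "0 \<le> A" "0 \<le> B" and [measurable]: "f \<in> borel_measurable M" "g \<in> borel_measurable M"
    using f g by (auto simp: Lp_le_def)
  have *: "Lp_le M n (\<lambda>x. f x * g x) ((A + e) * (B + e))" if e: "e > 0" for e
  proof -
    define A' B' where "A' = A + e" and "B' = B + e"
    have pos: "A' > 0" "B' > 0" using e f0 by (auto simp: A'_def B'_def)
    have "A ^ (2*n) \<le> A' ^ (2*n)" "B ^ (2*n) \<le> B' ^ (2*n)"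
      using f0 e by (auto simp: A'_def B'_def intro!: power_mono)
    then have i: "integrable M (\<lambda>x. \<bar>f x\<bar> ^ (2*n))" "(\<integral>x. \<bar>f x\<bar> ^ (2*n) \<partial>M) \<le> A' ^ (2*n)"
       "integrable M (\<lambda>x. \<bar>g x\<bar> ^ (2*n))" "(\<integral>x. \<bar>g x\<bar> ^ (2*n) \<partial>M) \<le> B' ^ (2*n)"
      using f g by (auto simp: Lp_le_def)
    let ?h = "\<lambda>x. (A' * B') ^ n * ((\<bar>f x\<bar> ^ (2*n) / A' ^ (2*n) + \<bar>g x\<bar> ^ (2*n) / B' ^ (2*n)) / 2)"
    show ?thesis unfolding A'_def[symmetric] B'_def[symmetric]
    proof (rule Lp_leI_bound[where h = ?h])
      show "integrable M ?h" using i by auto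
      have "(\<integral>x. ?h x \<partial>M) = (A' * B') ^ n * (((\<integral>x. \<bar>f x\<bar> ^ (2*n) \<partial>M) / A' ^ (2*n) + (\<integral>x. \<bar>g x\<bar> ^ (2*n) \<partial>M) / B' ^ (2*n)) / 2)"
        using i by simp
      also have "\<dots> \<le> (A' * B') ^ n * ((1 + 1) / 2)"
        by (intro mult_left_mono divide_right_mono add_mono) (use i pos in \<open>auto\<close>)
      finally show "(\<integral>x. ?h x \<partial>M) \<le> (A' * B') ^ n" by simp
      fix x
      define u v where "u = \<bar>f x\<bar> ^ n / A' ^ n" and "v = \<bar>g x\<bar> ^ n / B' ^ n"
      have "\<bar>f x * g x\<bar> ^ n = (A' * B') ^ n * (u * v)"
        using pos by (simp add: u_def v_def abs_mult power_mult_distrib)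
      also have "u * v \<le> (u ^ 2 + v ^ 2) / 2"
        using sum_squares_bound[of u v] by simp
      finally show "\<bar>f x * g x\<bar> ^ n \<le> ?h x" using pos
        by (simp add: u_def v_def power_divide power_mult[symmetric] mult.commute)
    qed (use pos in auto)
  qed
  show ?thesis
  proof (rule Lp_le_closure)
    fix K assume K: "A * B < K"
    have "((\<lambda>e. (A + e) * (B + e)) \<longlongrightarrow> (A + 0) * (B + 0)) (at_right 0)"
      by (intro tendsto_intros)
    then have "\<forall>\<^sub>F e in at_right 0. (A + e) * (B + e) < K"
      using K by (auto dest: order_tendstoD)
    moreover have "\<forall>\<^sub>F e in at_right (0::real). e > 0" by (auto simp: eventually_at_filter)
    ultimately have "\<forall>\<^sub>F e in at_right (0::real). e > 0 \<and> (A + e) * (B + e) < K" by eventually_elim auto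
    then obtain e where "e > 0" "(A + e) * (B + e) < K"
      using eventually_happens'[OF trivial_limit_at_right_real] by blast
    then show "Lp_le M n (\<lambda>x. f x * g x) K" using *[of e] Lp_le_mono by fastforce
  qed (use f0 in auto)
qed

lemma Lp_le_integrable: "Lp_le M 1 f K \<Longrightarrow> integrable M f"
  unfolding Lp_le_def by (auto simp: integrable_abs_iff)

lemma Lp_le_integral: "Lp_le M 1 f K \<Longrightarrow> \<bar>\<integral>x. f x \<partial>M\<bar> \<le> K"
  unfolding Lp_le_def by (auto intro: order_trans[OF integral_abs_bound])

lemma (in prob_space) Lp_le_const: "Lp_le M n (\<lambda>x. c) \<bar>c\<bar>"
  by (simp add: Lp_le_def prob_space)

text \<open>Cauchy-Schwarz against the constant 1. Below, moments occur with the exponents 8, 4, 2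
  and 1, so halving is the comparison that is needed.\<close>

lemma (in prob_space) Lp_le_halve:
  assumes "Lp_le M (2 * n) f K" shows "Lp_le M n f K"
  using Lp_le_mult[OF assms, of "\<lambda>_. 1" 1] Lp_le_const[of "2*n" 1] by simp

lemma (in prob_space) Lp_le_2_1: "Lp_le M 2 f K \<Longrightarrow> Lp_le M 1 f K"
  using Lp_le_halve[of 1] by simp

lemma (in prob_space) Lp_le_4_2: "Lp_le M 4 f K \<Longrightarrow> Lp_le M 2 f K"
  using Lp_le_halve[of 2] by simp

lemma (in prob_space) Lp_le_8_4: "Lp_le M 8 f K \<Longrightarrow> Lp_le M 4 f K"
  using Lp_le_halve[of 4] by simp

text \<open>Carries the bound for finite telescoping sums over to their almost sure limit;
  integrability of the limit is part of the conclusion.\<close>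

lemma Lp_le_Fatou:
  assumes u: "\<And>k. Lp_le M n (u k) K" and f[measurable]: "f \<in> borel_measurable M"
    and lim: "AE x in M. (\<lambda>k. u k x) \<longlonglongrightarrow> f x"
  shows "Lp_le M n f K"
proof -
  have K: "0 \<le> K" and [measurable]: "\<And>k. u k \<in> borel_measurable M" using u by (auto simp: Lp_le_def)
  have "(\<integral>\<^sup>+x. ennreal (\<bar>f x\<bar> ^ n) \<partial>M) = (\<integral>\<^sup>+x. liminf (\<lambda>k. ennreal (\<bar>u k x\<bar> ^ n)) \<partial>M)"
  proof (rule nn_integral_cong_AE, use lim in eventually_elim)
    fix x assume "(\<lambda>k. u k x) \<longlonglongrightarrow> f x"
    then have "(\<lambda>k. ennreal (\<bar>u k x\<bar> ^ n)) \<longlonglongrightarrow> ennreal (\<bar>f x\<bar> ^ n)"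
      by (intro tendsto_intros) auto
    then show "ennreal (\<bar>f x\<bar> ^ n) = liminf (\<lambda>k. ennreal (\<bar>u k x\<bar> ^ n))"
      by (intro lim_imp_Liminf[symmetric]) auto
  qed
  also have "\<dots> \<le> liminf (\<lambda>k. \<integral>\<^sup>+x. ennreal (\<bar>u k x\<bar> ^ n) \<partial>M)"
    by (rule nn_integral_liminf) simp
  also have "\<dots> \<le> liminf (\<lambda>k::nat. ennreal (K ^ n))"
  proof (rule Liminf_mono, rule always_eventually, rule allI)
    fix k show "(\<integral>\<^sup>+x. ennreal (\<bar>u k x\<bar> ^ n) \<partial>M) \<le> ennreal (K ^ n)"
      using u[of k] by (subst nn_integral_eq_integral) (auto simp: Lp_le_def)
  qed
  also have "\<dots> = ennreal (K ^ n)" by (simp add: Liminf_const)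
  finally have *: "(\<integral>\<^sup>+x. ennreal (\<bar>f x\<bar> ^ n) \<partial>M) \<le> ennreal (K ^ n)" .
  then have i: "integrable M (\<lambda>x. \<bar>f x\<bar> ^ n)"
    by (intro integrableI_bounded) (auto simp: power_abs intro: le_less_trans)
  have "(\<integral>x. \<bar>f x\<bar> ^ n \<partial>M) \<le> K ^ n"
    using * K by (subst (asm) nn_integral_eq_integral[OF i]) auto
  with i K show ?thesis by (simp add: Lp_le_def)
qed

lemma Lnorm_imp_nn_integral_le:
  assumes "Lnorm M m f \<le> ennreal K" "m > 0" "K \<ge> 0"
  shows "(\<integral>\<^sup>+x. ennreal (\<bar>f x\<bar> powr m) \<partial>M) \<le> ennreal (K powr m)"
proof -
  define I where "I = (\<integral>\<^sup>+x. ennreal (\<bar>f x\<bar> powr m) \<partial>M)"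
  have I: "I \<noteq> \<infinity>" "ennreal (enn2real I powr (1/m)) \<le> ennreal K"
    using assms by (auto simp: Lnorm_def I_def[symmetric] Let_def top_unique split: if_splits)
  then have "enn2real I powr (1/m) \<le> K" using assms by simp
  then have "(enn2real I powr (1/m)) powr m \<le> K powr m" using assms by (intro powr_mono2) auto
  then have "enn2real I \<le> K powr m" using assms by (simp add: powr_powr)
  then have "ennreal (enn2real I) \<le> ennreal (K powr m)" by (rule ennreal_leI)
  then show ?thesis using I by (simp add: I_def[symmetric] ennreal_enn2real_if)
qed

text \<open>Jensen's inequality, obtained by integrating \<open>u\<^sup>s \<le> 1 + s (u - 1)\<close> with \<open>u = (|f| / K)\<^sup>m\<close>, \<open>s = n / m\<close>.\<close>

lemma (in prob_space) Lp_le_Lnorm: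
  assumes L: "Lnorm M m f \<le> ennreal K" and m: "0 < n" "real n \<le> m" and K: "K \<ge> 0"
    and f[measurable]: "f \<in> borel_measurable M"
  shows "Lp_le M n f K"
proof (rule Lp_le_closure[OF K])
  fix K' assume K': "K < K'"
  have m0: "m > 0" using m by linarith
  have *: "(\<integral>\<^sup>+x. ennreal (\<bar>f x\<bar> powr m) \<partial>M) \<le> ennreal (K' powr m)"
    by (rule order_trans[OF Lnorm_imp_nn_integral_le[OF L m0 K]]) (use K K' m0 in \<open>auto intro!: ennreal_leI powr_mono2\<close>)
  then have i: "integrable M (\<lambda>x. \<bar>f x\<bar> powr m)"
    by (intro integrableI_bounded) (auto intro: le_less_trans)
  have le: "(\<integral>x. \<bar>f x\<bar> powr m \<partial>M) \<le> K' powr m"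
    using * by (subst (asm) nn_integral_eq_integral[OF i]) auto
  define s where "s = real n / m"
  have s: "0 \<le> s" "s \<le> 1" "m * s = real n" using m m0 by (auto simp: s_def)
  let ?h = "\<lambda>x. K' ^ n * (1 + s * (\<bar>f x\<bar> powr m / K' powr m - 1))"
  show "Lp_le M n f K'"
  proof (rule Lp_leI_bound[where h = ?h])
    show "integrable M ?h" using i by auto
    have "(\<integral>x. ?h x \<partial>M) = K' ^ n * (1 + s * ((\<integral>x. \<bar>f x\<bar> powr m \<partial>M) / K' powr m - 1))"
      using i by (simp add: prob_space)
    also have "\<dots> \<le> K' ^ n * (1 + s * 0)"
      by (intro mult_left_mono add_left_mono) (use le K K' s in \<open>auto simp: divide_le_eq\<close>)
    finally show "(\<integral>x. ?h x \<partial>M) \<le> K' ^ n" by simp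
    fix x
    define u where "u = (\<bar>f x\<bar> / K') powr m"
    have u0: "u \<ge> 0" by (simp add: u_def)
    have "u powr s \<le> 1 + s * (u - 1)"
    proof (cases "u = 0")
      case False
      then have "u powr s * 1 powr (1 - s) \<le> s * u + (1 - s) * 1"
        by (intro Youngs_inequality_0) (use u0 s in auto)
      then show ?thesis by (simp add: algebra_simps)
    qed (use s in auto)
    moreover have "u powr s = \<bar>f x\<bar> ^ n / K' ^ n"
    proof -
      have "u powr s = (\<bar>f x\<bar> / K') powr real n"
        using s by (simp add: u_def powr_powr)
      \<comment> \<open>Positivity of \<open>n\<close> matters at a zero base:
        \<open>0 powr 0\<close> is 0, whereas \<open>0 ^ 0\<close> is 1.\<close>
      also have "\<dots> = (\<bar>f x\<bar> / K') ^ n" using K K' m(1)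
        by (cases "\<bar>f x\<bar> / K' = 0") (auto simp: powr_realpow)
      finally show ?thesis by (simp add: power_divide)
    qed
    moreover have "u = \<bar>f x\<bar> powr m / K' powr m" using K K' by (simp add: u_def powr_divide)
    ultimately show "\<bar>f x\<bar> ^ n \<le> ?h x" using K K' by (simp add: pos_divide_le_eq mult.commute)
  qed (use K K' in auto)
qed

subsection \<open>Resampling independent coordinates\<close>

text \<open>With \<open>y\<close> an independent copy of \<open>x\<close>, this is the noise
  resampled outside \<open>J\<close>. The single replacement of the dependence measure is
  \<open>J = - {i - int r}\<close>; replacing everything up to time \<open>i - l\<close> is
  \<open>J = {i - int l<..}\<close>.\<close>

definition mix :: "int set \<Rightarrow> (int \<Rightarrow> real) \<Rightarrow> (int \<Rightarrow> real) \<Rightarrow> int \<Rightarrow> real" where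
  "mix J x y = (\<lambda>j. if j \<in> J then x j else y j)"

abbreviation seqs :: "(int \<Rightarrow> real) measure" where
  "seqs \<equiv> Pi\<^sub>M UNIV (\<lambda>_. borel)"

text \<open>Exchanging the coordinates outside \<open>J\<close> between two independent copies of the noise preserves their joint
  law. This is the only form in which the independence of the innovations is used.\<close>

locale noise = prob_space P for P :: "(int \<Rightarrow> real) measure" +
  assumes sets_P[measurable_cong]: "sets P = sets seqs"
    and swap: "\<And>J. distr (P \<Otimes>\<^sub>M P) (P \<Otimes>\<^sub>M P) (\<lambda>w. (mix J (fst w) (snd w), mix J (snd w) (fst w))) = P \<Otimes>\<^sub>M P"

lemma measurable_mix[measurable (raw)]:
  assumes [measurable]: "f \<in> measurable N seqs" "g \<in> measurable N seqs"
  shows "(\<lambda>w. mix J (f w) (g w)) \<in> measurable N seqs"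
proof (rule measurable_PiM_single')
  fix j :: int
  have "(\<lambda>w. f w j) \<in> borel_measurable N" "(\<lambda>w. g w j) \<in> borel_measurable N" by measurable
  then show "(\<lambda>w. mix J (f w) (g w) j) \<in> borel_measurable N" by (simp add: mix_def)
qed auto

text \<open>The two copies form one product measure over the index set \<open>int + int\<close>.
  Exchanging coordinates is a permutation of the indices, and it preserves the measure because
  \<open>Inl j\<close> and \<open>Inr j\<close> carry the same marginal.\<close>

lemma noise_distr:
  fixes e :: "int \<Rightarrow> 'a \<Rightarrow> real"
  assumes M: "prob_space M" and e: "prob_space.indep_vars M (\<lambda>_. borel) e UNIV"
  shows "noise (distr M seqs (\<lambda>\<omega> j. e j \<omega>))"
proof -
  interpret prob_space M by fact
  interpret MM: pair_prob_space M M ..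
  have em[measurable]: "e j \<in> borel_measurable M" for j
    using e by (auto simp: indep_vars_def2)
  define E where "E = (\<lambda>\<omega> j. e j \<omega>)"
  have E[measurable]: "E \<in> measurable M seqs" unfolding E_def
    by (rule measurable_PiM_single') auto
  define P where "P = distr M seqs E"
  interpret P: prob_space P unfolding P_def by (rule prob_space_distr) fact
  interpret PP: pair_prob_space P P ..
  have sP[measurable_cong]: "sets P = sets seqs" by (simp add: P_def)
  define \<nu> :: "int + int \<Rightarrow> real measure" where "\<nu> = case_sum (\<lambda>i. distr M borel (e i)) (\<lambda>i. distr M borel (e i))"
  define W where "W = Pi\<^sub>M UNIV \<nu>"
  have \<nu>: "prob_space (\<nu> i)" "sets (\<nu> i) = sets borel" for i
    by (cases i; auto simp: \<nu>_def intro: prob_space_distr)+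
  have sW[measurable_cong]: "sets W = sets (Pi\<^sub>M UNIV (\<lambda>_. borel))"
    unfolding W_def by (rule sets_PiM_cong) (auto simp: \<nu>)
  define F where "F = (\<lambda>w i. case_sum (innov e) (innov_copy e) i w)"
  have rv: "MM.random_variable borel (case_sum (innov e) (innov_copy e) i)" for i
    by (cases i) (auto simp: innov_def innov_copy_def)
  have F[measurable]: "F \<in> measurable (M \<Otimes>\<^sub>M M) (Pi\<^sub>M UNIV (\<lambda>_. borel))"
    unfolding F_def by (rule measurable_PiM_single') (use rv in auto)
  have W: "distr (M \<Otimes>\<^sub>M M) (Pi\<^sub>M UNIV (\<lambda>_. borel)) F = W"
  proof -
    have "distr (M \<Otimes>\<^sub>M M) (Pi\<^sub>M UNIV (\<lambda>_. borel)) F =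
       Pi\<^sub>M UNIV (\<lambda>i. distr (M \<Otimes>\<^sub>M M) borel (case_sum (innov e) (innov_copy e) i))"
      using MM.indep_vars_iff_distr_eq_PiM[where I = UNIV and M' = "\<lambda>_. borel" and X = "case_sum (innov e) (innov_copy e)",
          THEN iffD1, OF _ rv indep_innov_copy[OF M e]]
      by (simp add: F_def restrict_def)
    also have "\<dots> = W" unfolding W_def
      by (rule PiM_cong) (auto simp: \<nu>_def distr_innov[OF M em] split: sum.splits)
    finally show ?thesis .
  qed
  \<comment> \<open>\<open>sp\<close> separates a family over \<open>int + int\<close> into the two
    copies; through it the product \<open>P \<Otimes>\<^sub>M P\<close> becomes an image of
    \<open>W\<close>.\<close>
  define sp :: "(int + int \<Rightarrow> real) \<Rightarrow> (int \<Rightarrow> real) \<times> (int \<Rightarrow> real)" where "sp = (\<lambda>z. (\<lambda>i. z (Inl i), \<lambda>i. z (Inr i)))"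
  have sp[measurable]: "sp \<in> measurable (Pi\<^sub>M UNIV (\<lambda>_. borel)) (seqs \<Otimes>\<^sub>M seqs)"
    unfolding sp_def by (intro measurable_Pair measurable_PiM_single') auto
  have PP: "P \<Otimes>\<^sub>M P = distr W (P \<Otimes>\<^sub>M P) sp"
  proof -
    have "P \<Otimes>\<^sub>M P = distr (M \<Otimes>\<^sub>M M) (seqs \<Otimes>\<^sub>M seqs) (\<lambda>(x, y). (E x, E y))"
      unfolding P_def by (rule pair_measure_distr) (auto intro: prob_space_imp_sigma_finite P.prob_space_axioms[unfolded P_def])
    also have "\<dots> = distr (M \<Otimes>\<^sub>M M) (seqs \<Otimes>\<^sub>M seqs) (\<lambda>w. sp (F w))"
      by (rule distr_cong) (auto simp: sp_def F_def E_def innov_def innov_copy_def)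
    also have "\<dots> = distr W (seqs \<Otimes>\<^sub>M seqs) sp"
      unfolding W[symmetric] by (subst distr_distr) (auto simp: comp_def)
    also have "\<dots> = distr W (P \<Otimes>\<^sub>M P) sp" by (rule distr_cong) (auto cong: sets_pair_measure_cong simp: sP)
    finally show ?thesis .
  qed
  show ?thesis unfolding E_def[symmetric] P_def[symmetric]
  proof
    show "sets P = sets seqs" by (rule sP)
    fix J
    \<comment> \<open>This index permutation swaps the two copies of \<open>j\<close> exactly for
      \<open>j\<close> outside \<open>J\<close>; after \<open>sp\<close> it acts as the pair of
      mixtures.\<close>
    define \<pi> :: "int + int \<Rightarrow> int + int" where "\<pi> i = (case i of Inl j \<Rightarrow> if j \<in> J then Inl j else Inr j
        | Inr j \<Rightarrow> if j \<in> J then Inr j else Inl j)" for i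
    have inj: "inj \<pi>" by (auto simp: inj_def \<pi>_def split: sum.splits if_splits)
    have \<nu>\<pi>: "\<nu> (\<pi> i) = \<nu> i" for i by (auto simp: \<nu>_def \<pi>_def split: sum.splits)
    have R: "distr W W (\<lambda>z i. z (\<pi> i)) = W"
      using distr_PiM_reindex[of UNIV \<nu> \<pi> UNIV] \<nu> inj by (simp add: \<nu>\<pi> W_def restrict_def)
    have m\<pi>[measurable]: "(\<lambda>z i. z (\<pi> i)) \<in> measurable W W"
      by (subst measurable_cong_sets[OF sW sW], rule measurable_PiM_single') auto
    have msp[measurable]: "sp \<in> measurable W (P \<Otimes>\<^sub>M P)"
      by (subst measurable_cong_sets[OF sW sets_pair_measure_cong[OF sP sP]]) (rule sp)
    have mixm: "(\<lambda>w. (mix J (fst w) (snd w), mix J (snd w) (fst w))) \<in> measurable (P \<Otimes>\<^sub>M P) (P \<Otimes>\<^sub>M P)"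
      by measurable
    have "distr (P \<Otimes>\<^sub>M P) (P \<Otimes>\<^sub>M P) (\<lambda>w. (mix J (fst w) (snd w), mix J (snd w) (fst w))) =
        distr W (P \<Otimes>\<^sub>M P) ((\<lambda>w. (mix J (fst w) (snd w), mix J (snd w) (fst w))) \<circ> sp)"
      by (subst (1) PP, subst distr_distr) (use mixm in auto)
    also have "(\<lambda>w. (mix J (fst w) (snd w), mix J (snd w) (fst w))) \<circ> sp = sp \<circ> (\<lambda>z i. z (\<pi> i))"
      by (auto simp: fun_eq_iff sp_def mix_def \<pi>_def)
    also have "distr W (P \<Otimes>\<^sub>M P) (sp \<circ> (\<lambda>z i. z (\<pi> i))) = distr (distr W W (\<lambda>z i. z (\<pi> i))) (P \<Otimes>\<^sub>M P) sp"
      by (subst distr_distr) auto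
    also have "\<dots> = P \<Otimes>\<^sub>M P" unfolding R PP[symmetric] ..
    finally show "distr (P \<Otimes>\<^sub>M P) (P \<Otimes>\<^sub>M P) (\<lambda>w. (mix J (fst w) (snd w), mix J (snd w) (fst w))) = P \<Otimes>\<^sub>M P" .
  qed
qed

section \<open>Integrals and moments under resampling of the noise\<close>

context noise
begin

sublocale PP: pair_prob_space P P ..

lemma measurable_P_mix[measurable]: "(\<lambda>w. mix J (fst w) (snd w)) \<in> measurable (P \<Otimes>\<^sub>M P) P"
  "(\<lambda>w. mix J (snd w) (fst w)) \<in> measurable (P \<Otimes>\<^sub>M P) P"
  by measurable

text \<open>Resampled noise has the original law: it is the first marginal of the exchanged
  pair.\<close>

lemma distr_mix: "distr (P \<Otimes>\<^sub>M P) P (\<lambda>w. mix J (fst w) (snd w)) = P"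
proof -
  have "distr (distr (P \<Otimes>\<^sub>M P) (P \<Otimes>\<^sub>M P) (\<lambda>w. (mix J (fst w) (snd w), mix J (snd w) (fst w)))) P fst =
     distr (P \<Otimes>\<^sub>M P) P (\<lambda>w. mix J (fst w) (snd w))"
    by (subst distr_distr) (auto simp: comp_def)
  then show ?thesis unfolding swap by (simp add: distr_pair_fst)
qed

lemma Lp_le_fst: "Lp_le P n f K \<Longrightarrow> Lp_le (P \<Otimes>\<^sub>M P) n (\<lambda>w. f (fst w)) K"
  using Lp_le_distr[of fst "P \<Otimes>\<^sub>M P" P f n K] by (simp add: distr_pair_fst Lp_le_measurable)

lemma Lp_le_mix: "Lp_le P n f K \<Longrightarrow> Lp_le (P \<Otimes>\<^sub>M P) n (\<lambda>w. f (mix J (fst w) (snd w))) K"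
  using Lp_le_distr[of "\<lambda>w. mix J (fst w) (snd w)" "P \<Otimes>\<^sub>M P" P f n K]
  by (simp add: distr_mix Lp_le_measurable)

lemma Lp_le_swap:
  assumes "Lp_le (P \<Otimes>\<^sub>M P) n f K"
  shows "Lp_le (P \<Otimes>\<^sub>M P) n (\<lambda>w. f (mix J (fst w) (snd w), mix J (snd w) (fst w))) K"
  using Lp_le_distr[of "\<lambda>w. (mix J (fst w) (snd w), mix J (snd w) (fst w))" "P \<Otimes>\<^sub>M P" "P \<Otimes>\<^sub>M P" f n K] assms
  by (simp add: swap Lp_le_measurable)

lemma integral_fst:
  fixes f :: "_ \<Rightarrow> 'b::{banach, second_countable_topology}"
  assumes [measurable]: "f \<in> borel_measurable P"
  shows "(\<integral>w. f (fst w) \<partial>(P \<Otimes>\<^sub>M P)) = (\<integral>x. f x \<partial>P)"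
  using integral_distr[of fst "P \<Otimes>\<^sub>M P" P f] by (simp add: distr_pair_fst)

lemma integral_mix:
  fixes f :: "_ \<Rightarrow> 'b::{banach, second_countable_topology}"
  assumes [measurable]: "f \<in> borel_measurable P"
  shows "(\<integral>w. f (mix J (fst w) (snd w)) \<partial>(P \<Otimes>\<^sub>M P)) = (\<integral>x. f x \<partial>P)"
  using integral_distr[of "\<lambda>w. mix J (fst w) (snd w)" "P \<Otimes>\<^sub>M P" P f] by (simp add: distr_mix)

lemma integrable_mix:
  fixes f :: "_ \<Rightarrow> 'b::{banach, second_countable_topology}"
  assumes f: "integrable P f"
  shows "integrable (P \<Otimes>\<^sub>M P) (\<lambda>w. f (mix J (fst w) (snd w)))"
proof -
  have [measurable]: "f \<in> borel_measurable P" using f by auto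
  show ?thesis
  using integrable_distr_eq[of "\<lambda>w. mix J (fst w) (snd w)" "P \<Otimes>\<^sub>M P" P f] f by (simp add: distr_mix)
qed

text \<open>If \<open>A\<close> looks only at the coordinates in \<open>J\<close>, then replacing
  those coordinates in the argument of \<open>B\<close> decouples the two factors. The exchange
  turns the independent pair \<open>A (fst w)\<close>, \<open>B (snd w)\<close> into exactly this
  expression, because \<open>mix J y x\<close> is \<open>mix (- J) x y\<close>.\<close>

lemma integral_mult_mix:
  fixes A B :: "_ \<Rightarrow> 'b::{banach, second_countable_topology, real_normed_field}"
  assumes [measurable]: "A \<in> borel_measurable P" "B \<in> borel_measurable P"
    and A: "\<And>x y. A (mix J x y) = A x"
    and int: "integrable (P \<Otimes>\<^sub>M P) (\<lambda>w. A (fst w) * B (snd w))"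
  shows "(\<integral>w. A (fst w) * B (mix (- J) (fst w) (snd w)) \<partial>(P \<Otimes>\<^sub>M P)) = (\<integral>x. A x \<partial>P) * (\<integral>x. B x \<partial>P)"
proof -
  have "(\<integral>w. A (fst w) * B (snd w) \<partial>(P \<Otimes>\<^sub>M P)) =
     (\<integral>w. A (mix J (fst w) (snd w)) * B (mix J (snd w) (fst w)) \<partial>(P \<Otimes>\<^sub>M P))"
    by (subst swap[of J, symmetric], subst integral_distr) auto
  also have "\<dots> = (\<integral>w. A (fst w) * B (mix (- J) (fst w) (snd w)) \<partial>(P \<Otimes>\<^sub>M P))"
  proof (rule Bochner_Integration.integral_cong[OF refl])
    fix w have "mix J (snd w) (fst w) = mix (- J) (fst w) (snd w)" by (auto simp: mix_def)
    then show "A (mix J (fst w) (snd w)) * B (mix J (snd w) (fst w)) = A (fst w) * B (mix (- J) (fst w) (snd w))"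
      by (simp add: A)
  qed
  finally have "(\<integral>w. A (fst w) * B (mix (- J) (fst w) (snd w)) \<partial>(P \<Otimes>\<^sub>M P)) = (\<integral>w. A (fst w) * B (snd w) \<partial>(P \<Otimes>\<^sub>M P))" ..
  also have "\<dots> = (\<integral>x. (\<integral>y. A x * B y \<partial>P) \<partial>P)"
    using PP.integral_fst'[of "\<lambda>w. A (fst w) * B (snd w)"] int by simp
  finally show ?thesis by simp
qed

section \<open>Continuity of resampling in the set of retained coordinates\<close>

lemma integrable_mix_diff:
  fixes f :: "_ \<Rightarrow> real"
  assumes "integrable P f"
  shows "integrable (P \<Otimes>\<^sub>M P) (\<lambda>w. \<bar>f (mix J (fst w) (snd w)) - f (mix K (fst w) (snd w))\<bar>)"
  using integrable_mix[OF assms] by auto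

text \<open>A three-epsilon argument. Since every mixture has law \<open>P\<close>, the error of
  replacing \<open>f\<close> by \<open>u k\<close> is the same for all sets \<open>J m\<close> and
  for \<open>L\<close>.\<close>

lemma mix_limit_closed:
  fixes f :: "_ \<Rightarrow> real" and J :: "nat \<Rightarrow> int set"
  assumes u: "\<And>k::nat. integrable P (u k)"
    and conv: "\<And>k. (\<lambda>m. \<integral>w. \<bar>u k (mix (J m) (fst w) (snd w)) - u k (mix L (fst w) (snd w))\<bar> \<partial>(P \<Otimes>\<^sub>M P)) \<longlonglongrightarrow> 0"
    and f: "integrable P f" and lim: "(\<lambda>k. \<integral>x. \<bar>u k x - f x\<bar> \<partial>P) \<longlonglongrightarrow> 0"
  shows "(\<lambda>m. \<integral>w. \<bar>f (mix (J m) (fst w) (snd w)) - f (mix L (fst w) (snd w))\<bar> \<partial>(P \<Otimes>\<^sub>M P)) \<longlonglongrightarrow> 0"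
proof (rule tendstoI)
  fix e :: real assume e: "e > 0"
  have "\<forall>\<^sub>F k in sequentially. (\<integral>x. \<bar>u k x - f x\<bar> \<partial>P) < e / 3"
    by (rule order_tendstoD(2)[OF lim]) (use e in auto)
  then obtain k where k: "(\<integral>x. \<bar>u k x - f x\<bar> \<partial>P) < e / 3"
    using eventually_happens'[OF sequentially_bot] by blast
  have [measurable]: "f \<in> borel_measurable P" "u k \<in> borel_measurable P" using f u by auto
  have a: "(\<integral>w. \<bar>u k (mix J' (fst w) (snd w)) - f (mix J' (fst w) (snd w))\<bar> \<partial>(P \<Otimes>\<^sub>M P)) < e / 3" for J'
    using integral_mix[of "\<lambda>x. \<bar>u k x - f x\<bar>" J'] k by simp
  have i: "integrable (P \<Otimes>\<^sub>M P) (\<lambda>w. u k (mix J' (fst w) (snd w)))"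
     "integrable (P \<Otimes>\<^sub>M P) (\<lambda>w. f (mix J' (fst w) (snd w)))" for J'
    using u f by (auto intro: integrable_mix)
  have "\<forall>\<^sub>F m in sequentially. (\<integral>w. \<bar>u k (mix (J m) (fst w) (snd w)) - u k (mix L (fst w) (snd w))\<bar> \<partial>(P \<Otimes>\<^sub>M P)) < e / 3"
    by (rule order_tendstoD(2)[OF conv]) (use e in auto)
  then show "\<forall>\<^sub>F m in sequentially. dist (\<integral>w. \<bar>f (mix (J m) (fst w) (snd w)) - f (mix L (fst w) (snd w))\<bar> \<partial>(P \<Otimes>\<^sub>M P)) 0 < e"
  proof eventually_elim
    case (elim m)
    have "(\<integral>w. \<bar>f (mix (J m) (fst w) (snd w)) - f (mix L (fst w) (snd w))\<bar> \<partial>(P \<Otimes>\<^sub>M P)) \<le>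
      (\<integral>w. \<bar>u k (mix (J m) (fst w) (snd w)) - f (mix (J m) (fst w) (snd w))\<bar> +
         \<bar>u k (mix (J m) (fst w) (snd w)) - u k (mix L (fst w) (snd w))\<bar> +
         \<bar>u k (mix L (fst w) (snd w)) - f (mix L (fst w) (snd w))\<bar> \<partial>(P \<Otimes>\<^sub>M P))"
      by (intro integral_mono Bochner_Integration.integrable_add Bochner_Integration.integrable_diff
          Bochner_Integration.integrable_abs i) (auto)
    also have "\<dots> = (\<integral>w. \<bar>u k (mix (J m) (fst w) (snd w)) - f (mix (J m) (fst w) (snd w))\<bar> \<partial>(P \<Otimes>\<^sub>M P)) +
        (\<integral>w. \<bar>u k (mix (J m) (fst w) (snd w)) - u k (mix L (fst w) (snd w))\<bar> \<partial>(P \<Otimes>\<^sub>M P)) +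
        (\<integral>w. \<bar>u k (mix L (fst w) (snd w)) - f (mix L (fst w) (snd w))\<bar> \<partial>(P \<Otimes>\<^sub>M P))"
      by (subst Bochner_Integration.integral_add; (intro Bochner_Integration.integrable_add Bochner_Integration.integrable_diff
          Bochner_Integration.integrable_abs i)?)+ auto
    also have "\<dots> < e" using a[of "J m"] a[of L] elim by linarith
    finally show ?case by simp
  qed
qed

text \<open>The claim is immediate for cylinder sets, passes to all measurable sets by the disjoint
  form of the generator induction, and to integrable functions by closedness in L1. It covers
  replacement of an infinite past, which no finite telescoping reaches.\<close>

lemma mix_limit:
  fixes f :: "_ \<Rightarrow> real" and J :: "nat \<Rightarrow> int set"
  assumes ev: "\<And>j. \<forall>\<^sub>F m in sequentially. j \<in> J m \<longleftrightarrow> j \<in> L"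
    and f: "integrable P f"
  shows "(\<lambda>m. \<integral>w. \<bar>f (mix (J m) (fst w) (snd w)) - f (mix L (fst w) (snd w))\<bar> \<partial>(P \<Otimes>\<^sub>M P)) \<longlonglongrightarrow> 0"
    (is "?C f")
  using f
proof (induction f rule: integrable_induct)
  case (base A c)
  then have A: "A \<in> sets P" by simp
  have G: "Int_stable (prod_algebra UNIV (\<lambda>_::int. borel :: real measure))"
      "prod_algebra UNIV (\<lambda>_::int. borel :: real measure) \<subseteq> Pow UNIV"
    by (auto intro: Int_stable_prod_algebra)
  have "A \<in> sigma_sets UNIV (prod_algebra UNIV (\<lambda>_::int. borel :: real measure))"
    using A by (simp add: sets_P sets_PiM space_PiM)
  with G have ind: "?C (indicator A :: _ \<Rightarrow> real)"
  proof (induction A rule: sigma_sets_induct_disjoint)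
    case (basic A)
    then obtain F X where F: "finite F" and A: "A = prod_emb UNIV (\<lambda>_. borel) F (Pi\<^sub>E F X)"
      by (elim prod_algebraE) blast
    \<comment> \<open>A cylinder sees finitely many coordinates. Once \<open>J m\<close> and
      \<open>L\<close> agree on them the integrand vanishes identically.\<close>
    have "\<forall>\<^sub>F m in sequentially. \<forall>j\<in>F. j \<in> J m \<longleftrightarrow> j \<in> L"
      using ev F by (simp add: eventually_ball_finite_distrib)
    then have "\<forall>\<^sub>F m in sequentially. (\<integral>w. \<bar>indicator A (mix (J m) (fst w) (snd w)) - indicator A (mix L (fst w) (snd w))\<bar> \<partial>(P \<Otimes>\<^sub>M P)) = (0::real)"
    proof eventually_elim
      case (elim m)
      have "mix (J m) x y \<in> A \<longleftrightarrow> mix L x y \<in> A" for x y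
        using elim unfolding A by (auto simp: prod_emb_def PiE_iff mix_def)
      then show ?case by (simp add: indicator_def)
    qed
    then show ?case by (rule tendsto_eventually)
  next
    case empty then show ?case by simp
  next
    case (compl A)
    have "\<bar>indicator (UNIV - A) x - indicator (UNIV - A) y\<bar> = (\<bar>indicator A x - indicator A y\<bar> :: real)" for x y :: "int \<Rightarrow> real"
      by (auto simp: indicator_def)
    with compl show ?case by simp
  next
    case (union A)
    have Am: "A i \<in> sets P" for i using union(2) by (simp add: sets_P sets_PiM space_PiM image_subset_iff)
    show ?case
    \<comment> \<open>The indicator of a disjoint union is the L1 limit of the partial sums of
      indicators, by dominated convergence.\<close>
    proof (rule mix_limit_closed[where u = "\<lambda>k x. \<Sum>i<k. indicator (A i) x"])
      fix k
      have ii: "integrable P (indicator (A i) :: _ \<Rightarrow> real)" for i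
        using Am by (intro integrable_real_indicator) (auto simp: less_top[symmetric])
      then show "integrable P (\<lambda>x. \<Sum>i<k. indicator (A i) x :: real)" by auto
      have *: "(\<lambda>m. \<Sum>i<k. \<integral>w. \<bar>indicator (A i) (mix (J m) (fst w) (snd w)) - indicator (A i) (mix L (fst w) (snd w))\<bar> \<partial>(P \<Otimes>\<^sub>M P)) \<longlonglongrightarrow> (\<Sum>i<k. 0::real)"
        by (intro tendsto_intros union.IH)
      show "(\<lambda>m. \<integral>w. \<bar>(\<Sum>i<k. indicator (A i) (mix (J m) (fst w) (snd w))) - (\<Sum>i<k. indicator (A i) (mix L (fst w) (snd w)))\<bar> \<partial>(P \<Otimes>\<^sub>M P)) \<longlonglongrightarrow> (0::real)"
      proof (rule tendsto_sandwich[OF _ _ tendsto_const])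
        show "(\<lambda>m. \<Sum>i<k. \<integral>w. \<bar>indicator (A i) (mix (J m) (fst w) (snd w)) - indicator (A i) (mix L (fst w) (snd w))\<bar> \<partial>(P \<Otimes>\<^sub>M P)) \<longlonglongrightarrow> (0::real)"
          using * by simp
        have "(\<integral>w. \<bar>(\<Sum>i<k. indicator (A i) (mix (J m) (fst w) (snd w))) - (\<Sum>i<k. indicator (A i) (mix L (fst w) (snd w)))\<bar> \<partial>(P \<Otimes>\<^sub>M P))
            \<le> (\<Sum>i<k. \<integral>w. \<bar>indicator (A i) (mix (J m) (fst w) (snd w)) - indicator (A i) (mix L (fst w) (snd w)) :: real\<bar> \<partial>(P \<Otimes>\<^sub>M P))" for m
          unfolding sum_subtractf[symmetric]
          by (subst Bochner_Integration.integral_sum[symmetric], (intro integrable_mix_diff ii)[1])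
            (intro integral_mono Bochner_Integration.integrable_sum Bochner_Integration.integrable_abs Bochner_Integration.integrable_diff
              integrable_mix ii sum_abs)
        then show "\<forall>\<^sub>F m in sequentially. (\<integral>w. \<bar>(\<Sum>i<k. indicator (A i) (mix (J m) (fst w) (snd w))) - (\<Sum>i<k. indicator (A i) (mix L (fst w) (snd w)))\<bar> \<partial>(P \<Otimes>\<^sub>M P))
            \<le> (\<Sum>i<k. \<integral>w. \<bar>indicator (A i) (mix (J m) (fst w) (snd w)) - indicator (A i) (mix L (fst w) (snd w)) :: real\<bar> \<partial>(P \<Otimes>\<^sub>M P))"
          by simp
      qed auto
    next
      show "integrable P (indicator (\<Union>i. A i) :: _ \<Rightarrow> real)"
        using Am by (intro integrable_real_indicator) (auto simp: less_top[symmetric])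
      have eq: "(\<Sum>i<k. indicator (A i) x) = (indicator (\<Union>i<k. A i) x :: real)" for k x
        using union(1) by (subst indicator_UN_disjoint) (auto simp: disjoint_family_on_def)
      have lim: "(\<lambda>k. (\<integral>x. \<bar>(\<Sum>i<k. indicator (A i) x) - indicator (\<Union>i. A i) x\<bar> \<partial>P)) \<longlonglongrightarrow> (\<integral>x. (0::real) \<partial>P)"
      proof (rule integral_dominated_convergence[where w = "\<lambda>_. 1"])
        show "AE x in P. (\<lambda>k. \<bar>(\<Sum>i<k. indicator (A i) x) - indicator (\<Union>i. A i) x\<bar>) \<longlonglongrightarrow> (0::real)"
        proof (rule AE_I2)
          fix x
          have "(\<lambda>k. indicator (\<Union>i<k. A i) x :: real) \<longlonglongrightarrow> indicator (\<Union>i. A i) x"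
            by (rule LIMSEQ_indicator_UN)
          then show "(\<lambda>k. \<bar>(\<Sum>i<k. indicator (A i) x) - indicator (\<Union>i. A i) x\<bar>) \<longlonglongrightarrow> (0::real)"
            unfolding eq by (auto simp: LIM_zero intro: tendsto_rabs_zero)
        qed
        show "AE x in P. norm \<bar>(\<Sum>i<k. indicator (A i) x) - indicator (\<Union>i. A i) x :: real\<bar> \<le> 1" for k
          unfolding eq by (intro AE_I2) (auto simp: indicator_def)
      qed (use Am in auto)
      then show "(\<lambda>k. \<integral>x. \<bar>(\<Sum>i<k. indicator (A i) x) - indicator (\<Union>i. A i) x\<bar> \<partial>P) \<longlonglongrightarrow> (0::real)"
        by simp
    qed
  qed
  have "(\<lambda>m. \<bar>c\<bar> * (\<integral>w. \<bar>indicator A (mix (J m) (fst w) (snd w)) - indicator A (mix L (fst w) (snd w))\<bar> \<partial>(P \<Otimes>\<^sub>M P))) \<longlonglongrightarrow> \<bar>c\<bar> * 0"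
    by (intro tendsto_intros ind)
  then show ?case
    by (simp add: integral_mult_right_zero[symmetric] abs_mult[symmetric] algebra_simps del: integral_mult_right_zero)
next
  case (add f g)
  have "(\<lambda>m. (\<integral>w. \<bar>f (mix (J m) (fst w) (snd w)) - f (mix L (fst w) (snd w))\<bar> \<partial>(P \<Otimes>\<^sub>M P))
       + (\<integral>w. \<bar>g (mix (J m) (fst w) (snd w)) - g (mix L (fst w) (snd w))\<bar> \<partial>(P \<Otimes>\<^sub>M P))) \<longlonglongrightarrow> 0 + 0"
    by (intro tendsto_intros add.IH)
  then have lim: "(\<lambda>m. (\<integral>w. \<bar>f (mix (J m) (fst w) (snd w)) - f (mix L (fst w) (snd w))\<bar> \<partial>(P \<Otimes>\<^sub>M P))
       + (\<integral>w. \<bar>g (mix (J m) (fst w) (snd w)) - g (mix L (fst w) (snd w))\<bar> \<partial>(P \<Otimes>\<^sub>M P))) \<longlonglongrightarrow> 0" by simp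
  have "(\<integral>w. \<bar>(f (mix (J m) (fst w) (snd w)) + g (mix (J m) (fst w) (snd w))) - (f (mix L (fst w) (snd w)) + g (mix L (fst w) (snd w)))\<bar> \<partial>(P \<Otimes>\<^sub>M P))
     \<le> (\<integral>w. \<bar>f (mix (J m) (fst w) (snd w)) - f (mix L (fst w) (snd w))\<bar> \<partial>(P \<Otimes>\<^sub>M P))
       + (\<integral>w. \<bar>g (mix (J m) (fst w) (snd w)) - g (mix L (fst w) (snd w))\<bar> \<partial>(P \<Otimes>\<^sub>M P))" for m
    unfolding Bochner_Integration.integral_add[OF integrable_mix_diff[OF add(1)] integrable_mix_diff[OF add(2)], symmetric]
    by (rule integral_mono) (auto intro!: Bochner_Integration.integrable_add Bochner_Integration.integrable_abs
        Bochner_Integration.integrable_diff integrable_mix add(1,2))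
  then show ?case
    by (intro tendsto_sandwich[OF _ _ tendsto_const lim]) auto
next
  case (lim f s)
  show ?case
  proof (rule mix_limit_closed[where u = s])
    have "(\<lambda>k. (\<integral>x. \<bar>s k x - f x\<bar> \<partial>P)) \<longlonglongrightarrow> (\<integral>x. (0::real) \<partial>P)"
    proof (rule integral_dominated_convergence[where w = "\<lambda>x. 3 * norm (f x)"])
      show "AE x in P. (\<lambda>k. \<bar>s k x - f x\<bar>) \<longlonglongrightarrow> 0"
        using lim(2) by (intro AE_I2) (auto simp: LIM_zero intro: tendsto_rabs_zero)
      show "AE x in P. norm \<bar>s k x - f x\<bar> \<le> 3 * norm (f x)" for k
      proof (rule AE_I2)
        fix x assume "x \<in> space P"
        then have "norm (s k x) \<le> 2 * norm (f x)" by (rule lim(3))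
        then show "norm \<bar>s k x - f x\<bar> \<le> 3 * norm (f x)" by auto
      qed
    qed (use lim in auto)
    then show "(\<lambda>k. \<integral>x. \<bar>s k x - f x\<bar> \<partial>P) \<longlonglongrightarrow> 0" by simp
  qed (use lim in auto)
qed

text \<open>Consecutive terms differ in one coordinate. The bound for a single replacement is stated
  for a fresh pair of copies, and the exchange carries it to the pair in which later coordinates
  have already been replaced.\<close>

lemma Lp_le_telescope_finite:
  fixes f :: "_ \<Rightarrow> real" and i :: int
  assumes n: "n > 0"
    and d: "\<And>r. Lp_le (P \<Otimes>\<^sub>M P) n (\<lambda>w. f (fst w) - f (mix (- {i - int r}) (fst w) (snd w))) (d r)"
    and lm: "l \<le> m"
  shows "Lp_le (P \<Otimes>\<^sub>M P) n (\<lambda>w. f (fst w) - f (mix (- {i - int m<..i - int l}) (fst w) (snd w))) (\<Sum>r=l..<m. d r)"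
  using lm
proof (induction m rule: dec_induct)
  case base
  then show ?case using Lp_le_zero[OF n] by (simp add: mix_def)
next
  case (step m)
  let ?S = "\<lambda>m. - {i - int m<..i - int l}"
  let ?F = "\<lambda>w. f (fst w) - f (mix (- {i - int m}) (fst w) (snd w))"
  have "Lp_le (P \<Otimes>\<^sub>M P) n (\<lambda>w. ?F (mix (?S m) (fst w) (snd w), mix (?S m) (snd w) (fst w))) (d m)"
    by (rule Lp_le_swap) (rule d)
  \<comment> \<open>Coordinate \<open>i - m\<close> is still untouched at this stage, so taking it
    from the exchanged second copy inserts \<open>y\<close>.\<close>
  moreover have "mix (- {i - int m}) (mix (?S m) x y) (mix (?S m) y x) = mix (?S (Suc m)) x y" for x y
    using step(1) by (auto simp: mix_def fun_eq_iff)
  ultimately have "Lp_le (P \<Otimes>\<^sub>M P) n (\<lambda>w. f (mix (?S m) (fst w) (snd w)) - f (mix (?S (Suc m)) (fst w) (snd w))) (d m)"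
    by simp
  from Lp_le_add[OF step.IH this] show ?case using step(1) by simp
qed

text \<open>As \<open>m\<close> grows the replaced interval exhausts the past.
  \<open>mix_limit\<close> gives L1 convergence, a subsequence converges almost surely, and Fatou's
  lemma keeps the bound.\<close>

lemma Lp_le_telescope:
  fixes f :: "_ \<Rightarrow> real" and i :: int
  assumes n: "n > 0"
    and d: "\<And>r. Lp_le (P \<Otimes>\<^sub>M P) n (\<lambda>w. f (fst w) - f (mix (- {i - int r}) (fst w) (snd w))) (d r)"
    and f: "integrable P f"
    and D: "\<And>m. (\<Sum>r=l..<m. d r) \<le> D"
  shows "Lp_le (P \<Otimes>\<^sub>M P) n (\<lambda>w. f (fst w) - f (mix {i - int l<..} (fst w) (snd w))) D"
proof -
  let ?J = "\<lambda>m. - {i - int m<..i - int l}"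
  have [measurable]: "f \<in> borel_measurable P" using f by auto
  have "(\<lambda>m. \<integral>w. \<bar>f (mix (?J m) (fst w) (snd w)) - f (mix {i - int l<..} (fst w) (snd w))\<bar> \<partial>(P \<Otimes>\<^sub>M P)) \<longlonglongrightarrow> 0"
  proof (rule mix_limit[OF _ f])
    fix j
    show "\<forall>\<^sub>F m in sequentially. j \<in> ?J m \<longleftrightarrow> j \<in> {i - int l<..}"
      using eventually_ge_at_top[of "nat (i - j) + 1"] by eventually_elim auto
  qed
  from tendsto_L1_AE_subseq[of "P \<Otimes>\<^sub>M P" "\<lambda>m w. f (mix (?J m) (fst w) (snd w)) - f (mix {i - int l<..} (fst w) (snd w))"] this
  obtain r :: "nat \<Rightarrow> nat" where r: "strict_mono r"
    "AE w in P \<Otimes>\<^sub>M P. (\<lambda>m. f (mix (?J (r m)) (fst w) (snd w)) - f (mix {i - int l<..} (fst w) (snd w))) \<longlonglongrightarrow> 0"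
    using integrable_mix[OF f] by auto
  show ?thesis
  proof (rule Lp_le_Fatou[where u = "\<lambda>m w. f (fst w) - f (mix (?J (r (m + l))) (fst w) (snd w))"])
    fix k
    \<comment> \<open>The subsequence is shifted by \<open>l\<close> so that every term belongs to
      an interval to which the finite telescoping applies.\<close>
    have "l \<le> r (k + l)" using seq_suble[OF r(1), of "k + l"] by simp
    from Lp_le_telescope_finite[where f = f, OF n d this]
    show "Lp_le (P \<Otimes>\<^sub>M P) n (\<lambda>w. f (fst w) - f (mix (?J (r (k + l))) (fst w) (snd w))) D"
      by (rule Lp_le_mono) (rule D)
  next
    show "AE w in P \<Otimes>\<^sub>M P. (\<lambda>m. f (fst w) - f (mix (?J (r (m + l))) (fst w) (snd w)))
        \<longlonglongrightarrow> f (fst w) - f (mix {i - int l<..} (fst w) (snd w))"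
      using r(2)
    proof eventually_elim
      case (elim w)
      then have "(\<lambda>m. f (mix (?J (r m)) (fst w) (snd w))) \<longlonglongrightarrow> f (mix {i - int l<..} (fst w) (snd w))"
        by (rule LIM_zero_cancel)
      then have "(\<lambda>m. f (mix (?J (r (m + l))) (fst w) (snd w))) \<longlonglongrightarrow> f (mix {i - int l<..} (fst w) (snd w))"
        by (rule LIMSEQ_ignore_initial_segment)
      then show ?case by (intro tendsto_intros)
    qed
  qed simp
qed

end

subsection \<open>A central limit theorem by blocking\<close>

text \<open>Each term is dominated by the telescoping difference
  \<open>1 / real N - 1 / (1 + real N)\<close>.\<close>

lemma sum_inverse_square_tail:
  assumes "s \<ge> 1" "s \<le> N"
  shows "(\<Sum>l=s..<N. 1 / (1 + real l)\<^sup>2) \<le> 1 / real s - 1 / real N"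
  using assms(2)
proof (induction N rule: dec_induct)
  case (step N)
  have "N \<ge> 1" using step assms by simp
  then have "1 / (1 + real N)\<^sup>2 \<le> 1 / real N - 1 / (1 + real N)"
  proof -
    have "1 / (1 + real N)\<^sup>2 \<le> 1 / (real N * (1 + real N))"
      using \<open>N \<ge> 1\<close> by (intro divide_left_mono) (auto simp: power2_eq_square)
    also have "\<dots> = 1 / real N - 1 / (1 + real N)" using \<open>N \<ge> 1\<close> by (simp add: divide_simps)
    finally show ?thesis .
  qed
  with step show ?case by simp
qed simp

lemma sum_inverse_square_le:
  assumes "finite F" "\<And>l. l \<in> F \<Longrightarrow> s \<le> l" "s \<ge> 1"
  shows "(\<Sum>l\<in>F. 1 / (1 + real l)\<^sup>2) \<le> 1 / real s"
proof -
  obtain N where N: "F \<subseteq> {..<N}" using assms(1) finite_nat_iff_bounded by blast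
  have "(\<Sum>l\<in>F. 1 / (1 + real l)\<^sup>2) \<le> (\<Sum>l=s..<N + s. 1 / (1 + real l)\<^sup>2)"
    using N assms by (intro sum_mono2) (auto dest!: subsetD)
  also have "\<dots> \<le> 1 / real s - 1 / real (N + s)" using assms by (intro sum_inverse_square_tail) auto
  also have "\<dots> \<le> 1 / real s" by simp
  finally show ?thesis .
qed

lemma sum_inverse_square_le_2:
  assumes "finite F"
  shows "(\<Sum>l\<in>F. 1 / (1 + real l)\<^sup>2) \<le> 2"
proof -
  have "(\<Sum>l\<in>F. 1 / (1 + real l)\<^sup>2) \<le> (\<Sum>l\<in>insert 0 (F - {0}). 1 / (1 + real l)\<^sup>2)"
    using assms by (intro sum_mono2) auto
  also have "\<dots> = 1 + (\<Sum>l\<in>F - {0}. 1 / (1 + real l)\<^sup>2)"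
    using assms by (subst sum.insert) auto
  also have "(\<Sum>l\<in>F - {0}. 1 / (1 + real l)\<^sup>2) \<le> 1 / real 1"
    using assms by (intro sum_inverse_square_le) auto
  finally show ?thesis by simp
qed

text \<open>A given distance from \<open>i\<close> is attained at most once on either side, hence
  the factor 2. The predicate \<open>P\<close> transmits restrictions on the distances, such as a
  minimal gap.\<close>

lemma sum_int_distance_le:
  fixes h :: "nat \<Rightarrow> real" and i :: int
  assumes A: "finite A" "\<And>j. j \<in> A \<Longrightarrow> P (nat \<bar>i - j\<bar>)"
    and B: "\<And>F. finite F \<Longrightarrow> (\<And>l. l \<in> F \<Longrightarrow> P l) \<Longrightarrow> (\<Sum>l\<in>F. h l) \<le> B"
  shows "(\<Sum>j\<in>A. h (nat \<bar>i - j\<bar>)) \<le> 2 * B"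
proof -
  have *: "(\<Sum>j\<in>A'. h (nat \<bar>i - j\<bar>)) \<le> B" if "A' \<subseteq> A" "inj_on (\<lambda>j. nat \<bar>i - j\<bar>) A'" for A'
  proof -
    have "(\<Sum>j\<in>A'. h (nat \<bar>i - j\<bar>)) = (\<Sum>l\<in>(\<lambda>j. nat \<bar>i - j\<bar>) ` A'. h l)"
      using that(2) by (simp add: sum.reindex)
    also have "\<dots> \<le> B" using that A by (intro B) (auto intro: finite_subset)
    finally show ?thesis .
  qed
  have "A = {j\<in>A. i \<le> j} \<union> {j\<in>A. j < i}" by auto
  then have "(\<Sum>j\<in>A. h (nat \<bar>i - j\<bar>)) = (\<Sum>j\<in>{j\<in>A. i \<le> j} \<union> {j\<in>A. j < i}. h (nat \<bar>i - j\<bar>))" by simp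
  also have "\<dots> = (\<Sum>j\<in>{j\<in>A. i \<le> j}. h (nat \<bar>i - j\<bar>)) + (\<Sum>j\<in>{j\<in>A. j < i}. h (nat \<bar>i - j\<bar>))"
    using A(1) by (intro sum.union_disjoint) auto
  also have "\<dots> \<le> B + B"
    by (intro add_mono *) (auto simp: inj_on_def)
  finally show ?thesis by simp
qed

lemma iexp_diff_le: "cmod (iexp x - iexp y) \<le> \<bar>x - y\<bar>"
proof -
  have "iexp x - iexp y = iexp y * (iexp (x - y) - 1)"
    by (simp add: algebra_simps exp_add[symmetric])
  then have "cmod (iexp x - iexp y) = cmod (iexp (x - y) - 1)"
    by (simp add: norm_mult)
  also have "\<dots> \<le> \<bar>x - y\<bar>" using iexp_approx1[of "x - y" 0] by simp
  finally show ?thesis .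
qed

text \<open>The upper half rests on \<open>(1 - u + u\<^sup>2 / 2) * (1 + u + u\<^sup>2 / 2) = 1 + u
  ^ 4 / 4\<close>, which compares the alternating polynomial with the reciprocal of the Taylor
  minorant of \<open>exp u\<close>.\<close>

lemma exp_minus_second_order:
  fixes u :: real assumes "u \<ge> 0"
  shows "\<bar>exp (- u) - (1 - u)\<bar> \<le> u\<^sup>2 / 2"
proof -
  have 1: "1 - u \<le> exp (- u)" using exp_ge_add_one_self[of "- u"] by simp
  have "1 + u + u\<^sup>2 / 2 \<le> exp u" by (rule exp_lower_Taylor_quadratic[OF assms])
  then have "exp (- u) * (1 + u + u\<^sup>2 / 2) \<le> exp (- u) * exp u" by (intro mult_left_mono) auto
  then have "exp (- u) * (1 + u + u\<^sup>2 / 2) \<le> 1" by (simp add: exp_add[symmetric])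
  also have "1 \<le> (1 - u + u\<^sup>2 / 2) * (1 + u + u\<^sup>2 / 2)"
  proof -
    have "(1 - u + u\<^sup>2 / 2) * (1 + u + u\<^sup>2 / 2) = 1 + u ^ 4 / 4"
      by (simp add: algebra_simps power2_eq_square power4_eq_xxxx)
    then show ?thesis by simp
  qed
  finally have *: "exp (- u) * (1 + u + u\<^sup>2 / 2) \<le> (1 - u + u\<^sup>2 / 2) * (1 + u + u\<^sup>2 / 2)" .
  have "0 < 1 + u + u\<^sup>2 / 2" using assms by (simp add: add_pos_nonneg)
  with * have "exp (- u) \<le> 1 - u + u\<^sup>2 / 2" by (simp only: mult_le_cancel_right_pos)
  with 1 show ?thesis by simp
qed

lemma exp_minus_diff_le:
  fixes a b :: real assumes "a \<ge> 0" "b \<ge> 0"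
  shows "\<bar>exp (- a) - exp (- b)\<bar> \<le> \<bar>a - b\<bar>"
proof -
  have *: "exp (- x) - exp (- y) \<le> y - x" if "0 \<le> x" "x \<le> y" for x y :: real
  proof -
    have "exp (- x) - exp (- y) = exp (- x) * (1 - exp (- (y - x)))"
      by (simp add: algebra_simps exp_add[symmetric])
    also have "\<dots> \<le> 1 * (1 - exp (- (y - x)))" using that by (intro mult_right_mono) auto
    also have "\<dots> \<le> y - x" using exp_ge_add_one_self[of "x - y"] unfolding mult_1 minus_diff_eq by linarith
    finally show ?thesis .
  qed
  show ?thesis using *[of a b] *[of b a] assms by (cases "a \<le> b") (auto simp: abs_if)
qed

text \<open>The abstract sequence of the central limit theorem, later a linear combination of
  centred products of the process. Stationarity of \<open>Y\<close> is not assumed, and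
  \<open>C\<close>, \<open>D\<close> stay explicit so that all errors are uniform in the sample
  size.\<close>

locale weakly_dependent = noise P for P +
  fixes Y :: "int \<Rightarrow> (int \<Rightarrow> real) \<Rightarrow> real" and C D :: real
  assumes Y4: "\<And>i. Lp_le P 4 (Y i) C"
    and mean: "\<And>i. (\<integral>x. Y i x \<partial>P) = 0"
    and adapted: "\<And>i x y. Y i (mix {..i} x y) = Y i x"
    and decay: "\<And>i l. Lp_le (P \<Otimes>\<^sub>M P) 2 (\<lambda>w. Y i (fst w) - Y i (mix {i - int l<..} (fst w) (snd w))) (D / (1 + real l)\<^sup>2)"
begin

lemma measurable_Y[measurable]: "Y i \<in> borel_measurable P"
  using Y4 by (rule Lp_le_measurable)

lemma Y2: "Lp_le P 2 (Y i) C" using Y4 by (rule Lp_le_4_2)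

lemma C0: "C \<ge> 0" using Y4 by (rule Lp_le_nonneg)

lemma D0: "D \<ge> 0" using Lp_le_nonneg[OF decay[of 0 0]] by simp

lemma Y_integrable: "integrable P (Y i)" "integrable P (\<lambda>x. Y i x * Y j x)"
proof -
  show "integrable P (Y i)" by (rule Lp_le_integrable[OF Lp_le_2_1[OF Y2]])
  have "Lp_le P 1 (\<lambda>x. Y i x * Y j x) (C * C)" by (rule Lp_le_mult) (use Y2 in simp_all)
  then show "integrable P (\<lambda>x. Y i x * Y j x)" by (rule Lp_le_integrable)
qed

lemma adapted_le: "i \<le> a \<Longrightarrow> Y i (mix {..a} x y) = Y i x"
proof -
  assume "i \<le> a"
  then have "mix {..i} (mix {..a} x y) y = mix {..i} x y" by (auto simp: mix_def fun_eq_iff)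
  then show ?thesis using adapted[of i "mix {..a} x y" y] adapted[of i x y] by simp
qed

lemma decay': "a \<le> i \<Longrightarrow> Lp_le (P \<Otimes>\<^sub>M P) 2 (\<lambda>w. Y i (fst w) - Y i (mix {a<..} (fst w) (snd w)))
    (D * (1 / (1 + real (nat \<bar>a - i\<bar>))\<^sup>2))"
  using decay[of i "nat (i - a)"] by simp

text \<open>After resampling the innovations up to time \<open>i\<close>, the later variable is
  independent of \<open>Y i\<close> and centred. The covariance therefore equals the one with the
  change caused by resampling, which \<open>decay\<close> controls.\<close>

lemma cov_bound_le:
  assumes "i \<le> j"
  shows "\<bar>\<integral>x. Y i x * Y j x \<partial>P\<bar> \<le> C * D * (1 / (1 + real (nat \<bar>i - j\<bar>))\<^sup>2)"
proof -
  let ?N = "P \<Otimes>\<^sub>M P" and ?Y' = "\<lambda>w. Y j (mix {i<..} (fst w) (snd w))"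
  have Yi: "Lp_le ?N 2 (\<lambda>w. Y i (fst w)) C" by (rule Lp_le_fst[OF Y2])
  have neg: "- {..i} = {i<..}" by auto
  have i0: "integrable ?N (\<lambda>w. Y i (fst w) * Y j (mix K (fst w) (snd w)))" for K
  proof -
    have "Lp_le ?N 1 (\<lambda>w. Y i (fst w) * Y j (mix K (fst w) (snd w))) (C * C)"
      by (rule Lp_le_mult) (use Yi Lp_le_mix[OF Y2] in simp_all)
    then show ?thesis by (rule Lp_le_integrable)
  qed
  have "integrable ?N (\<lambda>w. Y i (fst w) * Y j (snd w))"
    using i0[of "{}"] by (simp add: mix_def)
  from integral_mult_mix[OF _ _ adapted this] have 0: "(\<integral>w. Y i (fst w) * ?Y' w \<partial>?N) = 0"
    by (simp add: neg mean)
  have L: "Lp_le ?N 1 (\<lambda>w. Y i (fst w) * (Y j (fst w) - ?Y' w)) (C * (D * (1 / (1 + real (nat \<bar>i - j\<bar>))\<^sup>2)))"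
    by (rule Lp_le_mult) (use Yi decay'[OF assms] in simp_all)
  have i1: "integrable ?N (\<lambda>w. Y i (fst w) * Y j (fst w))"
    using i0[of UNIV] by (simp add: mix_def)
  have i2: "integrable ?N (\<lambda>w. Y i (fst w) * ?Y' w)" by (rule i0)
  have "(\<integral>x. Y i x * Y j x \<partial>P) = (\<integral>w. Y i (fst w) * Y j (fst w) \<partial>?N)"
    by (subst integral_fst[symmetric]) auto
  also have "\<dots> = (\<integral>w. Y i (fst w) * (Y j (fst w) - ?Y' w) \<partial>?N)"
    using i1 i2 0 by (simp add: right_diff_distrib)
  finally show ?thesis using Lp_le_integral[OF L] by simp
qed

lemma cov_bound: "\<bar>\<integral>x. Y i x * Y j x \<partial>P\<bar> \<le> C * D * (1 / (1 + real (nat \<bar>i - j\<bar>))\<^sup>2)"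
  using cov_bound_le[of i j] cov_bound_le[of j i] by (cases "i \<le> j") (auto simp: mult.commute abs_minus_commute)

section \<open>Sums over finite index sets: variances, decoupling and expansion of blocks\<close>

definition U :: "int set \<Rightarrow> (int \<Rightarrow> real) \<Rightarrow> real" where
  "U A x = (\<Sum>i\<in>A. Y i x)"

lemma measurable_U[measurable]: "U A \<in> borel_measurable P"
  unfolding U_def by measurable

lemma U_mult: "(\<integral>x. U A x * U B x \<partial>P) = (\<Sum>i\<in>A. \<Sum>j\<in>B. \<integral>x. Y i x * Y j x \<partial>P)"
  unfolding U_def sum_product
  by (simp add: Bochner_Integration.integral_sum Bochner_Integration.integrable_sum Y_integrable)

text \<open>The variance grows linearly because the covariances are summable. The 4 is 2 for the two
  sides of an index times 2 for the sum of inverse squares.\<close>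

lemma U_square_le:
  assumes "finite A"
  shows "(\<integral>x. (U A x)\<^sup>2 \<partial>P) \<le> 4 * C * D * real (card A)"
proof -
  have "(\<integral>x. (U A x)\<^sup>2 \<partial>P) = (\<Sum>i\<in>A. \<Sum>j\<in>A. \<integral>x. Y i x * Y j x \<partial>P)"
    unfolding power2_eq_square by (rule U_mult)
  also have "\<dots> \<le> (\<Sum>i\<in>A. \<Sum>j\<in>A. C * D * (1 / (1 + real (nat \<bar>i - j\<bar>))\<^sup>2))"
    by (intro sum_mono abs_le_D1[OF cov_bound])
  also have "\<dots> = (\<Sum>i\<in>A. C * D * (\<Sum>j\<in>A. 1 / (1 + real (nat \<bar>i - j\<bar>))\<^sup>2))"
    by (simp add: sum_distrib_left)
  also have "\<dots> \<le> (\<Sum>i\<in>A. C * D * (2 * 2))"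
    by (intro sum_mono mult_left_mono sum_int_distance_le[where P = "\<lambda>_. True"] sum_inverse_square_le_2)
       (use assms C0 D0 in auto)
  finally show ?thesis by (simp add: algebra_simps)
qed

lemma U2: "finite A \<Longrightarrow> Lp_le P 2 (U A) (sqrt (4 * C * D * real (card A)))"
proof -
  assume A: "finite A"
  have "integrable P (\<lambda>x. U A x * U A x)"
    unfolding U_def sum_product by (intro Bochner_Integration.integrable_sum Y_integrable)
  then show ?thesis using U_square_le[OF A] C0 D0
    by (auto simp: Lp_le_def power2_eq_square[symmetric])
qed

text \<open>The triangle inequality alone. Linear growth is affordable since it is applied to single
  blocks, whose length is a small power of \<open>T\<close>.\<close>

lemma U4: "finite A \<Longrightarrow> Lp_le P 4 (U A) (real (card A) * C)"
  using Lp_le_sum[of 4 A P Y "\<lambda>_. C"] Y4 by (simp add: U_def[abs_def])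

lemma U_mix: "A \<subseteq> {..a} \<Longrightarrow> U A (mix {..a} x y) = U A x"
  unfolding U_def by (intro sum.cong adapted_le) auto

text \<open>Resampling the innovations up to \<open>a\<close> in the block alone makes it
  independent of \<open>F\<close>. The block sum moves in mean by at most a tail of inverse squares
  beyond distance \<open>s\<close>, so the cost does not grow with the size of
  \<open>B\<close>.\<close>

lemma block_independence:
  fixes F :: "_ \<Rightarrow> complex" and \<theta> :: real
  assumes [measurable]: "F \<in> borel_measurable P" and F: "\<And>x. cmod (F x) \<le> 1" "\<And>x y. F (mix {..a} x y) = F x"
    and B: "finite B" "\<And>i. i \<in> B \<Longrightarrow> a + int s \<le> i" and s: "s \<ge> 1" and \<theta>: "\<theta> \<ge> 0"
  shows "cmod ((\<integral>x. F x * iexp (\<theta> * U B x) \<partial>P) - (\<integral>x. F x \<partial>P) * (\<integral>x. iexp (\<theta> * U B x) \<partial>P)) \<le> \<theta> * (2 * D / real s)"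
proof -
  let ?N = "P \<Otimes>\<^sub>M P" and ?V = "\<lambda>x. iexp (\<theta> * U B x)"
  have neg: "- {..a} = {a<..}" by auto
  have bd: "integrable ?N f" if "f \<in> borel_measurable ?N" "\<And>w. cmod (f w) \<le> 1" for f
    by (rule PP.integrable_const_bound[where B = 1]) (use that in auto)
  have F1: "cmod (F x * iexp t) \<le> 1" for x t using F(1)[of x] by (simp add: norm_mult)
  have "(\<integral>w. F (fst w) * ?V (mix (- {..a}) (fst w) (snd w)) \<partial>?N) = (\<integral>x. F x \<partial>P) * (\<integral>x. ?V x \<partial>P)"
  proof (rule integral_mult_mix)
    show "integrable ?N (\<lambda>w. F (fst w) * ?V (snd w))" by (rule bd[OF _ F1]) measurable
  qed (use F in auto)
  then have 1: "(\<integral>x. F x * ?V x \<partial>P) - (\<integral>x. F x \<partial>P) * (\<integral>x. ?V x \<partial>P) =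
     (\<integral>w. F (fst w) * ?V (fst w) \<partial>?N) - (\<integral>w. F (fst w) * ?V (mix {a<..} (fst w) (snd w)) \<partial>?N)"
    unfolding neg by (subst integral_fst[symmetric, of "\<lambda>x. F x * ?V x"]) auto
  also have "\<dots> = (\<integral>w. F (fst w) * ?V (fst w) - F (fst w) * ?V (mix {a<..} (fst w) (snd w)) \<partial>?N)"
    by (rule Bochner_Integration.integral_diff[symmetric]; rule bd[OF _ F1]) measurable
  finally have eq: "(\<integral>x. F x * ?V x \<partial>P) - (\<integral>x. F x \<partial>P) * (\<integral>x. ?V x \<partial>P) = \<dots>" .
  have L2: "Lp_le ?N 2 (\<lambda>w. \<Sum>i\<in>B. Y i (fst w) - Y i (mix {a<..} (fst w) (snd w)))
       (\<Sum>i\<in>B. D * (1 / (1 + real (nat \<bar>a - i\<bar>))\<^sup>2))"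
    by (intro Lp_le_sum decay') (use B in \<open>auto dest!: B(2)\<close>)
  have "(\<Sum>i\<in>B. D * (1 / (1 + real (nat \<bar>a - i\<bar>))\<^sup>2)) \<le> D * (2 * (1 / real s))"
    unfolding sum_distrib_left[symmetric]
    by (intro mult_left_mono sum_int_distance_le[where P = "\<lambda>l. s \<le> l"] sum_inverse_square_le)
       (use B s D0 in \<open>auto dest!: B(2)\<close>)
  then have L1: "Lp_le ?N 1 (\<lambda>w. \<Sum>i\<in>B. Y i (fst w) - Y i (mix {a<..} (fst w) (snd w))) (2 * D / real s)"
    by (intro PP.Lp_le_2_1 Lp_le_mono[OF L2]) (simp add: mult.commute)
  let ?G = "\<lambda>w. \<Sum>i\<in>B. Y i (fst w) - Y i (mix {a<..} (fst w) (snd w))"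
  have "cmod (\<integral>w. F (fst w) * ?V (fst w) - F (fst w) * ?V (mix {a<..} (fst w) (snd w)) \<partial>?N)
      \<le> (\<integral>w. cmod (F (fst w) * ?V (fst w) - F (fst w) * ?V (mix {a<..} (fst w) (snd w))) \<partial>?N)"
    by (rule integral_norm_bound)
  also have "\<dots> \<le> (\<integral>w. \<theta> * \<bar>?G w\<bar> \<partial>?N)"
  proof (rule integral_mono)
    show "integrable ?N (\<lambda>w. cmod (F (fst w) * ?V (fst w) - F (fst w) * ?V (mix {a<..} (fst w) (snd w))))"
      by (intro integrable_norm Bochner_Integration.integrable_diff bd F1) auto
    show "integrable ?N (\<lambda>w. \<theta> * \<bar>?G w\<bar>)" using Lp_le_integrable[OF L1] by auto
    fix w
    have "cmod (F (fst w) * ?V (fst w) - F (fst w) * ?V (mix {a<..} (fst w) (snd w)))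
        = cmod (F (fst w)) * cmod (?V (fst w) - ?V (mix {a<..} (fst w) (snd w)))"
      by (simp add: right_diff_distrib[symmetric] norm_mult)
    also have "\<dots> \<le> 1 * \<bar>\<theta> * U B (fst w) - \<theta> * U B (mix {a<..} (fst w) (snd w))\<bar>"
      by (intro mult_mono F iexp_diff_le) auto
    also have "\<dots> = \<theta> * \<bar>?G w\<bar>" using \<theta>
      by (simp add: U_def right_diff_distrib[symmetric] abs_mult sum_subtractf)
    finally show "cmod (F (fst w) * ?V (fst w) - F (fst w) * ?V (mix {a<..} (fst w) (snd w))) \<le> \<theta> * \<bar>?G w\<bar>" .
  qed
  also have "\<dots> \<le> \<theta> * (2 * D / real s)"
    unfolding integral_mult_right_zero
    by (rule mult_left_mono[OF _ \<theta>]) (use L1 in \<open>simp add: Lp_le_def\<close>)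
  finally show ?thesis unfolding eq .
qed

lemma norm_integral_iexp: "cmod (\<integral>x. iexp (f x) \<partial>P) \<le> 1" if [measurable]: "f \<in> borel_measurable P"
proof -
  have "cmod (\<integral>x. iexp (f x) \<partial>P) \<le> (\<integral>x. cmod (iexp (f x)) \<partial>P)" by (rule integral_norm_bound)
  then show ?thesis by (simp add: prob_space)
qed

text \<open>One decoupling per added block; the factors already split off have modulus at most 1, so
  the errors merely add up.\<close>

lemma blocks_char:
  fixes B :: "nat \<Rightarrow> int set" and a :: "nat \<Rightarrow> int" and \<theta> :: real
  assumes B: "\<And>k. finite (B k)" "\<And>k. B k \<subseteq> {..a k}" "\<And>k i. i \<in> B (Suc k) \<Longrightarrow> a k + int s \<le> i"
    and a: "mono a" and s: "s \<ge> 1" and \<theta>: "\<theta> \<ge> 0"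
  shows "cmod ((\<integral>x. iexp (\<theta> * (\<Sum>k<n. U (B k) x)) \<partial>P) - (\<Prod>k<n. \<integral>x. iexp (\<theta> * U (B k) x) \<partial>P)) \<le> real n * (\<theta> * (2 * D / real s))"
proof (induction n)
  case 0
  then show ?case by (simp add: prob_space)
next
  case (Suc n)
  show ?case
  proof (cases n)
    case 0
    then show ?thesis using \<theta> D0 by simp
  next
    case (Suc n')
    let ?F = "\<lambda>x. iexp (\<theta> * (\<Sum>k<n. U (B k) x))" and ?V = "\<lambda>x. iexp (\<theta> * U (B n) x)"
    have "cmod ((\<integral>x. ?F x * ?V x \<partial>P) - (\<integral>x. ?F x \<partial>P) * (\<integral>x. ?V x \<partial>P)) \<le> \<theta> * (2 * D / real s)"
    \<comment> \<open>The cut is the right end of the last block already contained in the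
      product.\<close>
    proof (rule block_independence[where a = "a n'"])
      have "B k \<subseteq> {..a n'}" if "k < n" for k
        using B(2)[of k] monoD[OF a, of k n'] that Suc by force
      then show "?F (mix {..a n'} x y) = ?F x" for x y
        by (simp add: U_mix)
      show "a n' + int s \<le> i" if "i \<in> B n" for i using B(3)[of i n'] that Suc by simp
    qed (use B s \<theta> in auto)
    moreover have "cmod ((\<integral>x. ?F x \<partial>P) * (\<integral>x. ?V x \<partial>P) - (\<Prod>k<n. \<integral>x. iexp (\<theta> * U (B k) x) \<partial>P) * (\<integral>x. ?V x \<partial>P))
        \<le> (real n * (\<theta> * (2 * D / real s))) * 1"
      unfolding left_diff_distrib[symmetric] norm_mult
      by (intro mult_mono Suc.IH norm_integral_iexp) (use \<theta> D0 in auto)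
    ultimately have "cmod ((\<integral>x. ?F x * ?V x \<partial>P) - (\<Prod>k<n. \<integral>x. iexp (\<theta> * U (B k) x) \<partial>P) * (\<integral>x. ?V x \<partial>P))
        \<le> \<theta> * (2 * D / real s) + real n * (\<theta> * (2 * D / real s))"
      using norm_diff_triangle_le by fastforce
    moreover have "?F x * ?V x = iexp (\<theta> * (\<Sum>k<Suc n. U (B k) x))" for x
      by (simp add: exp_add[symmetric] algebra_simps)
    ultimately show ?thesis by (simp add: algebra_simps add_divide_distrib)
  qed
qed

text \<open>Both terms are compared with \<open>1 - \<theta>\<^sup>2 * v / 2\<close>: the
  characteristic function by Taylor expansion, the Gaussian factor by
  \<open>exp_minus_second_order\<close>. A vanishing variance does no harm.\<close>

lemma block_char_expansion:
  assumes A: "finite A" and \<theta>: "\<theta> \<ge> 0"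
  shows "cmod ((\<integral>x. iexp (\<theta> * U A x) \<partial>P) - exp (- (\<theta>\<^sup>2 * (\<integral>x. (U A x)\<^sup>2 \<partial>P) / 2)))
    \<le> \<theta> ^ 3 * (sqrt (4 * C * D * real (card A)) * (real (card A) * C)\<^sup>2) / 6 + \<theta> ^ 4 * (4 * C * D * real (card A))\<^sup>2 / 8"
proof -
  define v where "v = (\<integral>x. (U A x)\<^sup>2 \<partial>P)"
  let ?W = "\<lambda>x. \<theta> * U A x"
  have v: "0 \<le> v" "v \<le> 4 * C * D * real (card A)" using U_square_le[OF A] by (auto simp: v_def)
  \<comment> \<open>The third absolute moment is bounded by Cauchy-Schwarz between the sum, of L2
    size the square root of the block length, and its square, controlled by the cruder fourth
    moment.\<close>
  have "Lp_le P 2 (\<lambda>x. U A x * U A x) ((real (card A) * C) * (real (card A) * C))"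
    by (rule Lp_le_mult) (use U4[OF A] in simp_all)
  then have "Lp_le P 1 (\<lambda>x. U A x * (U A x * U A x)) (sqrt (4 * C * D * real (card A)) * ((real (card A) * C) * (real (card A) * C)))"
    by (intro Lp_le_mult[of P 1 "U A"]) (use U2[OF A] in simp_all)
  then have c3: "integrable P (\<lambda>x. \<bar>U A x\<bar> ^ 3)"
     "(\<integral>x. \<bar>U A x\<bar> ^ 3 \<partial>P) \<le> sqrt (4 * C * D * real (card A)) * (real (card A) * C)\<^sup>2"
  proof -
    have "\<bar>U A x\<bar> ^ 3 = \<bar>U A x * (U A x * U A x)\<bar> ^ 1" for x
      by (simp add: power3_eq_cube abs_mult)
    moreover assume "Lp_le P 1 (\<lambda>x. U A x * (U A x * U A x)) (sqrt (4 * C * D * real (card A)) * ((real (card A) * C) * (real (card A) * C)))"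
    ultimately show "integrable P (\<lambda>x. \<bar>U A x\<bar> ^ 3)"
      "(\<integral>x. \<bar>U A x\<bar> ^ 3 \<partial>P) \<le> sqrt (4 * C * D * real (card A)) * (real (card A) * C)\<^sup>2"
      unfolding Lp_le_def by (simp_all only: power2_eq_square power_one_right)
  qed
  have iU: "integrable P (U A)" using U2[OF A] Lp_le_2_1 Lp_le_integrable by blast
  have iU2: "integrable P (\<lambda>x. (U A x)\<^sup>2)" using U2[OF A] by (simp add: Lp_le_def)
  have EU: "(\<integral>x. U A x \<partial>P) = 0" unfolding U_def
    by (subst Bochner_Integration.integral_sum) (auto simp: mean Y_integrable)
  have iV: "integrable P (\<lambda>x. iexp (?W x))"
    by (rule integrable_const_bound[where B = 1]) auto
  let ?q = "\<lambda>x. 1 + \<i> * complex_of_real (?W x) - complex_of_real ((?W x)\<^sup>2 / 2)"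
  have "has_bochner_integral P (U A) 0" "has_bochner_integral P (\<lambda>x. (U A x)\<^sup>2) v"
    using iU iU2 EU by (auto simp: has_bochner_integral_iff v_def)
  then have h: "has_bochner_integral P ?W (\<theta> * 0)" "has_bochner_integral P (\<lambda>x. (?W x)\<^sup>2 / 2) (\<theta>\<^sup>2 * v / 2)"
    unfolding power_mult_distrib by (intro has_bochner_integral_mult_right has_bochner_integral_divide_zero; simp)+
  have "has_bochner_integral P ?q (1 + \<i> * complex_of_real (\<theta> * 0) - complex_of_real (\<theta>\<^sup>2 * v / 2))"
  proof (intro has_bochner_integral_diff has_bochner_integral_add has_bochner_integral_mult_right)
    show "has_bochner_integral P (\<lambda>x. 1 :: complex) 1"
      by (simp add: has_bochner_integral_iff prob_space)
    show "has_bochner_integral P (\<lambda>x. complex_of_real (?W x)) (complex_of_real (\<theta> * 0))"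
      by (rule has_bochner_integral_of_real[OF h(1)])
    show "has_bochner_integral P (\<lambda>x. complex_of_real ((?W x)\<^sup>2 / 2)) (complex_of_real (\<theta>\<^sup>2 * v / 2))"
      by (rule has_bochner_integral_of_real[OF h(2)])
  qed
  then have iq: "integrable P ?q" and q: "(\<integral>x. ?q x \<partial>P) = complex_of_real (1 - \<theta>\<^sup>2 * v / 2)"
    by (auto simp: has_bochner_integral_iff)
  have "cmod ((\<integral>x. iexp (?W x) \<partial>P) - complex_of_real (1 - \<theta>\<^sup>2 * v / 2)) = cmod (\<integral>x. iexp (?W x) - ?q x \<partial>P)"
    unfolding q[symmetric] using iV iq by simp
  also have "\<dots> \<le> (\<integral>x. cmod (iexp (?W x) - ?q x) \<partial>P)" by (rule integral_norm_bound)
  also have "\<dots> \<le> (\<integral>x. \<theta> ^ 3 * \<bar>U A x\<bar> ^ 3 / 6 \<partial>P)"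
  proof (rule integral_mono)
    show "integrable P (\<lambda>x. cmod (iexp (?W x) - ?q x))" using iV iq by auto
    fix x
    have "cmod (iexp (?W x) - ?q x) \<le> \<bar>?W x\<bar> ^ 3 / 6"
      using iexp_approx1[of "?W x" 2]
      by (simp add: numeral_eq_Suc power_mult_distrib fact_numeral algebra_simps power2_eq_square)
    then show "cmod (iexp (?W x) - ?q x) \<le> \<theta> ^ 3 * \<bar>U A x\<bar> ^ 3 / 6"
      using \<theta> by (simp add: abs_mult power_mult_distrib)
  qed (use c3 in auto)
  also have "\<dots> \<le> \<theta> ^ 3 * (sqrt (4 * C * D * real (card A)) * (real (card A) * C)\<^sup>2) / 6"
    using c3 \<theta> by (auto intro!: divide_right_mono mult_left_mono)
  finally have 1: "cmod ((\<integral>x. iexp (?W x) \<partial>P) - complex_of_real (1 - \<theta>\<^sup>2 * v / 2)) \<le> \<dots>" .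
  have "cmod (complex_of_real (1 - \<theta>\<^sup>2 * v / 2) - complex_of_real (exp (- (\<theta>\<^sup>2 * v / 2)))) \<le> (\<theta>\<^sup>2 * v / 2)\<^sup>2 / 2"
    unfolding of_real_diff[symmetric] norm_of_real
    using exp_minus_second_order[of "\<theta>\<^sup>2 * v / 2"] v by (simp add: abs_minus_commute)
  also have "\<dots> = \<theta> ^ 4 * v\<^sup>2 / 8" by (simp add: power_mult_distrib power_divide)
  also have "\<dots> \<le> \<theta> ^ 4 * (4 * C * D * real (card A))\<^sup>2 / 8"
    using v by (intro divide_right_mono mult_left_mono power_mono) auto
  finally show ?thesis using 1 norm_diff_triangle_le[OF 1] unfolding v_def[symmetric] by blast
qed


text \<open>All factors have modulus at most 1, so the products differ by at most the sum of the
  differences; the Gaussian factors multiply to the exponential of the summed block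
  variances.\<close>

lemma prod_iexp_bound:
  fixes A :: "nat \<Rightarrow> int set"
  assumes A: "\<And>k. k < n \<Longrightarrow> finite (A k)" "\<And>k. k < n \<Longrightarrow> card (A k) = b" and \<theta>: "\<theta> \<ge> 0"
  shows "cmod ((\<Prod>k<n. \<integral>x. iexp (\<theta> * U (A k) x) \<partial>P) - exp (- (\<theta>\<^sup>2 * (\<Sum>k<n. \<integral>x. (U (A k) x)\<^sup>2 \<partial>P) / 2)))
    \<le> real n * (\<theta> ^ 3 * (sqrt (4 * C * D * real b) * (real b * C)\<^sup>2) / 6 + \<theta> ^ 4 * (4 * C * D * real b)\<^sup>2 / 8)"
proof -
  let ?w = "\<lambda>k. complex_of_real (exp (- (\<theta>\<^sup>2 * (\<integral>x. (U (A k) x)\<^sup>2 \<partial>P) / 2)))"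
  have "(\<Prod>k<n. ?w k) = complex_of_real (exp (- (\<theta>\<^sup>2 * (\<Sum>k<n. \<integral>x. (U (A k) x)\<^sup>2 \<partial>P) / 2)))"
    by (simp add: exp_sum[symmetric] of_real_prod[symmetric] sum_distrib_left sum_divide_distrib sum_negf[symmetric] del: of_real_prod)
  moreover have "cmod ((\<Prod>k<n. \<integral>x. iexp (\<theta> * U (A k) x) \<partial>P) - (\<Prod>k<n. ?w k))
      \<le> (\<Sum>k<n. cmod ((\<integral>x. iexp (\<theta> * U (A k) x) \<partial>P) - ?w k))"
    by (rule norm_prod_diff) (auto intro!: norm_integral_iexp simp del: of_real_mult of_real_exp)
  moreover have "\<dots> \<le> (\<Sum>k<n. \<theta> ^ 3 * (sqrt (4 * C * D * real b) * (real b * C)\<^sup>2) / 6 + \<theta> ^ 4 * (4 * C * D * real b)\<^sup>2 / 8)"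
    using A \<theta> by (intro sum_mono) (use block_char_expansion[OF A(1) \<theta>] in simp)
  ultimately show ?thesis by simp
qed

text \<open>Only covariances between different blocks remain. Each index meets the others at
  distances of at least \<open>s\<close>, where the inverse squares sum to at most
  \<open>2 / s\<close>.\<close>

lemma blocks_variance:
  fixes A :: "nat \<Rightarrow> int set"
  assumes A: "\<And>k. finite (A k)" and sep: "\<And>k l i j. k \<noteq> l \<Longrightarrow> i \<in> A k \<Longrightarrow> j \<in> A l \<Longrightarrow> int s \<le> \<bar>i - j\<bar>" and s: "s \<ge> 1"
  shows "\<bar>(\<integral>x. (U (\<Union>k<n. A k) x)\<^sup>2 \<partial>P) - (\<Sum>k<n. \<integral>x. (U (A k) x)\<^sup>2 \<partial>P)\<bar> \<le> real (card (\<Union>k<n. A k)) * (2 * C * D / real s)"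
proof -
  let ?W = "\<Union>k<n. A k"
  let ?c = "\<lambda>i j. \<integral>x. Y i x * Y j x \<partial>P"
  have disj: "A k \<inter> A l = {}" if "k \<noteq> l" for k l using sep[OF that] s by fastforce
  have UN: "(\<Sum>i\<in>?W. g i) = (\<Sum>k<n. \<Sum>i\<in>A k. g i)" for g :: "int \<Rightarrow> real"
    by (rule sum.UNION_disjoint) (use A disj in auto)
  have "(\<integral>x. (U ?W x)\<^sup>2 \<partial>P) = (\<Sum>k<n. \<Sum>i\<in>A k. \<Sum>j\<in>?W. ?c i j)"
    unfolding power2_eq_square U_mult UN ..
  moreover have "(\<Sum>k<n. \<integral>x. (U (A k) x)\<^sup>2 \<partial>P) = (\<Sum>k<n. \<Sum>i\<in>A k. \<Sum>j\<in>A k. ?c i j)"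
    unfolding power2_eq_square U_mult ..
  ultimately have "(\<integral>x. (U ?W x)\<^sup>2 \<partial>P) - (\<Sum>k<n. \<integral>x. (U (A k) x)\<^sup>2 \<partial>P) =
     (\<Sum>k<n. \<Sum>i\<in>A k. (\<Sum>j\<in>?W. ?c i j) - (\<Sum>j\<in>A k. ?c i j))"
    by (simp add: sum_subtractf)
  also have "\<bar>\<dots>\<bar> \<le> (\<Sum>k<n. \<Sum>i\<in>A k. 2 * C * D / real s)"
  proof (intro order_trans[OF sum_abs] sum_mono)
    fix k i assume k: "k \<in> {..<n}" and i: "i \<in> A k"
    have "(\<Sum>j\<in>?W. ?c i j) - (\<Sum>j\<in>A k. ?c i j) = (\<Sum>j\<in>?W - A k. ?c i j)"
      by (subst sum_diff) (use A k in auto)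
    also have "\<bar>\<dots>\<bar> \<le> (\<Sum>j\<in>?W - A k. C * D * (1 / (1 + real (nat \<bar>i - j\<bar>))\<^sup>2))"
      by (intro order_trans[OF sum_abs] sum_mono cov_bound)
    also have "\<dots> = C * D * (\<Sum>j\<in>?W - A k. 1 / (1 + real (nat \<bar>i - j\<bar>))\<^sup>2)"
      by (simp add: sum_distrib_left)
    also have "\<dots> \<le> C * D * (2 * (1 / real s))"
    proof (intro mult_left_mono sum_int_distance_le[where P = "\<lambda>l. s \<le> l"] sum_inverse_square_le)
      fix j assume "j \<in> ?W - A k"
      then obtain l where l: "j \<in> A l" "l \<noteq> k" by auto
      then have "int s \<le> \<bar>i - j\<bar>" using sep[of k l i j] i by simp
      then show "s \<le> nat \<bar>i - j\<bar>" by linarith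
    qed (use A s C0 D0 in auto)
    finally show "\<bar>(\<Sum>j\<in>?W. ?c i j) - (\<Sum>j\<in>A k. ?c i j)\<bar> \<le> 2 * C * D / real s" by (simp add: mult_ac)
  qed
  also have "\<dots> = real (card ?W) * (2 * C * D / real s)"
    unfolding UN[of "\<lambda>_. 2 * C * D / real s", symmetric] by simp
  finally show ?thesis .
qed

lemma U_union: "finite A \<Longrightarrow> finite B \<Longrightarrow> A \<inter> B = {} \<Longrightarrow> U (A \<union> B) x = U A x + U B x"
  by (simp add: U_def sum.union_disjoint)

text \<open>The difference of the squares factors as
  \<open>U R x * (U (W \<union> R) x + U W x)\<close>, so Cauchy-Schwarz leaves only the square root
  of the size of \<open>R\<close>.\<close>

lemma remainder_bounds:
  assumes W: "finite W" and R: "finite R" and WR: "W \<inter> R = {}" and \<theta>: "\<theta> \<ge> 0"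
  shows "cmod ((\<integral>x. iexp (\<theta> * U (W \<union> R) x) \<partial>P) - (\<integral>x. iexp (\<theta> * U W x) \<partial>P)) \<le> \<theta> * sqrt (4 * C * D * real (card R))"
    and "\<bar>(\<integral>x. (U (W \<union> R) x)\<^sup>2 \<partial>P) - (\<integral>x. (U W x)\<^sup>2 \<partial>P)\<bar> \<le>
       sqrt (4 * C * D * real (card R)) * (2 * sqrt (4 * C * D * real (card (W \<union> R))))"
proof -
  have i: "integrable P (\<lambda>x. iexp (f x))" if [measurable]: "f \<in> borel_measurable P" for f
    by (rule integrable_const_bound[where B = 1]) auto
  note R2 = U2[OF R]
  have R1: "integrable P (U R)" "(\<integral>x. \<bar>U R x\<bar> \<partial>P) \<le> sqrt (4 * C * D * real (card R))"
    using Lp_le_2_1[OF R2] Lp_le_integrable by (auto simp: Lp_le_def integrable_abs_iff)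
  have "cmod ((\<integral>x. iexp (\<theta> * U (W \<union> R) x) \<partial>P) - (\<integral>x. iexp (\<theta> * U W x) \<partial>P)) =
     cmod (\<integral>x. iexp (\<theta> * U (W \<union> R) x) - iexp (\<theta> * U W x) \<partial>P)"
    by (subst Bochner_Integration.integral_diff) (auto intro!: i simp del: of_real_mult)
  also have "\<dots> \<le> (\<integral>x. cmod (iexp (\<theta> * U (W \<union> R) x) - iexp (\<theta> * U W x)) \<partial>P)"
    by (rule integral_norm_bound)
  also have "\<dots> \<le> (\<integral>x. \<theta> * \<bar>U R x\<bar> \<partial>P)"
  proof (rule integral_mono)
    show "integrable P (\<lambda>x. cmod (iexp (\<theta> * U (W \<union> R) x) - iexp (\<theta> * U W x)))"
      by (intro integrable_norm Bochner_Integration.integrable_diff i) auto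
    fix x
    have "\<theta> * U (W \<union> R) x - \<theta> * U W x = \<theta> * U R x"
      by (simp add: U_union[OF W R WR] algebra_simps)
    then show "cmod (iexp (\<theta> * U (W \<union> R) x) - iexp (\<theta> * U W x)) \<le> \<theta> * \<bar>U R x\<bar>"
      using iexp_diff_le[of "\<theta> * U (W \<union> R) x" "\<theta> * U W x"] \<theta> by (simp add: abs_mult)
  qed (use R1 in auto)
  also have "\<dots> \<le> \<theta> * sqrt (4 * C * D * real (card R))"
    unfolding integral_mult_right_zero by (rule mult_left_mono[OF R1(2) \<theta>])
  finally show "cmod ((\<integral>x. iexp (\<theta> * U (W \<union> R) x) \<partial>P) - (\<integral>x. iexp (\<theta> * U W x) \<partial>P)) \<le> \<theta> * sqrt (4 * C * D * real (card R))" .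
  let ?q = "sqrt (4 * C * D * real (card (W \<union> R)))"
  have fin: "finite (W \<union> R)" using W R by simp
  have "card W \<le> card (W \<union> R)" using fin by (intro card_mono) auto
  then have "Lp_le P 2 (U W) ?q"
    using C0 D0 by (intro Lp_le_mono[OF U2[OF W]] real_sqrt_le_mono mult_left_mono) auto
  from Lp_le_add[OF U2[OF fin] this]
  have "Lp_le P 2 (\<lambda>x. U (W \<union> R) x + U W x) (2 * ?q)" by simp
  then have L: "Lp_le P 1 (\<lambda>x. U R x * (U (W \<union> R) x + U W x)) (sqrt (4 * C * D * real (card R)) * (2 * ?q))"
    by (intro Lp_le_mult[of P 1 "U R"]) (use R2 in simp_all)
  have iW: "integrable P (\<lambda>x. (U A x)\<^sup>2)" if "finite A" for A
    using U2[OF that] by (simp add: Lp_le_def)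
  have "(\<integral>x. (U (W \<union> R) x)\<^sup>2 \<partial>P) - (\<integral>x. (U W x)\<^sup>2 \<partial>P) = (\<integral>x. (U (W \<union> R) x)\<^sup>2 - (U W x)\<^sup>2 \<partial>P)"
    using iW[OF fin] iW[OF W] by simp
  also have "\<dots> = (\<integral>x. U R x * (U (W \<union> R) x + U W x) \<partial>P)"
    by (rule Bochner_Integration.integral_cong) (auto simp: U_union[OF W R WR] algebra_simps power2_eq_square)
  finally show "\<bar>(\<integral>x. (U (W \<union> R) x)\<^sup>2 \<partial>P) - (\<integral>x. (U W x)\<^sup>2 \<partial>P)\<bar> \<le> sqrt (4 * C * D * real (card R)) * (2 * ?q)"
    using Lp_le_integral[OF L] by simp
qed

text \<open>Bernstein's blocking: \<open>n\<close> big blocks of length \<open>b\<close>, separated by gaps of length \<open>s\<close>; \<open>r\<close> indices are left over.\<close>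

lemma clt_blocks:
  fixes T b s :: nat and \<theta> :: real
  assumes s: "s \<ge> 1" and \<theta>: "\<theta> \<ge> 0"
  defines "n \<equiv> T div (b + s)" and "r \<equiv> T - T div (b + s) * b" and "v \<equiv> 4 * C * D"
  shows "cmod ((\<integral>x. iexp (\<theta> * U {1..int T} x) \<partial>P) - exp (- (\<theta>\<^sup>2 * (\<integral>x. (U {1..int T} x)\<^sup>2 \<partial>P) / 2)))
    \<le> \<theta> * sqrt (v * real r) + real n * (\<theta> * (2 * D / real s))
      + real n * (\<theta> ^ 3 * (sqrt (v * real b) * (real b * C)\<^sup>2) / 6 + \<theta> ^ 4 * (v * real b)\<^sup>2 / 8)
      + \<theta>\<^sup>2 * (sqrt (v * real r) * (2 * sqrt (v * real T)) + real T * (2 * C * D / real s)) / 2"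
proof -
  define q where "q = b + s"
  define A where "A k = {int (k * q) + 1..int (k * q + b)}" for k
  define W where "W = (\<Union>k<n. A k)"
  define R where "R = {1..int T} - W"
  have nq: "n * q \<le> T" by (simp add: n_def q_def)
  have A: "finite (A k)" "card (A k) = b" for k by (auto simp: A_def)
  have step: "int (k * q + b) + int s \<le> int (l * q)" if "k < l" for k l
  proof -
    have "(k + 1) * q \<le> l * q" using that by (intro mult_right_mono) auto
    then have "k * q + b + s \<le> l * q" by (simp add: q_def algebra_simps)
    then show ?thesis unfolding of_nat_add[symmetric] of_nat_le_iff .
  qed
  have sep: "int s \<le> \<bar>i - j\<bar>" if "k \<noteq> l" "i \<in> A k" "j \<in> A l" for k l i j
    using step[of k l] step[of l k] that unfolding A_def by (cases "k < l") auto
  have disj: "A k \<inter> A l = {}" if "k \<noteq> l" for k l using sep[OF that] s by fastforce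
  have WT: "W \<subseteq> {1..int T}"
  proof
    fix i assume "i \<in> W"
    then obtain k where k: "k < n" "i \<in> A k" by (auto simp: W_def)
    have "int (k * q + b) + int s \<le> int (n * q)" by (rule step[OF k(1)])
    also have "\<dots> \<le> int T" using nq by (simp only: of_nat_le_iff)
    finally have "int (k * q + b) + int s \<le> int T" .
    moreover have "0 \<le> int (k * q)" by simp
    ultimately show "i \<in> {1..int T}" using k(2) unfolding A_def by (simp del: of_nat_mult)
  qed
  have cW: "card W = n * b"
    unfolding W_def by (subst card_UN_disjoint) (use A disj in auto)
  have fin: "finite W" "finite R" "W \<inter> R = {}" "W \<union> R = {1..int T}" using WT A by (auto simp: W_def R_def)
  have cR: "card R = r"
    unfolding R_def using WT fin(1) by (subst card_Diff_subset) (auto simp: cW r_def n_def)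
  have cWT: "real (card W) \<le> real T" using card_mono[OF _ WT] by simp
  have UW: "U W x = (\<Sum>k<n. U (A k) x)" for x
    unfolding W_def U_def by (rule sum.UNION_disjoint) (use A disj in auto)
  let ?E = "\<lambda>f. \<integral>x. iexp (\<theta> * f x) \<partial>P"
  let ?S = "\<integral>x. (U {1..int T} x)\<^sup>2 \<partial>P"
  let ?V = "\<Sum>k<n. \<integral>x. (U (A k) x)\<^sup>2 \<partial>P"
  have 1: "cmod (?E (U {1..int T}) - ?E (U W)) \<le> \<theta> * sqrt (v * real r)"
    using remainder_bounds(1)[OF fin(1-3) \<theta>] unfolding fin(4) cR v_def .
  have 2: "cmod (?E (U W) - (\<Prod>k<n. ?E (U (A k)))) \<le> real n * (\<theta> * (2 * D / real s))"
    unfolding UW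
  proof (rule blocks_char[where a = "\<lambda>k. int (k * q + b)"])
    show "int (k * q + b) + int s \<le> i" if "i \<in> A (Suc k)" for k i
      using step[of k "Suc k"] that unfolding A_def by simp
    show "mono (\<lambda>k. int (k * q + b))" by (intro monoI) (simp del: of_nat_add of_nat_mult)
  qed (use A s \<theta> in \<open>auto simp: A_def\<close>)
  have 3: "cmod ((\<Prod>k<n. ?E (U (A k))) - exp (- (\<theta>\<^sup>2 * ?V / 2))) \<le>
     real n * (\<theta> ^ 3 * (sqrt (v * real b) * (real b * C)\<^sup>2) / 6 + \<theta> ^ 4 * (v * real b)\<^sup>2 / 8)"
    unfolding v_def by (rule prod_iexp_bound) (use A \<theta> in auto)
  have "\<bar>?S - (\<integral>x. (U W x)\<^sup>2 \<partial>P)\<bar> \<le> sqrt (v * real r) * (2 * sqrt (v * real T))"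
    using remainder_bounds(2)[OF fin(1-3) \<theta>] unfolding fin(4) cR v_def by simp
  moreover have "\<bar>(\<integral>x. (U W x)\<^sup>2 \<partial>P) - ?V\<bar> \<le> real T * (2 * C * D / real s)"
    unfolding W_def
    by (rule order_trans[OF blocks_variance[OF _ sep s] mult_right_mono])
       (use A cWT C0 D0 in \<open>auto simp: W_def\<close>)
  ultimately have dV: "\<bar>?V - ?S\<bar> \<le> sqrt (v * real r) * (2 * sqrt (v * real T)) + real T * (2 * C * D / real s)"
    by linarith
  \<comment> \<open>The sum of block variances is exchanged for the variance of the whole sum. The
    exponential is 1-Lipschitz on negative arguments, so an absolute error of the variances is
    enough.\<close>
  have "cmod (complex_of_real (exp (- (\<theta>\<^sup>2 * ?V / 2))) - complex_of_real (exp (- (\<theta>\<^sup>2 * ?S / 2)))) \<le> \<bar>\<theta>\<^sup>2 * ?V / 2 - \<theta>\<^sup>2 * ?S / 2\<bar>"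
    unfolding of_real_diff[symmetric] norm_of_real
    by (rule exp_minus_diff_le) (auto intro!: mult_nonneg_nonneg sum_nonneg divide_nonneg_nonneg)
  also have "\<dots> = \<theta>\<^sup>2 * \<bar>?V - ?S\<bar> / 2" by (simp add: diff_divide_distrib[symmetric] right_diff_distrib[symmetric] abs_mult)
  also have "\<dots> \<le> \<theta>\<^sup>2 * (sqrt (v * real r) * (2 * sqrt (v * real T)) + real T * (2 * C * D / real s)) / 2"
    by (intro divide_right_mono mult_left_mono dV) auto
  finally have 4: "cmod (complex_of_real (exp (- (\<theta>\<^sup>2 * ?V / 2))) - complex_of_real (exp (- (\<theta>\<^sup>2 * ?S / 2)))) \<le> \<dots>" .
  show ?thesis
    by (rule norm_diff_triangle_le[OF norm_diff_triangle_le[OF norm_diff_triangle_le[OF 1 2] 3] 4])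
qed

end

text \<open>The bound of \<open>clt_blocks\<close> for \<open>b\<close> near
  \<open>t powr 0.3\<close> and \<open>s\<close> near \<open>t powr 0.25\<close>. If these lengths
  are powers with exponents x and y, discarding the gaps needs y < x, decoupling needs x + y > 1/2,
  and the third-order Taylor term needs x < 1/3. With the chosen values the last two errors are both
  of order \<open>t powr (-0.05)\<close>.\<close>

definition clt_err :: "real \<Rightarrow> real \<Rightarrow> real \<Rightarrow> real" where
  "clt_err C D t = (sqrt (4 * C * D) + 4 * C * D) * sqrt ((2 * t powr 0.95 + t powr 0.3 + t powr 0.25) / t) +
     (8 * D + sqrt (4 * C * D) * C\<^sup>2 / 3) * t powr (-0.05) + (4 * C * D)\<^sup>2 / 4 * t powr (-0.7) + 2 * C * D * t powr (-0.25)"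

lemma clt_err_tendsto: "(\<lambda>T. clt_err C D (real T)) \<longlonglongrightarrow> 0"
proof -
  have "(\<lambda>T. sqrt ((2 * real T powr 0.95 + real T powr 0.3 + real T powr 0.25) / real T)) \<longlonglongrightarrow> 0"
    "(\<lambda>T. real T powr (-0.05)) \<longlonglongrightarrow> 0" "(\<lambda>T. real T powr (-0.7)) \<longlonglongrightarrow> 0" "(\<lambda>T. real T powr (-0.25)) \<longlonglongrightarrow> 0"
    by real_asymp+
  then have "(\<lambda>T. clt_err C D (real T)) \<longlonglongrightarrow> (sqrt (4 * C * D) + 4 * C * D) * 0 +
     (8 * D + sqrt (4 * C * D) * C\<^sup>2 / 3) * 0 + (4 * C * D)\<^sup>2 / 4 * 0 + 2 * C * D * 0"
    unfolding clt_err_def by (intro tendsto_intros)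
  then show ?thesis by simp
qed

lemma nat_floor_half: "1 \<le> x \<Longrightarrow> x / 2 \<le> real (nat \<lfloor>x\<rfloor>) \<and> real (nat \<lfloor>x\<rfloor>) \<le> x \<and> 1 \<le> nat \<lfloor>x\<rfloor>"
proof -
  assume "1 \<le> x"
  then have "1 \<le> \<lfloor>x\<rfloor>" by simp
  moreover from this have "real (nat \<lfloor>x\<rfloor>) = of_int \<lfloor>x\<rfloor>" by simp
  ultimately show ?thesis using real_of_int_floor_add_one_gt[of x] of_int_floor_le[of x] by linarith
qed

context weakly_dependent
begin

lemma clt:
  assumes T: "T \<ge> 1"
  shows "cmod ((\<integral>x. iexp (U {1..int T} x / sqrt (real T)) \<partial>P) - exp (- ((\<integral>x. (U {1..int T} x)\<^sup>2 \<partial>P) / (2 * real T)))) \<le> clt_err C D (real T)"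
proof -
  define t where "t = real T"
  have t: "t \<ge> 1" using T by (simp add: t_def)
  define b s where "b = nat \<lfloor>t powr 0.3\<rfloor>" and "s = nat \<lfloor>t powr 0.25\<rfloor>"
  have b: "t powr 0.3 / 2 \<le> real b" "real b \<le> t powr 0.3" "1 \<le> b"
    using nat_floor_half[of "t powr 0.3"] t by (auto simp: b_def ge_one_powr_ge_zero)
  have s: "t powr 0.25 / 2 \<le> real s" "real s \<le> t powr 0.25" "1 \<le> s"
    using nat_floor_half[of "t powr 0.25"] t by (auto simp: s_def ge_one_powr_ge_zero)
  define \<theta> where "\<theta> = t powr (-0.5)"
  have powr_pow: "(t powr a) ^ k = t powr (a * real k)" for a k
    using t by (simp add: powr_realpow[symmetric] powr_powr)
  have half: "t powr (1 / 2) = sqrt t" using t by (simp add: powr_half_sqrt)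
  have \<theta>1: "\<theta> \<ge> 0" by (simp add: \<theta>_def)
  have \<theta>2: "\<theta> = 1 / sqrt t" unfolding \<theta>_def half[symmetric] powr_minus_divide by simp
  have \<theta>3: "\<theta>\<^sup>2 = 1 / t" unfolding \<theta>2 power_divide using t by simp
  have \<theta>4: "\<theta> ^ 3 = t powr (-1.5)" "\<theta> ^ 4 = t powr (-2)" unfolding \<theta>_def powr_pow by simp_all
  note \<theta> = \<theta>1 \<theta>2 \<theta>3 \<theta>4
  define n r v where "n = T div (b + s)" and "r = T - T div (b + s) * b" and "v = 4 * C * D"
  have v: "v \<ge> 0" using C0 D0 by (simp add: v_def)
  have mod: "n * (b + s) \<le> T" "T < (n + 1) * (b + s)"
    using b(3) dividend_less_times_div[of "b + s" T] div_times_less_eq_dividend[of T "b + s"]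
    by (simp_all add: n_def mult.commute)
  have n: "real n \<le> 2 * t powr 0.7"
  proof -
    have "real n * (t powr 0.3 / 2) \<le> real n * real b" by (intro mult_left_mono b) auto
    also have "\<dots> \<le> t" using mod(1) unfolding t_def of_nat_mult[symmetric] of_nat_le_iff by (simp add: algebra_simps)
    finally have "real n \<le> 2 * (t / t powr 0.3)" using t by (simp add: pos_le_divide_eq)
    also have "t / t powr 0.3 = t powr 0.7" using t powr_diff[of t 1 "0.3"] by simp
    finally show ?thesis .
  qed
  \<comment> \<open>The leftover consists of the \<open>n\<close> gaps and of an incomplete last
    period shorter than \<open>b + s\<close>.\<close>
  have r: "real r \<le> 2 * t powr 0.95 + t powr 0.3 + t powr 0.25"
  proof -
    have "T < n * b + (n * s + b + s)" using mod(2) by (simp add: algebra_simps)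
    then have "r \<le> n * s + b + s" unfolding r_def n_def[symmetric] by linarith
    then have "real r \<le> real n * real s + real b + real s" by (metis of_nat_add of_nat_le_iff of_nat_mult)
    also have "\<dots> \<le> 2 * t powr 0.7 * t powr 0.25 + t powr 0.3 + t powr 0.25"
      by (intro add_mono mult_mono n b s) auto
    also have "2 * t powr 0.7 * t powr 0.25 = 2 * t powr 0.95"
      unfolding mult.assoc powr_add[symmetric] by simp
    finally show ?thesis .
  qed
  define \<rho> where "\<rho> = 2 * t powr 0.95 + t powr 0.3 + t powr 0.25"
  have sr: "sqrt (v * real r) \<le> sqrt v * sqrt \<rho>"
    unfolding real_sqrt_mult[symmetric] using r v by (intro real_sqrt_le_mono mult_left_mono) (auto simp: \<rho>_def)
  have ds: "1 / real s \<le> 2 * t powr (-0.25)"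
  proof -
    have "1 / real s \<le> 1 / (t powr 0.25 / 2)" using s t by (intro divide_left_mono) auto
    then show ?thesis by (simp add: powr_minus_divide)
  qed
  have 1: "\<theta> * sqrt (v * real r) \<le> sqrt v * sqrt (\<rho> / t)"
  proof -
    have "\<theta> * sqrt (v * real r) \<le> \<theta> * (sqrt v * sqrt \<rho>)" by (intro mult_left_mono sr \<theta>)
    then show ?thesis by (simp add: \<theta>(2) real_sqrt_divide)
  qed
  have 2: "real n * (\<theta> * (2 * D / real s)) \<le> 8 * D * t powr (-0.05)"
  proof -
    have "real n * (\<theta> * (2 * D / real s)) = 2 * D * \<theta> * (real n * (1 / real s))" by simp
    also have "\<dots> \<le> 2 * D * \<theta> * (2 * t powr 0.7 * (2 * t powr (-0.25)))"
      using D0 \<theta> by (intro mult_left_mono mult_mono n ds) auto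
    also have "\<dots> = 8 * D * (t powr (-0.5) * t powr 0.7 * t powr (-0.25))" by (simp add: \<theta>_def)
    also have "t powr (-0.5) * t powr 0.7 * t powr (-0.25) = t powr (-0.05)"
      unfolding powr_add[symmetric] by simp
    finally show ?thesis .
  qed
  have 3: "real n * (\<theta> ^ 3 * (sqrt (v * real b) * (real b * C)\<^sup>2) / 6 + \<theta> ^ 4 * (v * real b)\<^sup>2 / 8)
      \<le> sqrt v * C\<^sup>2 / 3 * t powr (-0.05) + v\<^sup>2 / 4 * t powr (-0.7)"
  proof -
    have "sqrt (v * real b) \<le> sqrt v * t powr 0.15"
    proof -
      have "sqrt (real b) \<le> sqrt (t powr 0.3)" using b by simp
      also have "\<dots> = t powr 0.15" unfolding powr_half_sqrt[OF powr_ge_zero, symmetric] powr_powr by simp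
      finally show ?thesis using v by (simp add: real_sqrt_mult mult_left_mono)
    qed
    moreover have "(real b * C)\<^sup>2 \<le> (t powr 0.3 * C)\<^sup>2" using b C0 by (intro power_mono mult_right_mono) auto
    moreover have "(v * real b)\<^sup>2 \<le> (v * t powr 0.3)\<^sup>2" using b v by (intro power_mono mult_left_mono) auto
    ultimately have "real n * (\<theta> ^ 3 * (sqrt (v * real b) * (real b * C)\<^sup>2) / 6 + \<theta> ^ 4 * (v * real b)\<^sup>2 / 8) \<le>
      2 * t powr 0.7 * (\<theta> ^ 3 * (sqrt v * t powr 0.15 * (t powr 0.3 * C)\<^sup>2) / 6 + \<theta> ^ 4 * (v * t powr 0.3)\<^sup>2 / 8)"
      using \<theta>(1) v by (intro mult_mono[OF n] add_mono divide_right_mono mult_left_mono mult_mono) auto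
    also have "\<dots> = sqrt v * C\<^sup>2 / 3 * (t powr 0.7 * t powr (-1.5) * t powr 0.15 * (t powr 0.3)\<^sup>2)
        + v\<^sup>2 / 4 * (t powr 0.7 * t powr (-2) * (t powr 0.3)\<^sup>2)"
      unfolding \<theta>4 by (simp add: power_mult_distrib algebra_simps)
    also have "(t powr 0.3)\<^sup>2 = t powr 0.6" unfolding powr_pow by simp
    also have "t powr 0.7 * t powr (-1.5) * t powr 0.15 * t powr 0.6 = t powr (-0.05)"
      unfolding powr_add[symmetric] by simp
    also have "t powr 0.7 * t powr (-2) * t powr 0.6 = t powr (-0.7)"
      unfolding powr_add[symmetric] by simp
    finally show ?thesis .
  qed
  have 4: "\<theta>\<^sup>2 * (sqrt (v * real r) * (2 * sqrt (v * real T)) + real T * (2 * C * D / real s)) / 2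
     \<le> v * sqrt (\<rho> / t) + 2 * C * D * t powr (-0.25)"
  proof -
    have "sqrt (v * real r) * (2 * sqrt (v * t)) + t * (2 * C * D * (1 / real s)) \<le>
       (sqrt v * sqrt \<rho>) * (2 * sqrt (v * t)) + t * (2 * C * D * (2 * t powr (-0.25)))"
      using v t C0 D0 by (intro add_mono mult_right_mono sr mult_left_mono ds) auto
    then have "\<theta>\<^sup>2 * (sqrt (v * real r) * (2 * sqrt (v * real T)) + real T * (2 * C * D / real s)) / 2 \<le>
       1 / t * ((sqrt v * sqrt \<rho>) * (2 * sqrt (v * t)) + t * (2 * C * D * (2 * t powr (-0.25)))) / 2"
      unfolding \<theta>(3) t_def[symmetric] using t by (intro divide_right_mono mult_left_mono) auto
    also have "\<dots> = (sqrt v * sqrt v) * (sqrt \<rho> * (sqrt t / t)) + 2 * C * D * t powr (-0.25)"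
      using t by (simp add: real_sqrt_mult add_divide_distrib)
    also have "sqrt t / t = 1 / sqrt t" using t real_div_sqrt[of t] by (simp add: divide_simps)
    finally show ?thesis using v by (simp add: real_sqrt_divide)
  qed
  have "cmod ((\<integral>x. iexp (\<theta> * U {1..int T} x) \<partial>P) - exp (- (\<theta>\<^sup>2 * (\<integral>x. (U {1..int T} x)\<^sup>2 \<partial>P) / 2)))
    \<le> \<theta> * sqrt (v * real r) + real n * (\<theta> * (2 * D / real s))
      + real n * (\<theta> ^ 3 * (sqrt (v * real b) * (real b * C)\<^sup>2) / 6 + \<theta> ^ 4 * (v * real b)\<^sup>2 / 8)
      + \<theta>\<^sup>2 * (sqrt (v * real r) * (2 * sqrt (v * real T)) + real T * (2 * C * D / real s)) / 2"
    unfolding n_def r_def v_def by (rule clt_blocks[OF s(3) \<theta>(1)])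
  also have "\<dots> \<le> sqrt v * sqrt (\<rho> / t) + 8 * D * t powr (-0.05)
      + (sqrt v * C\<^sup>2 / 3 * t powr (-0.05) + v\<^sup>2 / 4 * t powr (-0.7))
      + (v * sqrt (\<rho> / t) + 2 * C * D * t powr (-0.25))"
    by (intro add_mono 1 2 3 4)
  also have "\<dots> = clt_err C D t"
    unfolding clt_err_def v_def \<rho>_def by (simp add: algebra_simps)
  finally show ?thesis
    unfolding \<theta>(3) unfolding \<theta>(2) t_def by (simp add: mult.commute[of _ 2])
qed

end

subsection \<open>Products of short range dependent variables\<close>

text \<open>The moments are set up for products: eighth moments of \<open>X\<close> give fourth
  moments of a product, and fourth-moment decay gives decay in mean square.\<close>

locale short_range = noise P for P +
  fixes X :: "int \<Rightarrow> (int \<Rightarrow> real) \<Rightarrow> real" and C D :: real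
  assumes X8: "\<And>i. Lp_le P 8 (X i) C"
    and adapted: "\<And>i x y. X i (mix {..i} x y) = X i x"
    and decay: "\<And>i l. Lp_le (P \<Otimes>\<^sub>M P) 4 (\<lambda>w. X i (fst w) - X i (mix {i - int l<..} (fst w) (snd w))) (D / (1 + real l)\<^sup>2)"
begin

lemma measurable_X[measurable]: "X i \<in> borel_measurable P"
  using X8 by (rule Lp_le_measurable)

lemma X4: "Lp_le P 4 (X i) C" using X8 by (rule Lp_le_8_4)

lemma C0: "C \<ge> 0" using X8 by (rule Lp_le_nonneg)

lemma D0: "D \<ge> 0" using Lp_le_nonneg[OF decay[of 0 0]] by simp

lemma adapted_cong: "(\<And>j. j \<le> i \<Longrightarrow> u j = v j) \<Longrightarrow> X i u = X i v"
proof -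
  assume "\<And>j. j \<le> i \<Longrightarrow> u j = v j"
  then have "mix {..i} u v = v" by (auto simp: mix_def fun_eq_iff)
  then show ?thesis using adapted[of i u v] by simp
qed

lemma product_moment: "Lp_le P 4 (\<lambda>x. X i x * X j x) (C * C)"
  by (rule Lp_le_mult) (use X8 in simp_all)

lemma product_integral: "integrable P (\<lambda>x. X i x * X j x)" "\<bar>\<integral>x. X i x * X j x \<partial>P\<bar> \<le> C * C"
  using Lp_le_2_1[OF Lp_le_4_2[OF product_moment[of i j]]] Lp_le_integrable Lp_le_integral by blast+

text \<open>Seen from time \<open>i - k\<close>, the resampled past begins \<open>k\<close> steps
  closer. Since \<open>1 + l \<le> (1 + K) * (1 + (l - k))\<close>, this costs a factor depending
  only on \<open>K\<close>.\<close>

lemma decay_lag: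
  assumes "k \<le> K"
  shows "Lp_le (P \<Otimes>\<^sub>M P) 4 (\<lambda>w. X (i - int k) (fst w) - X (i - int k) (mix {i - int l<..} (fst w) (snd w)))
    (D * (1 + real K)\<^sup>2 / (1 + real l)\<^sup>2)"
proof (rule Lp_le_mono)
  \<comment> \<open>The truncated difference \<open>l - k\<close> is right also for
    \<open>l < k\<close>: then every innovation that \<open>X (i - int k)\<close> reads is replaced
    on both sides.\<close>
  have eq: "X (i - int k) (mix {i - int l<..} x y) = X (i - int k) (mix {i - int k - int (l - k)<..} x y)" for x y
    by (rule adapted_cong) (auto simp: mix_def)
  show "Lp_le (P \<Otimes>\<^sub>M P) 4 (\<lambda>w. X (i - int k) (fst w) - X (i - int k) (mix {i - int l<..} (fst w) (snd w))) (D / (1 + real (l - k))\<^sup>2)"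
    unfolding eq by (rule decay)
  have "1 + l \<le> (1 + K) + 1 * (l - k)" using assms by simp
  also have "\<dots> \<le> (1 + K) + (1 + K) * (l - k)" by (intro add_left_mono mult_right_mono) auto
  finally have "1 + l \<le> (1 + K) * (1 + (l - k))" by simp
  then have "real (1 + l) \<le> real ((1 + K) * (1 + (l - k)))" by (simp only: of_nat_le_iff)
  then have "1 + real l \<le> (1 + real K) * (1 + real (l - k))" by (simp only: of_nat_add of_nat_mult of_nat_1)
  then have "(1 + real l)\<^sup>2 \<le> ((1 + real K) * (1 + real (l - k)))\<^sup>2" by (intro power_mono) auto
  then have "1 / (1 + real (l - k))\<^sup>2 \<le> (1 + real K)\<^sup>2 / (1 + real l)\<^sup>2"
    by (simp add: divide_simps power_mult_distrib)
  from mult_left_mono[OF this D0] show "D / (1 + real (l - k))\<^sup>2 \<le> D * (1 + real K)\<^sup>2 / (1 + real l)\<^sup>2" by simp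
qed

text \<open>The change of a product is split as \<open>a * (b - b') + (a - a') * b'\<close>, each
  part a product of two functions with fourth moments.\<close>

lemma product_decay:
  assumes "k \<le> K"
  shows "Lp_le (P \<Otimes>\<^sub>M P) 2 (\<lambda>w. X i (fst w) * X (i - int k) (fst w)
      - X i (mix {i - int l<..} (fst w) (snd w)) * X (i - int k) (mix {i - int l<..} (fst w) (snd w)))
    (2 * C * D * (1 + real K)\<^sup>2 / (1 + real l)\<^sup>2)"
proof -
  let ?m = "\<lambda>w. mix {i - int l<..} (fst w) (snd w)"
  let ?D = "D * (1 + real K)\<^sup>2 / (1 + real l)\<^sup>2"
  have 1: "Lp_le (P \<Otimes>\<^sub>M P) 2 (\<lambda>w. X i (fst w) * (X (i - int k) (fst w) - X (i - int k) (?m w))) (C * ?D)"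
    by (rule Lp_le_mult) (use Lp_le_fst[OF X4] decay_lag[OF assms] in simp_all)
  have 2: "Lp_le (P \<Otimes>\<^sub>M P) 2 (\<lambda>w. (X i (fst w) - X i (?m w)) * X (i - int k) (?m w)) (?D * C)"
    by (rule Lp_le_mult) (use Lp_le_mix[OF X4] decay_lag[of 0 K i l] in simp_all)
  have "Lp_le (P \<Otimes>\<^sub>M P) 2 (\<lambda>w. X i (fst w) * X (i - int k) (fst w) - X i (?m w) * X (i - int k) (?m w)) (C * ?D + ?D * C)"
    by (rule Lp_le_cong[THEN iffD1, OF _ Lp_le_add[OF 1 2]]) (simp add: algebra_simps)
  then show ?thesis by (rule Lp_le_mono) (simp add: mult_ac)
qed

text \<open>The number of lags enters the constants only through its bound \<open>K\<close>, and the
  coefficients only through \<open>B\<close>; this makes the central limit theorem uniform over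
  varying orders.\<close>

lemma weakly_dependent_products:
  assumes \<sigma>: "\<And>i k. k \<le> p \<Longrightarrow> (\<integral>x. X i x * X (i - int k) x \<partial>P) = \<sigma> k"
    and p: "p \<le> K" and \<beta>: "\<And>k. k \<le> p \<Longrightarrow> \<bar>\<beta> k\<bar> \<le> B"
  shows "weakly_dependent P (\<lambda>i x. \<Sum>k\<le>p. \<beta> k * (X i x * X (i - int k) x - \<sigma> k))
    ((1 + real K) * (B * (2 * C * C))) ((1 + real K) * (B * (2 * C * D * (1 + real K)\<^sup>2)))"
proof
  fix i :: int
  have B: "B \<ge> 0" using \<beta>[of 0] by simp
  have \<sigma>C: "\<bar>\<sigma> k\<bar> \<le> C * C" if "k \<le> p" for k using product_integral(2)[of 0 "0 - int k"] \<sigma>[OF that, of 0] by simp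
  have s: "(\<Sum>k\<le>p. \<bar>\<beta> k\<bar> * c) \<le> (1 + real K) * (B * c)" if "c \<ge> 0" for c
  proof -
    have "(\<Sum>k\<le>p. \<bar>\<beta> k\<bar> * c) \<le> (\<Sum>k\<le>p. B * c)" using that \<beta> by (intro sum_mono mult_right_mono) auto
    also have "\<dots> = (1 + real p) * (B * c)" by simp
    also have "\<dots> \<le> (1 + real K) * (B * c)" using p that B by (intro mult_right_mono) auto
    finally show ?thesis .
  qed
  show "Lp_le P 4 (\<lambda>x. \<Sum>k\<le>p. \<beta> k * (X i x * X (i - int k) x - \<sigma> k)) ((1 + real K) * (B * (2 * C * C)))"
  proof (rule Lp_le_mono[OF Lp_le_sum])
    fix k assume "k \<in> {..p}"
    then have "Lp_le P 4 (\<lambda>x. X i x * X (i - int k) x - \<sigma> k) (2 * C * C)"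
      by (intro Lp_le_mono[OF Lp_le_diff[OF product_moment Lp_le_const]]) (use \<sigma>C in fastforce)
    then show "Lp_le P 4 (\<lambda>x. \<beta> k * (X i x * X (i - int k) x - \<sigma> k)) (\<bar>\<beta> k\<bar> * (2 * C * C))"
      by (rule Lp_le_cmult)
  qed (use C0 s in auto)
  show "(\<integral>x. (\<Sum>k\<le>p. \<beta> k * (X i x * X (i - int k) x - \<sigma> k)) \<partial>P) = 0"
    by (subst Bochner_Integration.integral_sum) (auto simp: product_integral \<sigma> prob_space)
  show "(\<Sum>k\<le>p. \<beta> k * (X i (mix {..i} x y) * X (i - int k) (mix {..i} x y) - \<sigma> k)) =
      (\<Sum>k\<le>p. \<beta> k * (X i x * X (i - int k) x - \<sigma> k))" for x y
  proof -
    have "X (i - int k) (mix {..i} x y) = X (i - int k) x" for k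
      by (rule adapted_cong) (auto simp: mix_def)
    then show ?thesis by (simp add: adapted)
  qed
  fix l
  let ?m = "\<lambda>w. mix {i - int l<..} (fst w) (snd w)"
  have "Lp_le (P \<Otimes>\<^sub>M P) 2 (\<lambda>w. \<Sum>k\<le>p. \<beta> k * (X i (fst w) * X (i - int k) (fst w) - X i (?m w) * X (i - int k) (?m w)))
     ((1 + real K) * (B * (2 * C * D * (1 + real K)\<^sup>2 / (1 + real l)\<^sup>2)))"
    by (rule Lp_le_mono[OF Lp_le_sum[OF _ Lp_le_cmult[OF product_decay[of _ K]]] s]) (use p C0 D0 in auto)
  then show "Lp_le (P \<Otimes>\<^sub>M P) 2 (\<lambda>w. (\<Sum>k\<le>p. \<beta> k * (X i (fst w) * X (i - int k) (fst w) - \<sigma> k)) -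
          (\<Sum>k\<le>p. \<beta> k * (X i (?m w) * X (i - int k) (?m w) - \<sigma> k)))
     ((1 + real K) * (B * (2 * C * D * (1 + real K)\<^sup>2)) / (1 + real l)\<^sup>2)"
    unfolding sum_subtractf[symmetric] right_diff_distrib[symmetric] by simp
qed

end

text \<open>Reads a one-sided history off a two-sided noise sequence, so that variables at different
  times become functions of the same argument.\<close>

definition recentre :: "(int \<Rightarrow> (nat \<Rightarrow> real) \<Rightarrow> real) \<Rightarrow> int \<Rightarrow> (int \<Rightarrow> real) \<Rightarrow> real" where
  "recentre g i x = g i (\<lambda>n. x (i - int n))"

text \<open>The dependence measure at lag \<open>r\<close> bounds a single resampling in the fourth
  moment. Its tail sums are of order \<open>(1 + l) powr (- \<alpha>)\<close>, hence at most
  \<open>D / (1 + real l)\<^sup>2\<close>, and telescoping converts them into the effect of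
  resampling the whole past.\<close>

lemma short_range_of_representation:
  fixes X e :: "int \<Rightarrow> 'a \<Rightarrow> real"
  assumes M: "prob_space M" and rep: "causal_representation M X e g"
    and m: "m \<ge> 8" and \<alpha>: "\<alpha> \<ge> 2" and C0: "C \<ge> 0" "D \<ge> 0"
    and C: "(SUP i. Lnorm M m (X i)) \<le> ennreal C"
    and D: "(SUP k. ennreal ((1 + real k) powr \<alpha>) * (\<Sum>l. dep_measure M X e g m (k + l))) \<le> ennreal D"
  shows "short_range (distr M seqs (\<lambda>\<omega> j. e j \<omega>)) (recentre g) C D"
proof -
  interpret M: prob_space M by fact
  interpret MM: pair_prob_space M M ..
  define E where "E = (\<lambda>\<omega> j. e j \<omega>)"
  have e: "M.indep_vars (\<lambda>_. borel) e UNIV" and g[measurable]: "\<And>i. g i \<in> borel_measurable (Pi\<^sub>M UNIV (\<lambda>_. borel))"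
    and Xg: "\<And>i \<omega>. \<omega> \<in> space M \<Longrightarrow> X i \<omega> = g i (\<lambda>n. e (i - int n) \<omega>)"
    using rep by (auto simp: causal_representation_def)
  have em[measurable]: "e j \<in> borel_measurable M" for j using e by (auto simp: M.indep_vars_def2)
  have E[measurable]: "E \<in> measurable M seqs" unfolding E_def by (rule measurable_PiM_single') auto
  define P where "P = distr M seqs E"
  interpret noise P unfolding P_def E_def by (rule noise_distr[OF M e])
  let ?X = "recentre g"
  have R[measurable]: "?X i \<in> borel_measurable P" for i
  proof -
    have "(\<lambda>x n. x (i - int n)) \<in> measurable seqs (Pi\<^sub>M UNIV (\<lambda>_::nat. borel :: real measure))"
      by (rule measurable_PiM_single') auto
    then have "(\<lambda>x. g i (\<lambda>n. x (i - int n))) \<in> borel_measurable seqs" by measurable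
    then show ?thesis by (simp add: recentre_def[abs_def] P_def)
  qed
  have R'[measurable]: "?X i \<in> borel_measurable seqs" for i using R[of i] by (simp add: P_def)
  have XE: "X i \<omega> = ?X i (E \<omega>)" if "\<omega> \<in> space M" for i \<omega> using Xg[OF that] by (simp add: recentre_def E_def)
  have Xm[measurable]: "X i \<in> borel_measurable M" for i
    by (subst measurable_cong[OF XE]) auto
  have X8: "Lp_le P 8 (?X i) C" for i
  proof -
    have "Lnorm M m (X i) \<le> ennreal C" using C by (rule order_trans[OF SUP_upper, rotated]) simp
    then have "Lp_le M 8 (X i) C" by (rule M.Lp_le_Lnorm) (use m C0 in auto)
    then have "Lp_le M 8 (\<lambda>\<omega>. ?X i (E \<omega>)) C" using Lp_le_cong[of M "X i" "\<lambda>\<omega>. ?X i (E \<omega>)"] XE by simp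
    then show ?thesis unfolding P_def by (subst Lp_le_distr) auto
  qed
  define dep where "dep = dep_measure M X e g m"
  have dep: "(\<Sum>l. dep (k + l)) \<le> ennreal (D / (1 + real k)\<^sup>2)" for k
  proof -
    have "(1 + real k)\<^sup>2 \<le> (1 + real k) powr \<alpha>"
      using powr_mono[of 2 \<alpha> "1 + real k"] \<alpha> by simp
    then have "ennreal ((1 + real k)\<^sup>2) * (\<Sum>l. dep (k + l)) \<le> ennreal ((1 + real k) powr \<alpha>) * (\<Sum>l. dep (k + l))"
      by (intro mult_right_mono ennreal_leI) auto
    also have "\<dots> \<le> ennreal D" unfolding dep_def using D by (rule order_trans[OF SUP_upper, rotated]) simp
    finally have "ennreal ((1 + real k)\<^sup>2) * (\<Sum>l. dep (k + l)) \<le> ennreal D" .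
    then show ?thesis
    proof (cases "\<Sum>l. dep (k + l)" rule: ennreal_cases)
      case (real r)
      then have "ennreal ((1 + real k)\<^sup>2 * r) \<le> ennreal D"
        using \<open>ennreal ((1 + real k)\<^sup>2) * (\<Sum>l. dep (k + l)) \<le> ennreal D\<close> by (simp add: ennreal_mult)
      then have "(1 + real k)\<^sup>2 * r \<le> D" using C0 by (simp add: ennreal_le_iff)
      then show ?thesis using real by (auto intro!: ennreal_leI simp: pos_le_divide_eq mult.commute)
    next
      case top
      then show ?thesis
        using \<open>ennreal ((1 + real k)\<^sup>2) * (\<Sum>l. dep (k + l)) \<le> ennreal D\<close> by (simp add: ennreal_mult_top top_unique)
    qed
  qed
  have depsum: "(\<Sum>r=l..<n. dep r) \<le> ennreal (D / (1 + real l)\<^sup>2)" for l n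
  proof -
    have "(\<Sum>r=l..<n. dep r) = (\<Sum>r<n - l. dep (l + r))"
      by (rule sum.reindex_bij_witness[where i = "\<lambda>r. l + r" and j = "\<lambda>r. r - l"]) auto
    also have "\<dots> \<le> (\<Sum>r. dep (l + r))" by (rule sum_le_suminf) auto
    finally show ?thesis using dep by (rule order_trans)
  qed
  have fin: "dep r < \<infinity>" for r
    using depsum[of r "Suc r"] by (auto intro: le_less_trans)
  have d: "Lp_le (P \<Otimes>\<^sub>M P) 4 (\<lambda>w. ?X i (fst w) - ?X i (mix (- {i - int r}) (fst w) (snd w))) (enn2real (dep r))" for i r
  proof -
    let ?F = "\<lambda>w. ?X i (fst w) - ?X i (mix (- {i - int r}) (fst w) (snd w))"
    have PP: "P \<Otimes>\<^sub>M P = distr (M \<Otimes>\<^sub>M M) (seqs \<Otimes>\<^sub>M seqs) (\<lambda>(x, y). (E x, E y))"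
      unfolding P_def by (rule pair_measure_distr[OF E E]) (simp add: P_def[symmetric] sigma_finite_measure_axioms)
    have "Lnorm (M \<Otimes>\<^sub>M M) m (\<lambda>w. X i (fst w) - coupled e g i r w) \<le> dep r"
      unfolding dep_def dep_measure_def by (rule SUP_upper) simp
    also have "\<dots> = ennreal (enn2real (dep r))" using fin[of r] by simp
    finally have L: "Lnorm (M \<Otimes>\<^sub>M M) m (\<lambda>w. X i (fst w) - coupled e g i r w) \<le> ennreal (enn2real (dep r))" .
    have eq: "X i (fst w) - coupled e g i r w = ?F (E (fst w), E (snd w))" if "w \<in> space (M \<Otimes>\<^sub>M M)" for w
    proof -
      \<comment> \<open>The coupled variable of the dependence measure is the process evaluated at
        noise resampled in the single coordinate \<open>i - r\<close>.\<close>
      have "(\<lambda>n. mix (- {i - int r}) (E (fst w)) (E (snd w)) (i - int n)) =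
         (\<lambda>n. if n = r then innov_copy e (i - int n) w else innov e (i - int n) w)"
        by (auto simp: mix_def E_def innov_def innov_copy_def)
      then show ?thesis using that XE[of "fst w"] by (simp add: coupled_def recentre_def space_pair_measure mem_Times_iff)
    qed
    have "Lp_le (M \<Otimes>\<^sub>M M) 4 (\<lambda>w. X i (fst w) - coupled e g i r w) (enn2real (dep r))"
    proof (rule MM.Lp_le_Lnorm[OF L])
      show "(\<lambda>w. X i (fst w) - coupled e g i r w) \<in> borel_measurable (M \<Otimes>\<^sub>M M)"
        by (subst measurable_cong[OF eq]) auto
    qed (use m in auto)
    then have "Lp_le (M \<Otimes>\<^sub>M M) 4 (\<lambda>w. ?F (E (fst w), E (snd w))) (enn2real (dep r))"
      by (rule Lp_le_cong[THEN iffD1, rotated]) (rule eq)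
    then show ?thesis unfolding PP
      by (subst Lp_le_distr) (auto simp: case_prod_beta')
  qed
  show ?thesis unfolding E_def[symmetric] P_def[symmetric]
  proof
    show "Lp_le P 8 (?X i) C" for i by (rule X8)
    show "?X i (mix {..i} x y) = ?X i x" for i x y by (simp add: recentre_def mix_def)
    show "Lp_le (P \<Otimes>\<^sub>M P) 4 (\<lambda>w. ?X i (fst w) - ?X i (mix {i - int l<..} (fst w) (snd w))) (D / (1 + real l)\<^sup>2)" for i l
    proof (rule Lp_le_telescope[OF _ d])
      show "integrable P (?X i)"
        using Lp_le_2_1[OF Lp_le_4_2[OF Lp_le_8_4[OF X8]]] by (rule Lp_le_integrable)
      fix n
      have "ennreal (\<Sum>r=l..<n. enn2real (dep r)) = (\<Sum>r=l..<n. dep r)"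
        using fin by (subst sum_ennreal[symmetric]) (auto intro!: sum.cong)
      then show "(\<Sum>r=l..<n. enn2real (dep r)) \<le> D / (1 + real l)\<^sup>2"
        using depsum[of l n] C0 by (subst ennreal_le_iff[symmetric]) simp_all
    qed simp
  qed
qed

subsection \<open>Comparison of box probabilities\<close>

text \<open>The class to which convergence of cosine expectations extends by linearity. It is also
  closed under products, since a product of two cosines is half the sum of the cosines of difference
  and sum.\<close>

inductive trig_poly :: "nat \<Rightarrow> ((nat \<Rightarrow> real) \<Rightarrow> real) \<Rightarrow> bool" for K where
  cosine: "trig_poly K (\<lambda>u. cos (\<Sum>j=1..K. t j * u j))"
| scale: "trig_poly K f \<Longrightarrow> trig_poly K (\<lambda>u. c * f u)"
| add: "trig_poly K f \<Longrightarrow> trig_poly K g \<Longrightarrow> trig_poly K (\<lambda>u. f u + g u)"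

lemma trig_poly_const: "trig_poly K (\<lambda>u. c)"
  using trig_poly.scale[OF trig_poly.cosine[of K "\<lambda>_. 0"], of c] by simp

lemma trig_poly_mult:
  assumes "trig_poly K f" "trig_poly K g" shows "trig_poly K (\<lambda>u. f u * g u)"
  using assms(1)
proof induction
  case (cosine t)
  show ?case using assms(2)
  proof induction
    case (cosine s)
    have eq: "cos (\<Sum>j=1..K. t j * u j) * cos (\<Sum>j=1..K. s j * u j) =
       1/2 * (cos (\<Sum>j=1..K. (t j - s j) * u j) + cos (\<Sum>j=1..K. (t j + s j) * u j))" for u
      unfolding cos_times_cos by (simp add: sum.distrib sum_subtractf algebra_simps)
    show ?case unfolding eq by (intro trig_poly.intros)
  next
    case (scale g c)
    from trig_poly.scale[OF scale.IH, of c] show ?case by (simp add: mult_ac)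
  next
    case (add g h)
    from trig_poly.add[OF add.IH] show ?case by (simp add: distrib_left)
  qed
next
  case (scale f c)
  from trig_poly.scale[OF scale.IH, of c] show ?case by (simp add: mult_ac)
next
  case (add f h)
  from trig_poly.add[OF add.IH] show ?case by (simp add: distrib_right)
qed

lemma trig_poly_prod:
  assumes "\<And>j. j \<in> J \<Longrightarrow> trig_poly K (f j)" shows "trig_poly K (\<lambda>u. \<Prod>j\<in>J. f j u)"
  using assms by (induction J rule: infinite_finite_induct) (auto intro: trig_poly_const trig_poly_mult)

lemma trig_poly_polynomial_cos:
  fixes g :: "real \<Rightarrow> real"
  assumes "real_polynomial_function g" and j: "j \<in> {1..K}"
  shows "trig_poly K (\<lambda>u. g (cos (a * u j)))"
  using assms(1)
proof induction
  case (linear f)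
  then have f: "f v = f 1 * v" for v
    using linear_scale[OF bounded_linear.linear, of f v 1] by (simp add: mult.commute)
  \<comment> \<open>The cosine of one coordinate is the generator with frequency \<open>a\<close> at
    \<open>j\<close> and zero elsewhere.\<close>
  have s: "(\<Sum>i=1..K. (if i = j then a else 0) * u i) = a * u j" for u :: "nat \<Rightarrow> real"
    using j by (simp add: if_distrib[of "\<lambda>x. x * _"] cong: if_cong)
  have "f (cos (a * u j)) = f 1 * cos (\<Sum>i=1..K. (if i = j then a else 0) * u i)" for u :: "nat \<Rightarrow> real"
    unfolding s by (rule f)
  then show ?case by (simp only: trig_poly.intros)
qed (auto intro: trig_poly_const trig_poly_mult trig_poly.add)

text \<open>On the interval from 0 to \<open>L\<close> the function \<open>cos (pi / L * s)\<close>
  is strictly decreasing, so a piecewise linear ramp in the cosine is an even bump in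
  \<open>s\<close>. Beyond \<open>L\<close> it repeats periodically, which is why tightness is
  needed.\<close>

lemma continuous_cos_bump:
  fixes x \<epsilon> L :: real
  assumes x: "0 \<le> x" "0 < \<epsilon>" "x + \<epsilon> \<le> L"
  shows "\<exists>H :: real \<Rightarrow> real. continuous_on UNIV H \<and> (\<forall>v. 0 \<le> H v \<and> H v \<le> 1) \<and>
    (\<forall>s. \<bar>s\<bar> \<le> x \<longrightarrow> H (cos (pi / L * s)) = 1) \<and>
    (\<forall>s. x + \<epsilon> \<le> \<bar>s\<bar> \<longrightarrow> \<bar>s\<bar> \<le> L \<longrightarrow> H (cos (pi / L * s)) = 0)"
proof -
  have L: "L > 0" using x by simp
  define c1 c2 where "c1 = cos (pi / L * x)" and "c2 = cos (pi / L * (x + \<epsilon>))"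
  have bd: "pi / L * s \<le> pi" if "s \<le> L" for s using that L by (simp add: field_simps)
  have c: "c2 < c1" unfolding c1_def c2_def
    using x L bd[of "x + \<epsilon>"] by (intro cos_monotone_0_pi mult_strict_left_mono) auto
  define H where "H v = max 0 (min 1 ((v - c2) / (c1 - c2)))" for v
  have abs: "cos (pi / L * s) = cos (pi / L * \<bar>s\<bar>)" for s by (simp add: abs_if)
  show ?thesis
  proof (intro exI[of _ H] conjI allI impI)
    show "continuous_on UNIV H" unfolding H_def using c by (intro continuous_intros) auto
    show "0 \<le> H v" "H v \<le> 1" for v by (auto simp: H_def)
    show "H (cos (pi / L * s)) = 1" if "\<bar>s\<bar> \<le> x" for s
    proof -
      have "c1 \<le> cos (pi / L * \<bar>s\<bar>)" unfolding c1_def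
        using that x L bd[of x] by (intro cos_monotone_0_pi_le mult_left_mono) auto
      then have "1 \<le> (cos (pi / L * s) - c2) / (c1 - c2)" using c unfolding abs[of s] by simp
      then show ?thesis by (simp add: H_def)
    qed
    show "H (cos (pi / L * s)) = 0" if "x + \<epsilon> \<le> \<bar>s\<bar>" "\<bar>s\<bar> \<le> L" for s
    proof -
      have "cos (pi / L * \<bar>s\<bar>) \<le> c2" unfolding c2_def
        using that x L bd[of "\<bar>s\<bar>"] by (intro cos_monotone_0_pi_le mult_left_mono) auto
      then have "(cos (pi / L * s) - c2) / (c1 - c2) \<le> 0" using c unfolding abs[of s] by (simp add: divide_le_0_iff)
      then show ?thesis by (simp add: H_def)
    qed
  qed
qed

lemma trig_poly_integrable:
  assumes "trig_poly K f" "prob_space Q" "\<And>j. W j \<in> borel_measurable Q"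
  shows "integrable Q (\<lambda>\<omega>. f (\<lambda>j. W j \<omega>))"
proof -
  interpret Q: prob_space Q by fact
  note [measurable] = assms(3)
  show ?thesis using assms(1)
  proof induction
    case (cosine t)
    show ?case by (rule Q.integrable_const_bound[where B = 1]) auto
  qed auto
qed

text \<open>The approximation is uniform in \<open>u\<close>, so the same error serves both families
  and every sample size.\<close>

lemma bump_expectation_close:
  assumes tp: "trig_poly K g" and Q: "prob_space Q" and W[measurable]: "\<And>j. W j \<in> borel_measurable Q"
    and H: "continuous_on UNIV H" "\<And>v. 0 \<le> H v \<and> H v \<le> 1"
    and gH: "\<And>u. \<bar>g u - (\<Prod>j=1..K. H (cos (a * u j)))\<bar> \<le> e"
  shows "\<bar>(\<integral>\<omega>. g (\<lambda>j. W j \<omega>) \<partial>Q) - (\<integral>\<omega>. (\<Prod>j=1..K. H (cos (a * W j \<omega>))) \<partial>Q)\<bar> \<le> e"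
proof -
  interpret Q: prob_space Q by fact
  have [measurable]: "H \<in> borel_measurable borel" using H(1) by (rule borel_measurable_continuous_onI)
  let ?H = "\<lambda>\<omega>. \<Prod>j=1..K. H (cos (a * W j \<omega>))"
  have i: "integrable Q (\<lambda>\<omega>. g (\<lambda>j. W j \<omega>))" by (rule trig_poly_integrable[OF tp Q W])
  have iH: "integrable Q ?H"
  proof (rule Q.integrable_const_bound[where B = 1])
    have "norm (?H \<omega>) \<le> 1" for \<omega>
      unfolding prod_norm[symmetric] by (rule prod_le_1) (use H(2) in auto)
    then show "AE \<omega> in Q. norm (?H \<omega>) \<le> 1" by simp
  qed measurable
  have "\<bar>(\<integral>\<omega>. g (\<lambda>j. W j \<omega>) \<partial>Q) - (\<integral>\<omega>. ?H \<omega> \<partial>Q)\<bar> = \<bar>\<integral>\<omega>. g (\<lambda>j. W j \<omega>) - ?H \<omega> \<partial>Q\<bar>"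
    using i iH by simp
  also have "\<dots> \<le> (\<integral>\<omega>. \<bar>g (\<lambda>j. W j \<omega>) - ?H \<omega>\<bar> \<partial>Q)" by (rule integral_abs_bound)
  also have "\<dots> \<le> (\<integral>\<omega>. e \<partial>Q)" by (rule integral_mono) (use i iH gH in auto)
  finally show ?thesis by (simp add: Q.prob_space)
qed

text \<open>The two families are compared through the expectations of cosines only. Even boxes are products of even
  functions of one variable, and these are approximated by polynomials in \<open>cos (\<pi> s / L)\<close>.\<close>

locale cosine_approx =
  fixes M :: "nat \<Rightarrow> 'a measure" and N :: "nat \<Rightarrow> 'b measure"
    and U :: "nat \<Rightarrow> nat \<Rightarrow> 'a \<Rightarrow> real" and V :: "nat \<Rightarrow> nat \<Rightarrow> 'b \<Rightarrow> real" and K T0 :: nat and A :: real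
  assumes prob: "\<And>T. T \<ge> T0 \<Longrightarrow> prob_space (M T)" "\<And>T. T \<ge> T0 \<Longrightarrow> prob_space (N T)"
    and meas: "\<And>T j. T \<ge> T0 \<Longrightarrow> U T j \<in> borel_measurable (M T)" "\<And>T j. T \<ge> T0 \<Longrightarrow> V T j \<in> borel_measurable (N T)"
    and cos: "\<And>t. (\<lambda>T. (\<integral>\<omega>. cos (\<Sum>j=1..K. t j * U T j \<omega>) \<partial>M T) - (\<integral>\<omega>. cos (\<Sum>j=1..K. t j * V T j \<omega>) \<partial>N T)) \<longlonglongrightarrow> 0"
    and tightU: "\<And>\<eta>. \<eta> > 0 \<Longrightarrow> \<exists>L. \<forall>\<^sub>F T in sequentially. \<forall>j\<in>{1..K}. measure (M T) {\<omega>\<in>space (M T). L < \<bar>U T j \<omega>\<bar>} \<le> \<eta>"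
    and tightV: "\<And>\<eta>. \<eta> > 0 \<Longrightarrow> \<exists>L. \<forall>\<^sub>F T in sequentially. \<forall>j\<in>{1..K}. measure (N T) {\<omega>\<in>space (N T). L < \<bar>V T j \<omega>\<bar>} \<le> \<eta>"
    and lipschitz: "\<And>T x y. T \<ge> T0 \<Longrightarrow> x \<le> y \<Longrightarrow> 0 \<le> y \<Longrightarrow>
       measure (N T) {\<omega>\<in>space (N T). \<forall>j\<in>{1..K}. \<bar>V T j \<omega>\<bar> \<le> y} - measure (N T) {\<omega>\<in>space (N T). \<forall>j\<in>{1..K}. \<bar>V T j \<omega>\<bar> \<le> x} \<le> A * (y - x)"
    and A: "A > 0"
begin

section \<open>Comparison of the distribution functions of the two maxima\<close>

definition F where "F T x = measure (M T) {\<omega>\<in>space (M T). \<forall>j\<in>{1..K}. \<bar>U T j \<omega>\<bar> \<le> x}"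
definition G where "G T x = measure (N T) {\<omega>\<in>space (N T). \<forall>j\<in>{1..K}. \<bar>V T j \<omega>\<bar> \<le> x}"

lemma trig_poly_tendsto:
  assumes "trig_poly K f"
  shows "(\<lambda>T. (\<integral>\<omega>. f (\<lambda>j. U T j \<omega>) \<partial>M T) - (\<integral>\<omega>. f (\<lambda>j. V T j \<omega>) \<partial>N T)) \<longlonglongrightarrow> 0"
  using assms
proof induction
  case (cosine t)
  show ?case by (rule cos)
next
  case (scale f c)
  from tendsto_mult_right_zero[OF scale.IH, of c] show ?case by (simp add: right_diff_distrib)
next
  case (add f g)
  have ev: "\<forall>\<^sub>F T in sequentially. T \<ge> T0" by (rule eventually_ge_at_top)
  from tendsto_add[OF add.IH]
  have "(\<lambda>T. ((\<integral>\<omega>. f (\<lambda>j. U T j \<omega>) \<partial>M T) - (\<integral>\<omega>. f (\<lambda>j. V T j \<omega>) \<partial>N T)) +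
     ((\<integral>\<omega>. g (\<lambda>j. U T j \<omega>) \<partial>M T) - (\<integral>\<omega>. g (\<lambda>j. V T j \<omega>) \<partial>N T))) \<longlonglongrightarrow> 0" by simp
  then show ?case
  proof (rule Lim_transform_eventually)
    show "\<forall>\<^sub>F T in sequentially. ((\<integral>\<omega>. f (\<lambda>j. U T j \<omega>) \<partial>M T) - (\<integral>\<omega>. f (\<lambda>j. V T j \<omega>) \<partial>N T)) +
     ((\<integral>\<omega>. g (\<lambda>j. U T j \<omega>) \<partial>M T) - (\<integral>\<omega>. g (\<lambda>j. V T j \<omega>) \<partial>N T)) =
     (\<integral>\<omega>. f (\<lambda>j. U T j \<omega>) + g (\<lambda>j. U T j \<omega>) \<partial>M T) - (\<integral>\<omega>. f (\<lambda>j. V T j \<omega>) + g (\<lambda>j. V T j \<omega>) \<partial>N T)"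
      using ev
    proof eventually_elim
      case (elim T)
      show ?case
        using trig_poly_integrable[OF add.hyps(1) prob(1)[OF elim] meas(1)[OF elim]]
          trig_poly_integrable[OF add.hyps(2) prob(1)[OF elim] meas(1)[OF elim]]
          trig_poly_integrable[OF add.hyps(1) prob(2)[OF elim] meas(2)[OF elim]]
          trig_poly_integrable[OF add.hyps(2) prob(2)[OF elim] meas(2)[OF elim]]
        by simp
    qed
  qed
qed

text \<open>Stone-Weierstrass replaces \<open>H\<close> on the range of the cosine by a polynomial,
  which turns the product of bumps into a trigonometric polynomial.\<close>

lemma bump_tendsto:
  fixes H :: "real \<Rightarrow> real"
  assumes H: "continuous_on UNIV H" "\<And>v. 0 \<le> H v \<and> H v \<le> 1"
  shows "(\<lambda>T. (\<integral>\<omega>. (\<Prod>j=1..K. H (cos (a * U T j \<omega>))) \<partial>M T) - (\<integral>\<omega>. (\<Prod>j=1..K. H (cos (a * V T j \<omega>))) \<partial>N T)) \<longlonglongrightarrow> 0"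
proof (rule tendstoI)
  fix e :: real assume e: "e > 0"
  \<comment> \<open>Each of the \<open>K\<close> factors will be off by at most
    \<open>2 * \<eta>\<close>, which adds up to at most \<open>e / 3\<close>.\<close>
  define \<eta> where "\<eta> = e / (6 * (real K + 1))"
  have \<eta>: "\<eta> > 0" using e by (simp add: \<eta>_def)
  have H'[measurable]: "H \<in> borel_measurable borel" using H(1) by (rule borel_measurable_continuous_onI)
  obtain g0 where g0: "real_polynomial_function g0" "\<And>v. v \<in> {-1..1} \<Longrightarrow> \<bar>H v - g0 v\<bar> < \<eta>"
    using Stone_Weierstrass_real_polynomial_function[OF compact_Icc continuous_on_subset[OF H(1)] \<eta>, of "-1" 1] by auto
  \<comment> \<open>Division by \<open>1 + \<eta>\<close> keeps the polynomial within 1 in absolute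
    value on the interval, as the estimate for differences of products requires.\<close>
  define g where "g v = g0 v / (1 + \<eta>)" for v
  have gp: "real_polynomial_function g" unfolding g_def divide_inverse
    by (intro real_polynomial_function.intros g0)
  have g: "\<bar>g v\<bar> \<le> 1" "\<bar>g v - H v\<bar> \<le> 2 * \<eta>" if "v \<in> {-1..1}" for v
  proof -
    have "\<bar>g0 v\<bar> \<le> 1 + \<eta>" using g0(2)[OF that] H(2)[of v] by linarith
    then show "\<bar>g v\<bar> \<le> 1" using \<eta> by (simp add: g_def abs_divide)
    have "g v - H v = (g0 v - H v) / (1 + \<eta>) - \<eta> * H v / (1 + \<eta>)"
    proof -
      have "H v = (H v + \<eta> * H v) / (1 + \<eta>)" using \<eta> by (simp add: eq_divide_eq algebra_simps)
      then show ?thesis unfolding g_def diff_divide_distrib add_divide_distrib by linarith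
    qed
    also have "\<bar>\<dots>\<bar> \<le> \<bar>g0 v - H v\<bar> / (1 + \<eta>) + \<eta> * H v / (1 + \<eta>)"
      using \<eta> H(2)[of v] by (intro order_trans[OF abs_triangle_ineq4]) (simp add: abs_divide abs_mult)
    also have "\<dots> \<le> \<eta> / 1 + \<eta> / 1"
      using \<eta> H(2)[of v] g0(2)[OF that] by (intro add_mono frac_le) (auto simp: abs_minus_commute mult_le_cancel_left1)
    finally show "\<bar>g v - H v\<bar> \<le> 2 * \<eta>" by simp
  qed
  let ?g = "\<lambda>u::nat \<Rightarrow> real. \<Prod>j=1..K. g (cos (a * u j))" and ?H = "\<lambda>u::nat \<Rightarrow> real. \<Prod>j=1..K. H (cos (a * u j))"
  have gH: "\<bar>?g u - ?H u\<bar> \<le> e / 3" for u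
  proof -
    have "\<bar>?g u - ?H u\<bar> \<le> (\<Sum>j=1..K. \<bar>g (cos (a * u j)) - H (cos (a * u j))\<bar>)"
    proof -
      have nH: "norm (H v) \<le> 1" for v using H(2)[of v] by simp
      have "norm (g (cos (a * u j))) \<le> 1" for j using g(1)[of "cos (a * u j)"] by simp
      from norm_prod_diff[OF this nH] show ?thesis unfolding real_norm_def .
    qed
    also have "\<dots> \<le> (\<Sum>j=1..K. 2 * \<eta>)" by (intro sum_mono g) auto
    also have "\<dots> \<le> e / 3" using e by (simp add: \<eta>_def field_simps)
    finally show ?thesis .
  qed
  have tp: "trig_poly K ?g"
    by (intro trig_poly_prod trig_poly_polynomial_cos[OF gp]) auto
  have "\<forall>\<^sub>F T in sequentially. dist ((\<integral>\<omega>. ?g (\<lambda>j. U T j \<omega>) \<partial>M T) - (\<integral>\<omega>. ?g (\<lambda>j. V T j \<omega>) \<partial>N T)) 0 < e / 3"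
    by (rule tendstoD[OF trig_poly_tendsto[OF tp]]) (use e in simp)
  with eventually_ge_at_top[of T0]
  show "\<forall>\<^sub>F T in sequentially. dist ((\<integral>\<omega>. ?H (\<lambda>j. U T j \<omega>) \<partial>M T) - (\<integral>\<omega>. ?H (\<lambda>j. V T j \<omega>) \<partial>N T)) 0 < e"
  proof eventually_elim
    case (elim T)
    show ?case
      using bump_expectation_close[where W = "U T", OF tp prob(1)[OF elim(1)] meas(1)[OF elim(1)] H gH]
        bump_expectation_close[where W = "V T", OF tp prob(2)[OF elim(1)] meas(2)[OF elim(1)] H gH] elim(2)
      unfolding dist_real_def by linarith
  qed
qed

text \<open>The product of bumps is 1 on the inner cube and vanishes outside the outer one, except
  where some coordinate exceeds \<open>L\<close> and the periodic bump may return; those events form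
  the extra sum.\<close>

lemma box_bump_bounds:
  fixes H :: "real \<Rightarrow> real"
  assumes Q: "prob_space Q" and W[measurable]: "\<And>j. W j \<in> borel_measurable Q"
    and H: "continuous_on UNIV H" "\<And>v. 0 \<le> H v \<and> H v \<le> 1"
    and H1: "\<And>s. \<bar>s\<bar> \<le> x \<Longrightarrow> H (cos (a * s)) = 1"
    and H0: "\<And>s. y \<le> \<bar>s\<bar> \<Longrightarrow> \<bar>s\<bar> \<le> L \<Longrightarrow> H (cos (a * s)) = 0"
  shows "measure Q {\<omega>\<in>space Q. \<forall>j\<in>{1..K}. \<bar>W j \<omega>\<bar> \<le> x} \<le> (\<integral>\<omega>. (\<Prod>j=1..K. H (cos (a * W j \<omega>))) \<partial>Q)"
    and "(\<integral>\<omega>. (\<Prod>j=1..K. H (cos (a * W j \<omega>))) \<partial>Q) \<le> measure Q {\<omega>\<in>space Q. \<forall>j\<in>{1..K}. \<bar>W j \<omega>\<bar> \<le> y}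
      + (\<Sum>j=1..K. measure Q {\<omega>\<in>space Q. L < \<bar>W j \<omega>\<bar>})"
proof -
  interpret Q: prob_space Q by fact
  have [measurable]: "H \<in> borel_measurable borel" using H(1) by (rule borel_measurable_continuous_onI)
  let ?h = "\<lambda>\<omega>. \<Prod>j=1..K. H (cos (a * W j \<omega>))"
  have h: "0 \<le> ?h \<omega>" "?h \<omega> \<le> 1" for \<omega> using H(2) by (auto intro!: prod_nonneg prod_le_1)
  have i: "integrable Q ?h"
    by (rule Q.integrable_const_bound[where B = 1]) (use h in auto)
  have ind: "integrable Q (indicator B :: _ \<Rightarrow> real)" if "B \<in> sets Q" for B
    using that by (intro integrable_real_indicator) (auto simp: less_top[symmetric])
  let ?X = "\<lambda>x. {\<omega>\<in>space Q. \<forall>j\<in>{1..K}. \<bar>W j \<omega>\<bar> \<le> x}" and ?L = "\<lambda>j. {\<omega>\<in>space Q. L < \<bar>W j \<omega>\<bar>}"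
  have m: "?X x \<in> sets Q" "?L j \<in> sets Q" for x j by measurable
  have "measure Q (?X x) = (\<integral>\<omega>. indicator (?X x) \<omega> \<partial>Q)" using m by simp
  also have "\<dots> \<le> (\<integral>\<omega>. ?h \<omega> \<partial>Q)"
  proof (rule integral_mono[OF ind[OF m(1)] i])
    fix \<omega>
    show "indicator (?X x) \<omega> \<le> ?h \<omega>" using h(1)[of \<omega>] H1 by (auto simp: indicator_def)
  qed
  finally show "measure Q (?X x) \<le> (\<integral>\<omega>. ?h \<omega> \<partial>Q)" .
  have "(\<integral>\<omega>. ?h \<omega> \<partial>Q) \<le> (\<integral>\<omega>. indicator (?X y) \<omega> + (\<Sum>j=1..K. indicator (?L j) \<omega>) \<partial>Q)"
  proof (rule integral_mono[OF i])
    show "integrable Q (\<lambda>\<omega>. indicator (?X y) \<omega> + (\<Sum>j=1..K. indicator (?L j) \<omega>) :: real)"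
      using m by (intro Bochner_Integration.integrable_add Bochner_Integration.integrable_sum ind)
    fix \<omega> assume \<omega>: "\<omega> \<in> space Q"
    consider "\<omega> \<in> ?X y" | j where "j \<in> {1..K}" "y < \<bar>W j \<omega>\<bar>" "\<bar>W j \<omega>\<bar> \<le> L" | j where "j \<in> {1..K}" "L < \<bar>W j \<omega>\<bar>"
      using \<omega> by force
    then show "?h \<omega> \<le> indicator (?X y) \<omega> + (\<Sum>j=1..K. indicator (?L j) \<omega>)"
    proof cases
      case 1
      have "0 \<le> (\<Sum>j=1..K. indicator (?L j) \<omega> :: real)" by (intro sum_nonneg) auto
      then show ?thesis using 1 h(2)[of \<omega>] by simp
    next
      case 2
      then have "?h \<omega> = 0" by (intro prod_zero) (auto intro!: bexI[of _ j] H0)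
      then show ?thesis by (simp only:) (intro add_nonneg_nonneg sum_nonneg, auto)
    next
      case 3
      then have "(1::real) \<le> (\<Sum>j=1..K. indicator (?L j) \<omega>)"
        using member_le_sum[of j "{1..K}" "\<lambda>j. indicator (?L j) \<omega> :: real"] \<omega> by (simp add: indicator_def)
      then show ?thesis using h(2)[of \<omega>] by (smt (verit) indicator_pos_le)
    qed
  qed
  also have "\<dots> = measure Q (?X y) + (\<Sum>j=1..K. measure Q (?L j))"
    using m by (subst Bochner_Integration.integral_add) (auto intro!: ind Bochner_Integration.integrable_sum simp: Bochner_Integration.integral_sum ind)
  finally show "(\<integral>\<omega>. ?h \<omega> \<partial>Q) \<le> measure Q (?X y) + (\<Sum>j=1..K. measure Q (?L j))" .
qed

lemma mono_FG: "T \<ge> T0 \<Longrightarrow> x \<le> y \<Longrightarrow> F T x \<le> F T y" "T \<ge> T0 \<Longrightarrow> x \<le> y \<Longrightarrow> G T x \<le> G T y"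
proof -
  assume T: "T \<ge> T0" and xy: "x \<le> y"
  interpret MT: prob_space "M T" using prob T by auto
  interpret NT: prob_space "N T" using prob T by auto
  have [measurable]: "U T j \<in> borel_measurable (M T)" "V T j \<in> borel_measurable (N T)" for j using meas T by auto
  show "F T x \<le> F T y" unfolding F_def using xy by (intro MT.finite_measure_mono) (auto intro: order_trans)
  show "G T x \<le> G T y" unfolding G_def using xy by (intro NT.finite_measure_mono) (auto intro: order_trans)
qed

lemma FG_le_1: "T \<ge> T0 \<Longrightarrow> F T x \<le> 1" "T \<ge> T0 \<Longrightarrow> G T x \<le> 1"
  using prob prob_space.prob_le_1 by (auto simp: F_def G_def)

text \<open>The bump descends from \<open>x\<close> to \<open>x + \<epsilon>\<close>. Convergence of
  its expectation, the tails of \<open>V\<close> and the Lipschitz bound for \<open>G\<close> each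
  cost a third of \<open>e\<close>.\<close>

lemma upper:
  assumes x: "0 \<le> x" and e: "e > 0"
  shows "\<forall>\<^sub>F T in sequentially. F T x \<le> G T x + e"
proof -
  define \<eta> \<epsilon> where "\<eta> = e / (3 * (real K + 1))" and "\<epsilon> = e / (3 * A)"
  have pos: "\<eta> > 0" "\<epsilon> > 0" using e A by (auto simp: \<eta>_def \<epsilon>_def)
  obtain L0 where L0: "\<forall>\<^sub>F T in sequentially. \<forall>j\<in>{1..K}. measure (N T) {\<omega>\<in>space (N T). L0 < \<bar>V T j \<omega>\<bar>} \<le> \<eta>"
    using tightV[OF pos(1)] by auto
  define L where "L = max L0 (x + \<epsilon>)"
  have "x + \<epsilon> \<le> L" by (simp add: L_def)
  from continuous_cos_bump[OF x pos(2) this] obtain H :: "real \<Rightarrow> real" where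
    "continuous_on UNIV H \<and> (\<forall>v. 0 \<le> H v \<and> H v \<le> 1) \<and> (\<forall>s. \<bar>s\<bar> \<le> x \<longrightarrow> H (cos (pi / L * s)) = 1) \<and>
      (\<forall>s. x + \<epsilon> \<le> \<bar>s\<bar> \<longrightarrow> \<bar>s\<bar> \<le> L \<longrightarrow> H (cos (pi / L * s)) = 0)" ..
  then have H: "continuous_on UNIV H" "\<And>v. 0 \<le> H v \<and> H v \<le> 1"
    "\<And>s. \<bar>s\<bar> \<le> x \<Longrightarrow> H (cos (pi / L * s)) = 1"
    "\<And>s. x + \<epsilon> \<le> \<bar>s\<bar> \<Longrightarrow> \<bar>s\<bar> \<le> L \<Longrightarrow> H (cos (pi / L * s)) = 0"
    by blast+
  have "\<forall>\<^sub>F T in sequentially. dist ((\<integral>\<omega>. (\<Prod>j=1..K. H (cos (pi / L * U T j \<omega>))) \<partial>M T) - (\<integral>\<omega>. (\<Prod>j=1..K. H (cos (pi / L * V T j \<omega>))) \<partial>N T)) 0 < e / 3"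
    by (rule tendstoD[OF bump_tendsto[OF H(1,2)]]) (use e in simp)
  with L0 eventually_ge_at_top[of T0] show ?thesis
  proof eventually_elim
    case (elim T)
    interpret NT: prob_space "N T" using prob elim by auto
    have [measurable]: "V T j \<in> borel_measurable (N T)" for j using meas elim by auto
    have "(\<Sum>j=1..K. measure (N T) {\<omega>\<in>space (N T). L < \<bar>V T j \<omega>\<bar>}) \<le> (\<Sum>j=1..K. \<eta>)"
    proof (rule sum_mono)
      fix j assume "j \<in> {1..K}"
      have "measure (N T) {\<omega>\<in>space (N T). L < \<bar>V T j \<omega>\<bar>} \<le> measure (N T) {\<omega>\<in>space (N T). L0 < \<bar>V T j \<omega>\<bar>}"
        by (intro NT.finite_measure_mono) (auto simp: L_def)
      then show "measure (N T) {\<omega>\<in>space (N T). L < \<bar>V T j \<omega>\<bar>} \<le> \<eta>" using elim(1) \<open>j \<in> {1..K}\<close> by force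
    qed
    also have "\<dots> \<le> e / 3" using e by (simp add: \<eta>_def field_simps)
    finally have t: "(\<Sum>j=1..K. measure (N T) {\<omega>\<in>space (N T). L < \<bar>V T j \<omega>\<bar>}) \<le> e / 3" .
    have "G T (x + \<epsilon>) - G T x \<le> A * \<epsilon>"
      using lipschitz[OF elim(2), of x "x + \<epsilon>"] x pos unfolding G_def by simp
    also have "\<dots> = e / 3" using A by (simp add: \<epsilon>_def)
    finally have l: "G T (x + \<epsilon>) \<le> G T x + e / 3" by simp
    show ?case
      using box_bump_bounds(1)[where W = "U T" and x = x and y = "x + \<epsilon>" and L = L, OF prob(1)[OF elim(2)] meas(1)[OF elim(2)] H]
        box_bump_bounds(2)[where W = "V T" and x = x and y = "x + \<epsilon>" and L = L, OF prob(2)[OF elim(2)] meas(2)[OF elim(2)] H] elim(3) t l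
      unfolding dist_real_def F_def G_def by linarith
  qed
qed

text \<open>Here the bump descends from \<open>x - \<epsilon>\<close> to \<open>x\<close>, and the
  roles of the families are reversed: tails of \<open>U\<close> are cut off, while regularity is
  still asked only of \<open>G\<close>.\<close>

lemma lower:
  assumes x: "0 \<le> x" and e: "e > 0"
  shows "\<forall>\<^sub>F T in sequentially. G T x \<le> F T x + e"
proof -
  define \<eta> \<epsilon> where "\<eta> = e / (3 * (real K + 1))" and "\<epsilon> = e / (3 * A)"
  have pos: "\<eta> > 0" "\<epsilon> > 0" using e A by (auto simp: \<eta>_def \<epsilon>_def)
  have l: "G T x \<le> G T (x - \<epsilon>) + e / 3" if "T \<ge> T0" for T
  proof -
    have "G T x - G T (x - \<epsilon>) \<le> A * \<epsilon>"
      using lipschitz[OF that, of "x - \<epsilon>" x] x pos unfolding G_def by simp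
    also have "\<dots> = e / 3" using A by (simp add: \<epsilon>_def)
    finally show ?thesis by simp
  qed
  show ?thesis
  \<comment> \<open>The bump needs a nonnegative inner radius. For a negative one the inner cube is
    empty when \<open>K \<ge> 1\<close>, so its probability is 0.\<close>
  proof (cases "x < \<epsilon>")
    case True
    show ?thesis using eventually_ge_at_top[of T0]
    proof eventually_elim
      case (elim T)
      have "G T (x - \<epsilon>) \<le> F T x"
      proof (cases "K \<ge> 1")
        case K: True
        then have "{\<omega>\<in>space (N T). \<forall>j\<in>{1..K}. \<bar>V T j \<omega>\<bar> \<le> x - \<epsilon>} = {}" using True by force
        then have "G T (x - \<epsilon>) = 0" unfolding G_def by (simp only: measure_empty)
        then show ?thesis by (simp add: F_def)
      next
        case False
        interpret MT: prob_space "M T" using prob elim by auto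
        interpret NT: prob_space "N T" using prob elim by auto
        show ?thesis using False by (simp add: F_def G_def MT.prob_space NT.prob_space)
      qed
      then show ?case using l[OF elim] e by linarith
    qed
  next
    case False
    obtain L0 where L0: "\<forall>\<^sub>F T in sequentially. \<forall>j\<in>{1..K}. measure (M T) {\<omega>\<in>space (M T). L0 < \<bar>U T j \<omega>\<bar>} \<le> \<eta>"
      using tightU[OF pos(1)] by auto
    define L where "L = max L0 x"
    have "0 \<le> x - \<epsilon>" "x - \<epsilon> + \<epsilon> \<le> L" using False by (auto simp: L_def)
    from continuous_cos_bump[OF this(1) pos(2) this(2)] obtain H :: "real \<Rightarrow> real" where
      "continuous_on UNIV H \<and> (\<forall>v. 0 \<le> H v \<and> H v \<le> 1) \<and> (\<forall>s. \<bar>s\<bar> \<le> x - \<epsilon> \<longrightarrow> H (cos (pi / L * s)) = 1) \<and>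
        (\<forall>s. x - \<epsilon> + \<epsilon> \<le> \<bar>s\<bar> \<longrightarrow> \<bar>s\<bar> \<le> L \<longrightarrow> H (cos (pi / L * s)) = 0)" ..
    then have H: "continuous_on UNIV H" "\<And>v. 0 \<le> H v \<and> H v \<le> 1"
      "\<And>s. \<bar>s\<bar> \<le> x - \<epsilon> \<Longrightarrow> H (cos (pi / L * s)) = 1"
      "\<And>s. x \<le> \<bar>s\<bar> \<Longrightarrow> \<bar>s\<bar> \<le> L \<Longrightarrow> H (cos (pi / L * s)) = 0"
      unfolding diff_add_cancel by blast+
    have "\<forall>\<^sub>F T in sequentially. dist ((\<integral>\<omega>. (\<Prod>j=1..K. H (cos (pi / L * U T j \<omega>))) \<partial>M T) - (\<integral>\<omega>. (\<Prod>j=1..K. H (cos (pi / L * V T j \<omega>))) \<partial>N T)) 0 < e / 3"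
      by (rule tendstoD[OF bump_tendsto[OF H(1,2)]]) (use e in simp)
    with L0 eventually_ge_at_top[of T0] show ?thesis
    proof eventually_elim
      case (elim T)
      interpret MT: prob_space "M T" using prob elim by auto
      have [measurable]: "U T j \<in> borel_measurable (M T)" for j using meas elim by auto
      have "(\<Sum>j=1..K. measure (M T) {\<omega>\<in>space (M T). L < \<bar>U T j \<omega>\<bar>}) \<le> (\<Sum>j=1..K. \<eta>)"
      proof (rule sum_mono)
        fix j assume "j \<in> {1..K}"
        have "measure (M T) {\<omega>\<in>space (M T). L < \<bar>U T j \<omega>\<bar>} \<le> measure (M T) {\<omega>\<in>space (M T). L0 < \<bar>U T j \<omega>\<bar>}"
          by (intro MT.finite_measure_mono) (auto simp: L_def)
        then show "measure (M T) {\<omega>\<in>space (M T). L < \<bar>U T j \<omega>\<bar>} \<le> \<eta>" using elim(1) \<open>j \<in> {1..K}\<close> by force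
      qed
      also have "\<dots> \<le> e / 3" using e by (simp add: \<eta>_def field_simps)
      finally have t: "(\<Sum>j=1..K. measure (M T) {\<omega>\<in>space (M T). L < \<bar>U T j \<omega>\<bar>}) \<le> e / 3" .
      show ?case
        using box_bump_bounds(1)[where W = "V T" and x = "x - \<epsilon>" and y = x and L = L, OF prob(2)[OF elim(2)] meas(2)[OF elim(2)] H]
          box_bump_bounds(2)[where W = "U T" and x = "x - \<epsilon>" and y = x and L = L, OF prob(1)[OF elim(2)] meas(1)[OF elim(2)] H] elim(3) t l[OF elim(2)]
        unfolding dist_real_def F_def G_def by linarith
    qed
  qed
qed

text \<open>Both functions are monotone, so agreement on a finite grid controls everything between
  grid points. The mesh lets \<open>G\<close> grow by at most \<open>e / 2\<close> per cell, and
  beyond the grid \<open>G\<close> is already within \<open>e / 2\<close> of 1.\<close>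

lemma uniform:
  assumes e: "e > 0"
  shows "\<forall>\<^sub>F T in sequentially. \<forall>x\<ge>0. \<bar>F T x - G T x\<bar> \<le> e"
proof -
  define \<eta> h where "\<eta> = e / (2 * (real K + 1))" and "h = e / (2 * A)"
  have pos: "\<eta> > 0" "h > 0" using e A by (auto simp: \<eta>_def h_def)
  obtain L0 where L0: "\<forall>\<^sub>F T in sequentially. \<forall>j\<in>{1..K}. measure (N T) {\<omega>\<in>space (N T). L0 < \<bar>V T j \<omega>\<bar>} \<le> \<eta>"
    using tightV[OF pos(1)] by auto
  obtain m :: nat where m: "L0 < real m * h" using reals_Archimedean3[OF pos(2)] by blast
  have e2: "e / 2 > 0" using e by simp
  have "\<forall>\<^sub>F T in sequentially. \<forall>i\<in>{..m}. F T (real i * h) \<le> G T (real i * h) + e / 2"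
    using upper[OF _ e2] pos by (simp add: eventually_ball_finite_distrib)
  moreover have "\<forall>\<^sub>F T in sequentially. \<forall>i\<in>{..m}. G T (real i * h) \<le> F T (real i * h) + e / 2"
    using lower[OF _ e2] pos by (simp add: eventually_ball_finite_distrib)
  ultimately show ?thesis using L0 eventually_ge_at_top[of T0]
  proof eventually_elim
    case (elim T)
    interpret NT: prob_space "N T" using prob elim by auto
    have [measurable]: "V T j \<in> borel_measurable (N T)" for j using meas elim by auto
    let ?L = "\<lambda>j. {\<omega>\<in>space (N T). L0 < \<bar>V T j \<omega>\<bar>}"
    have tail: "1 - e / 2 \<le> G T (real m * h)"
    proof -
      let ?B = "{\<omega>\<in>space (N T). \<forall>j\<in>{1..K}. \<bar>V T j \<omega>\<bar> \<le> real m * h}"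
      have "1 - G T (real m * h) = measure (N T) (space (N T) - ?B)"
        unfolding G_def by (subst NT.prob_compl) auto
      also have "\<dots> \<le> measure (N T) (\<Union>j\<in>{1..K}. ?L j)"
      proof (rule NT.finite_measure_mono)
        show "space (N T) - ?B \<subseteq> (\<Union>j\<in>{1..K}. ?L j)"
        proof
          fix \<omega> assume "\<omega> \<in> space (N T) - ?B"
          then obtain j where j: "j \<in> {1..K}" "real m * h < \<bar>V T j \<omega>\<bar>" "\<omega> \<in> space (N T)"
            by (auto simp: not_le)
          then have "\<omega> \<in> ?L j" using m by simp
          then show "\<omega> \<in> (\<Union>j\<in>{1..K}. ?L j)" using j(1) by blast
        qed
      qed measurable
      also have "\<dots> \<le> (\<Sum>j=1..K. measure (N T) (?L j))"
        by (rule NT.finite_measure_subadditive_finite) auto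
      also have "\<dots> \<le> (\<Sum>j=1..K. \<eta>)" using elim(3) by (intro sum_mono) auto
      also have "\<dots> \<le> e / 2" using e by (simp add: \<eta>_def field_simps)
      finally show ?thesis by simp
    qed
    show ?case
    proof (intro allI impI)
      fix x :: real assume x: "0 \<le> x"
      show "\<bar>F T x - G T x\<bar> \<le> e"
      proof (cases "real m * h \<le> x")
        case True
        have "F T (real m * h) \<le> F T x" "G T (real m * h) \<le> G T x" using mono_FG True elim by auto
        moreover have "F T x \<le> 1" "G T x \<le> 1" using FG_le_1 elim by auto
        ultimately show ?thesis using elim(2) tail by (force simp: abs_le_iff)
      next
        case False
        define i where "i = nat \<lfloor>x / h\<rfloor>"
        have fl: "real i \<le> x / h" "x / h < real i + 1" using x pos by (auto simp: i_def)
        have i: "real i * h \<le> x" "x < (real i + 1) * h"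
          using fl pos by (simp_all add: pos_le_divide_eq pos_divide_less_eq)
        have "real i * h < real m * h" using i False by linarith
        then have im: "i < m" using pos by simp
        have i': "real (Suc i) * h = real i * h + h" by (simp add: algebra_simps)
        have mono: "F T (real i * h) \<le> F T x" "F T x \<le> F T (real (Suc i) * h)" "G T (real i * h) \<le> G T x" "G T x \<le> G T (real (Suc i) * h)"
          using mono_FG i elim by (auto simp: algebra_simps)
        have lip: "G T (real (Suc i) * h) - G T (real i * h) \<le> e / 2"
        proof -
          have "G T (real (Suc i) * h) - G T (real i * h) \<le> A * h"
            unfolding G_def i' using lipschitz[OF elim(4), of "real i * h" "real i * h + h"] pos by simp
          then show ?thesis using A by (simp add: h_def)
        qed
        have "F T (real (Suc i) * h) \<le> G T (real (Suc i) * h) + e / 2" "G T (real i * h) \<le> F T (real i * h) + e / 2"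
          using elim(1,2) im by (auto simp del: of_nat_Suc)
        then show ?thesis using mono lip by (simp add: abs_le_iff)
      qed
    qed
  qed
qed

end

subsection \<open>Normal variables\<close>

lemma normal_rv_moments:
  assumes N: "prob_space N" and Y: "normal_rv N Y"
  shows "Y \<in> borel_measurable N" "integrable N Y" "integrable N (\<lambda>\<omega>. (Y \<omega>)\<^sup>2)"
proof -
  interpret prob_space N by fact
  have "Y \<in> borel_measurable N \<and> integrable N Y \<and> integrable N (\<lambda>\<omega>. (Y \<omega>)\<^sup>2)"
    using Y unfolding normal_rv_def
  proof (elim disjE exE conjE)
    fix \<mu> s :: real assume s: "0 < s" and d: "distributed N lborel Y (\<lambda>x. ennreal (normal_density \<mu> s x))"
    have m: "Y \<in> borel_measurable N" using distributed_measurable[OF d] by simp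
    have "integrable lborel (\<lambda>x. normal_density \<mu> s x * x)" by (rule integrable_normal_moment_nz_1[OF s])
    then have 1: "integrable N Y" using distributed_integrable[OF d, of "\<lambda>x. x"] by simp
    have "integrable lborel (\<lambda>x. normal_density \<mu> s x * (x - \<mu>)\<^sup>2)" by (rule integrable_normal_moment[OF s])
    then have "integrable N (\<lambda>\<omega>. (Y \<omega> - \<mu>)\<^sup>2)" using distributed_integrable[OF d, of "\<lambda>x. (x - \<mu>)\<^sup>2"] by simp
    then have "integrable N (\<lambda>\<omega>. (Y \<omega> - \<mu>)\<^sup>2 + 2 * \<mu> * Y \<omega> - \<mu>\<^sup>2)" using 1 by auto
    moreover have "(Y \<omega> - \<mu>)\<^sup>2 + 2 * \<mu> * Y \<omega> - \<mu>\<^sup>2 = (Y \<omega>)\<^sup>2" for \<omega>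
      by (simp add: power2_eq_square algebra_simps)
    ultimately show ?thesis using m 1 by simp
  next
    fix \<mu> assume m[measurable]: "Y \<in> borel_measurable N" and ae: "AE \<omega> in N. Y \<omega> = \<mu>"
    have "integrable N Y" by (rule integrable_const_bound[where B = "\<bar>\<mu>\<bar>"]) (use ae in auto)
    moreover have "integrable N (\<lambda>\<omega>. (Y \<omega>)\<^sup>2)"
      by (rule integrable_const_bound[where B = "\<mu>\<^sup>2"]) (use ae in auto)
    ultimately show ?thesis using m by simp
  qed
  then show "Y \<in> borel_measurable N" "integrable N Y" "integrable N (\<lambda>\<omega>. (Y \<omega>)\<^sup>2)" by auto
qed

text \<open>The real part of the normal characteristic function. In the degenerate case the variable
  is almost surely 0 and both sides are 1.\<close>

lemma normal_rv_cos:
  assumes N: "prob_space N" and Y: "normal_rv N Y" and mean: "(\<integral>\<omega>. Y \<omega> \<partial>N) = 0"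
  shows "(\<integral>\<omega>. cos (Y \<omega>) \<partial>N) = exp (- (\<integral>\<omega>. (Y \<omega>)\<^sup>2 \<partial>N) / 2)"
  using Y unfolding normal_rv_def
proof (elim disjE exE conjE)
  interpret prob_space N by fact
  fix \<mu> s :: real assume s: "0 < s" and d: "distributed N lborel Y (\<lambda>x. ennreal (normal_density \<mu> s x))"
  have mu: "\<mu> = 0" using normal_distributed_expectation[OF s d] mean by simp
  have var: "(\<integral>\<omega>. (Y \<omega>)\<^sup>2 \<partial>N) = s\<^sup>2" using normal_distributed_variance[OF s d] mean by simp
  define Z where "Z \<omega> = Y \<omega> / s" for \<omega>
  have dZ: "distributed N lborel Z (\<lambda>x. ennreal (std_normal_density x))"
    using d normal_standard_normal_convert[OF s, of Y \<mu>] by (simp add: mu Z_def[abs_def])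
  have mZ: "Z \<in> measurable N lborel" by (rule distributed_measurable[OF dZ])
  have "(\<integral>\<omega>. cos (Y \<omega>) \<partial>N) = (\<integral>\<omega>. cos (s * Z \<omega>) \<partial>N)" using s by (simp add: Z_def)
  also have "\<dots> = (\<integral>x. cos (s * x) \<partial>distr N lborel Z)"
    by (subst integral_distr[OF mZ]) auto
  also have "distr N lborel Z = std_normal_distribution" by (rule distributed_distr_eq_density[OF dZ])
  also have "(\<integral>x. cos (s * x) \<partial>std_normal_distribution) = (\<integral>x. Re (iexp (s * x)) \<partial>std_normal_distribution)"
    by (simp add: cis_conv_exp[symmetric] del: of_real_mult)
  also have "\<dots> = Re (char std_normal_distribution s)"
  proof -
    interpret S: real_distribution std_normal_distribution by (rule real_dist_normal_dist)
    have "integrable std_normal_distribution (\<lambda>x. iexp (s * x))"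
      by (rule S.integrable_const_bound[where B = 1]) auto
    then show ?thesis unfolding char_def by (rule integral_Re)
  qed
  also have "\<dots> = exp (- (s\<^sup>2) / 2)" unfolding char_std_normal_distribution by simp
  finally show ?thesis unfolding var .
next
  interpret prob_space N by fact
  fix \<mu> assume m[measurable]: "Y \<in> borel_measurable N" and ae: "AE \<omega> in N. Y \<omega> = \<mu>"
  have "(\<integral>\<omega>. Y \<omega> \<partial>N) = (\<integral>\<omega>. \<mu> \<partial>N)" by (rule integral_cong_AE) (use ae in auto)
  then have mu: "\<mu> = 0" using mean by (simp add: prob_space)
  have "(\<integral>\<omega>. cos (Y \<omega>) \<partial>N) = (\<integral>\<omega>. 1 \<partial>N)"
    by (rule integral_cong_AE, use m in \<open>simp_all\<close>) (use ae mu in \<open>auto elim!: eventually_mono\<close>)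
  moreover have "(\<integral>\<omega>. (Y \<omega>)\<^sup>2 \<partial>N) = (\<integral>\<omega>. 0 \<partial>N)"
    by (rule integral_cong_AE, use m in \<open>simp_all\<close>) (use ae mu in \<open>auto elim!: eventually_mono\<close>)
  ultimately show ?thesis by (simp add: prob_space)
qed

text \<open>The event lies in two intervals of length \<open>y - x\<close>, and the density is at
  most \<open>1 / (2 * C)\<close> because \<open>sqrt (2 * pi)\<close> exceeds 2. The lower bound on
  the variance rules out the degenerate alternative.\<close>

lemma normal_rv_anticoncentration:
  assumes N: "prob_space N" and Y: "normal_rv N Y" and mean: "(\<integral>\<omega>. Y \<omega> \<partial>N) = 0"
    and C: "C > 0" "C\<^sup>2 \<le> (\<integral>\<omega>. (Y \<omega>)\<^sup>2 \<partial>N)" and xy: "x \<le> y"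
  shows "measure N {\<omega>\<in>space N. x < \<bar>Y \<omega>\<bar> \<and> \<bar>Y \<omega>\<bar> \<le> y} \<le> (y - x) / C"
  using Y unfolding normal_rv_def
proof (elim disjE exE conjE)
  interpret prob_space N by fact
  fix \<mu> s :: real assume s: "0 < s" and d: "distributed N lborel Y (\<lambda>x. ennreal (normal_density \<mu> s x))"
  have var: "(\<integral>\<omega>. (Y \<omega>)\<^sup>2 \<partial>N) = s\<^sup>2" using normal_distributed_variance[OF s d] mean by simp
  have Cs: "C \<le> s" using C(2) s unfolding var by (rule power2_le_imp_le[OF _ less_imp_le])
  let ?A = "{x<..y} \<union> {-y..<-x}"
  have [measurable]: "Y \<in> borel_measurable N" using distributed_measurable[OF d] by simp
  have dens: "normal_density \<mu> s z \<le> 1 / (2 * C)" for z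
  proof -
    have "normal_density \<mu> s z \<le> 1 / sqrt (2 * pi * s\<^sup>2) * 1"
      unfolding normal_density_def by (intro mult_left_mono) auto
    also have "sqrt (2 * pi * s\<^sup>2) = sqrt (2 * pi) * s" using s by (simp add: real_sqrt_mult)
    also have "1 / (sqrt (2 * pi) * s) * 1 \<le> 1 / (2 * C)"
    proof -
      have "2 = sqrt 4" by simp
      also have "\<dots> \<le> sqrt (2 * pi)" using pi_ge_two by (intro real_sqrt_le_mono) simp
      finally have "2 * C \<le> sqrt (2 * pi) * s" using Cs C by (intro mult_mono) auto
      then show ?thesis using C by (simp add: frac_le)
    qed
    finally show ?thesis .
  qed
  have "emeasure N {\<omega>\<in>space N. x < \<bar>Y \<omega>\<bar> \<and> \<bar>Y \<omega>\<bar> \<le> y} \<le> emeasure N (Y -` ?A \<inter> space N)"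
    by (intro emeasure_mono) auto
  also have "\<dots> = (\<integral>\<^sup>+z. ennreal (normal_density \<mu> s z) * indicator ?A z \<partial>lborel)"
    by (rule distributed_emeasure[OF d]) auto
  also have "\<dots> \<le> (\<integral>\<^sup>+z. ennreal (1 / (2 * C)) * indicator ?A z \<partial>lborel)"
    by (intro nn_integral_mono mult_right_mono ennreal_leI dens) auto
  also have "\<dots> = ennreal (1 / (2 * C)) * emeasure lborel ?A"
    by (rule nn_integral_cmult_indicator) auto
  also have "\<dots> \<le> ennreal (1 / (2 * C)) * (emeasure lborel {x<..y} + emeasure lborel {-y..<-x})"
    by (intro mult_left_mono emeasure_subadditive) auto
  also have "\<dots> = ennreal (1 / (2 * C)) * (ennreal (y - x) + ennreal (y - x))"
    using xy by simp
  also have "\<dots> = ennreal ((y - x) / C)"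
    using xy C by (simp add: ennreal_plus[symmetric] ennreal_mult[symmetric] diff_divide_distrib del: ennreal_plus)
  finally show ?thesis using xy C by (simp add: emeasure_eq_measure)
next
  interpret prob_space N by fact
  fix \<mu> assume m[measurable]: "Y \<in> borel_measurable N" and ae: "AE \<omega> in N. Y \<omega> = \<mu>"
  have "(\<integral>\<omega>. Y \<omega> \<partial>N) = (\<integral>\<omega>. \<mu> \<partial>N)" by (rule integral_cong_AE) (use ae in auto)
  then have mu: "\<mu> = 0" using mean by (simp add: prob_space)
  have "(\<integral>\<omega>. (Y \<omega>)\<^sup>2 \<partial>N) = (\<integral>\<omega>. 0 \<partial>N)"
    by (rule integral_cong_AE, use m in \<open>simp_all\<close>) (use ae mu in \<open>auto elim!: eventually_mono\<close>)
  then have "C\<^sup>2 \<le> 0" using C by simp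
  then show ?thesis using C by simp
qed

subsection \<open>Toeplitz systems\<close>

text \<open>The Toeplitz matrix acting on functions with indices from 0. It is linear in the vector
  and in the symbol \<open>s\<close>, which lets perturbed systems be treated without carrier
  conditions.\<close>

definition toep :: "nat \<Rightarrow> (nat \<Rightarrow> real) \<Rightarrow> (nat \<Rightarrow> real) \<Rightarrow> nat \<Rightarrow> real" where
  "toep p s v j = (\<Sum>k<p. s (nat \<bar>int j - int k\<bar>) * v k)"

lemma toeplitz_carrier [simp]: "toeplitz p s \<in> carrier_mat p p" "dim_row (toeplitz p s) = p" "dim_col (toeplitz p s) = p"
  by (auto simp: toeplitz_def)

lemma toeplitz_mult_vec:
  assumes "v \<in> carrier_vec p" "j < p"
  shows "(toeplitz p s *\<^sub>v v) $ j = toep p s (\<lambda>i. v $ i) j"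
  using assms by (auto simp: toeplitz_def toep_def scalar_prod_def lessThan_atLeast0 intro!: sum.cong)

lemma toep_diff: "toep p s (\<lambda>i. v i - w i) j = toep p s v j - toep p s w j"
  by (simp add: toep_def sum_subtractf algebra_simps)

lemma toep_scale: "toep p s (\<lambda>i. c * v i) j = c * toep p s v j"
  by (simp add: toep_def sum_distrib_left mult_ac)

lemma toep_sum: "toep p s (\<lambda>i. \<Sum>k\<in>I. f k i) j = (\<Sum>k\<in>I. toep p s (f k) j)"
  unfolding toep_def sum_distrib_left by (rule sum.swap)

lemma toep_linear_symbol: "toep p (\<lambda>k. s k + c * r k) v j = toep p s v j + c * toep p r v j"
  by (simp add: toep_def sum.distrib sum_distrib_left algebra_simps)

lemma smult_one_mult_vec: "y \<in> carrier_vec n \<Longrightarrow> ((c :: real) \<cdot>\<^sub>m 1\<^sub>m n) *\<^sub>v y = c \<cdot>\<^sub>v y"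
  by (rule eq_vecI) auto

lemma inverse_mat_exists:
  fixes A :: "real mat"
  assumes A: "A \<in> carrier_mat n n" and d: "Determinant.det A \<noteq> 0"
  obtains B where "B \<in> carrier_mat n n" "A * B = 1\<^sub>m n" "B * A = 1\<^sub>m n" "mat_inverse A = Some B"
proof -
  have "A \<in> Units (ring_mat TYPE(real) n ())" by (rule det_non_zero_imp_unit[OF A d])
  then obtain B where B: "mat_inverse A = Some B" using mat_inverse(1)[OF A, of "()"] by (cases "mat_inverse A") auto
  from mat_inverse(2)[OF A this] B show ?thesis using that by blast
qed

lemma mult_mat_vec_bounded:
  fixes B :: "real mat"
  assumes B: "B \<in> carrier_mat n n"
  shows "\<exists>\<kappa>>0. \<forall>x\<in>carrier_vec n. (\<Sum>j<n. ((B *\<^sub>v x) $ j)\<^sup>2) \<le> \<kappa> * (\<Sum>j<n. (x $ j)\<^sup>2)"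
proof (intro exI[of _ "1 + (\<Sum>j<n. \<Sum>k<n. (B $$ (j, k))\<^sup>2)"] conjI ballI)
  show "0 < 1 + (\<Sum>j<n. \<Sum>k<n. (B $$ (j, k))\<^sup>2)" by (intro add_pos_nonneg sum_nonneg) auto
  fix x :: "real vec" assume x: "x \<in> carrier_vec n"
  have "(\<Sum>j<n. ((B *\<^sub>v x) $ j)\<^sup>2) = (\<Sum>j<n. (\<Sum>k<n. B $$ (j, k) * x $ k)\<^sup>2)"
    using B x by (intro sum.cong) (auto simp: scalar_prod_def lessThan_atLeast0 intro!: arg_cong[where f = "\<lambda>x. x\<^sup>2"] sum.cong)
  also have "\<dots> \<le> (\<Sum>j<n. (\<Sum>k<n. (B $$ (j, k))\<^sup>2) * (\<Sum>k<n. (x $ k)\<^sup>2))"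
    by (intro sum_mono Cauchy_Schwarz_ineq_sum)
  also have "\<dots> = (\<Sum>j<n. \<Sum>k<n. (B $$ (j, k))\<^sup>2) * (\<Sum>k<n. (x $ k)\<^sup>2)" by (simp add: sum_distrib_right)
  also have "\<dots> \<le> (1 + (\<Sum>j<n. \<Sum>k<n. (B $$ (j, k))\<^sup>2)) * (\<Sum>k<n. (x $ k)\<^sup>2)"
    by (intro mult_right_mono sum_nonneg) auto
  finally show "(\<Sum>j<n. ((B *\<^sub>v x) $ j)\<^sup>2) \<le> (1 + (\<Sum>j<n. \<Sum>k<n. (B $$ (j, k))\<^sup>2)) * (\<Sum>k<n. (x $ k)\<^sup>2)" .
qed

lemma quadratic_form_bounded:
  fixes a :: "nat \<Rightarrow> nat \<Rightarrow> real"
  shows "\<exists>\<beta>>0. \<forall>v. \<bar>\<Sum>j<p. \<Sum>k<p. a j k * v j * v k\<bar> \<le> \<beta> * (\<Sum>j<p. (v j)\<^sup>2)"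
proof (intro exI[of _ "1 + (\<Sum>j<p. \<Sum>k<p. \<bar>a j k\<bar>)"] conjI allI)
  show "0 < 1 + (\<Sum>j<p. \<Sum>k<p. \<bar>a j k\<bar>)" by (intro add_pos_nonneg sum_nonneg) auto
  fix v :: "nat \<Rightarrow> real"
  let ?n = "\<Sum>j<p. (v j)\<^sup>2"
  have n: "?n \<ge> 0" by (intro sum_nonneg) auto
  have sq: "(v j)\<^sup>2 \<le> ?n" if "j < p" for j using that by (intro member_le_sum) auto
  have "\<bar>\<Sum>j<p. \<Sum>k<p. a j k * v j * v k\<bar> \<le> (\<Sum>j<p. \<Sum>k<p. \<bar>a j k\<bar> * ?n)"
  proof (intro order_trans[OF sum_abs] sum_mono)
    fix j k assume jk: "j \<in> {..<p}" "k \<in> {..<p}"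
    have "2 * \<bar>v j * v k\<bar> \<le> (v j)\<^sup>2 + (v k)\<^sup>2"
      using sum_squares_bound[of "\<bar>v j\<bar>" "\<bar>v k\<bar>"] by (simp add: abs_mult)
    then have "\<bar>v j * v k\<bar> \<le> ?n" using sq[of j] sq[of k] jk by auto
    then show "\<bar>a j k * v j * v k\<bar> \<le> \<bar>a j k\<bar> * ?n"
      unfolding mult.assoc abs_mult[of "a j k"] by (intro mult_left_mono) auto
  qed
  also have "\<dots> = (\<Sum>j<p. \<Sum>k<p. \<bar>a j k\<bar>) * ?n" by (simp add: sum_distrib_right)
  also have "\<dots> \<le> (1 + (\<Sum>j<p. \<Sum>k<p. \<bar>a j k\<bar>)) * ?n" using n by (intro mult_right_mono) auto
  finally show "\<bar>\<Sum>j<p. \<Sum>k<p. a j k * v j * v k\<bar> \<le> (1 + (\<Sum>j<p. \<Sum>k<p. \<bar>a j k\<bar>)) * ?n" .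
qed

text \<open>The infimum \<open>\<mu>\<close> of the Rayleigh quotient is an eigenvalue: \<open>A - \<mu>\<close> is positive semidefinite and
  takes arbitrarily small values on unit vectors, so it has no bounded inverse.\<close>

lemma rayleigh:
  fixes a :: "nat \<Rightarrow> nat \<Rightarrow> real"
  assumes p: "p \<ge> 1" and sym: "\<And>j k. a j k = a k j"
    and inv: "\<And>\<mu>. \<mu> \<le> c \<Longrightarrow> \<exists>\<kappa>>0. \<forall>v. (\<Sum>j<p. (v j)\<^sup>2) \<le> \<kappa> * (\<Sum>j<p. ((\<Sum>k<p. a j k * v k) - \<mu> * v j)\<^sup>2)"
  shows "c * (\<Sum>j<p. (v j)\<^sup>2) \<le> (\<Sum>j<p. \<Sum>k<p. a j k * v j * v k)"
proof -
  define n where "n v = (\<Sum>j<p. (v j)\<^sup>2)" for v :: "nat \<Rightarrow> real"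
  define Q where "Q v = (\<Sum>j<p. \<Sum>k<p. a j k * v j * v k)" for v
  define R where "R = Q ` {v. n v = 1}"
  define \<mu> where "\<mu> = Inf R"
  have n0: "n v \<ge> 0" for v unfolding n_def by (intro sum_nonneg) auto
  obtain \<beta> where \<beta>: "\<And>v. \<bar>Q v\<bar> \<le> \<beta> * n v" using quadratic_form_bounded[of a p] unfolding Q_def n_def by blast
  have bdd: "bdd_below R"
    unfolding R_def
  proof (rule bdd_belowI2[where m = "- \<beta>"])
    show "- \<beta> \<le> Q v" if "v \<in> {v. n v = 1}" for v using \<beta>[of v] that by (simp add: abs_le_iff)
  qed
  have scale: "Q (\<lambda>j. t * v j) = t\<^sup>2 * Q v" "n (\<lambda>j. t * v j) = t\<^sup>2 * n v" for t v
    by (simp_all add: Q_def n_def sum_distrib_left power2_eq_square mult_ac)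
  have ne: "R \<noteq> {}"
  proof -
    have "n (\<lambda>j. if j = 0 then 1 else 0) = 1" using p by (simp add: n_def if_distrib[of "\<lambda>x. x\<^sup>2"] cong: if_cong)
    then show ?thesis by (auto simp: R_def)
  qed
  have psd: "\<mu> * n v \<le> Q v" for v
  proof (cases "n v = 0")
    case True then show ?thesis using \<beta>[of v] by simp
  next
    case False
    then have nv: "n v > 0" using n0[of v] by simp
    define t where "t = 1 / sqrt (n v)"
    have t: "t\<^sup>2 = 1 / n v" using nv by (simp add: t_def power_divide)
    have "Q (\<lambda>j. t * v j) \<in> R" unfolding R_def by (rule imageI) (use nv in \<open>simp add: scale t\<close>)
    then have "\<mu> \<le> Q (\<lambda>j. t * v j)" unfolding \<mu>_def by (rule cInf_lower) (rule bdd)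
    then show ?thesis using nv by (simp add: scale t pos_le_divide_eq)
  qed
  have "c \<le> \<mu>"
  proof (rule ccontr)
    assume "\<not> c \<le> \<mu>"
    then obtain \<kappa> where \<kappa>: "\<kappa> > 0" "\<And>v. n v \<le> \<kappa> * (\<Sum>j<p. ((\<Sum>k<p. a j k * v k) - \<mu> * v j)\<^sup>2)"
      using inv[of \<mu>] unfolding n_def by auto
    define b where "b j k = a j k - (if j = k then \<mu> else 0)" for j k
    define q where "q v = (\<Sum>j<p. \<Sum>k<p. b j k * v j * v k)" for v
    define L where "L v j = (\<Sum>k<p. b j k * v k)" for v j
    have L: "L v j = (\<Sum>k<p. a j k * v k) - \<mu> * v j" if "j < p" for v j
      using that by (simp add: L_def b_def left_diff_distrib sum_subtractf if_distrib[of "\<lambda>x. x * _"] cong: if_cong)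
    have qL: "q v = (\<Sum>j<p. v j * L v j)" for v
      by (simp add: q_def L_def sum_distrib_left mult_ac)
    have q: "q v = Q v - \<mu> * n v" for v
      unfolding qL by (simp add: L Q_def n_def right_diff_distrib sum_subtractf sum_distrib_left power2_eq_square mult_ac)
    obtain \<beta>' where \<beta>': "\<beta>' > 0" "\<And>v. \<bar>q v\<bar> \<le> \<beta>' * n v" using quadratic_form_bounded[of b p] unfolding q_def n_def by blast
    have bsym: "b j k = b k j" for j k using sym by (simp add: b_def)
    \<comment> \<open>Positivity of \<open>q\<close> at \<open>v - t * L v\<close> gives
      \<open>2 * t * n (L v) \<le> q v + t\<^sup>2 * q (L v)\<close>; the choice
      \<open>t = 1 / \<beta>'\<close> makes the last term at most
      \<open>t * n (L v)\<close>.\<close>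
    have Lq: "n (L v) \<le> \<beta>' * q v" for v
    proof -
      define t where "t = 1 / \<beta>'"
      have cross: "(\<Sum>j<p. v j * L (L v) j) = n (L v)"
      proof -
        have "(\<Sum>j<p. v j * L (L v) j) = (\<Sum>j<p. \<Sum>k<p. b j k * v j * L v k)"
          unfolding L_def[of "L v"] by (simp add: sum_distrib_left mult_ac)
        also have "\<dots> = (\<Sum>k<p. \<Sum>j<p. b j k * v j * L v k)" by (rule sum.swap)
        also have "\<dots> = (\<Sum>k<p. L v k * L v k)"
          unfolding L_def[of v] by (simp add: sum_distrib_right bsym)
        finally show ?thesis by (simp add: n_def power2_eq_square)
      qed
      have Ldiff: "L (\<lambda>j. v j - t * L v j) j = L v j - t * L (L v) j" for j
        unfolding L_def[of "\<lambda>j. v j - t * L v j"] L_def[of "L v"]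
        by (simp add: right_diff_distrib sum_subtractf sum_distrib_left mult_ac L_def[of v])
      have "0 \<le> q (\<lambda>j. v j - t * L v j)" using psd q by simp
      also have "\<dots> = (\<Sum>j<p. v j * L v j) - t * (\<Sum>j<p. v j * L (L v) j) - t * (\<Sum>j<p. L v j * L v j) + t * t * (\<Sum>j<p. L v j * L (L v) j)"
        unfolding qL Ldiff by (simp add: algebra_simps sum_subtractf sum.distrib sum_distrib_left)
      also have "\<dots> = q v - 2 * t * n (L v) + t\<^sup>2 * q (L v)"
        unfolding cross by (simp add: qL n_def power2_eq_square)
      also have "t\<^sup>2 * q (L v) \<le> t\<^sup>2 * (\<beta>' * n (L v))" using \<beta>'(2)[of "L v"] by (intro mult_left_mono) auto
      also have "t\<^sup>2 * (\<beta>' * n (L v)) = t * n (L v)" using \<beta>'(1) by (simp add: t_def power2_eq_square)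
      finally have "t * n (L v) \<le> q v" by simp
      then show ?thesis using \<beta>'(1) by (simp add: t_def field_simps)
    qed
    \<comment> \<open>A bounded inverse would bound \<open>q\<close> away from zero on unit vectors,
      although its infimum there is zero by the choice of \<mu>.\<close>
    have bound: "n v \<le> \<kappa> * (\<beta>' * q v)" for v
    proof -
      have "n v \<le> \<kappa> * (\<Sum>j<p. (L v j)\<^sup>2)" using \<kappa>(2)[of v] by (simp add: L)
      also have "(\<Sum>j<p. (L v j)\<^sup>2) = n (L v)" by (simp add: n_def)
      also have "\<kappa> * n (L v) \<le> \<kappa> * (\<beta>' * q v)" using Lq \<kappa>(1) by (intro mult_left_mono) auto
      finally show ?thesis .
    qed
    \<comment> \<open>The tolerance is half of that lower bound, so a near-minimiser yields
      \<open>1 \<le> 1 / 2\<close>.\<close>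
    have "\<mu> < \<mu> + 1 / (2 * \<kappa> * \<beta>')" using \<kappa>(1) \<beta>'(1) by simp
    then obtain r where "r \<in> R" "r < \<mu> + 1 / (2 * \<kappa> * \<beta>')"
      unfolding \<mu>_def using cInf_lessD[OF ne] by blast
    then obtain v where v: "n v = 1" "Q v < \<mu> + 1 / (2 * \<kappa> * \<beta>')" by (auto simp: R_def)
    then have "\<kappa> * \<beta>' * q v < \<kappa> * \<beta>' * (1 / (2 * \<kappa> * \<beta>'))" using \<kappa>(1) \<beta>'(1) by (intro mult_strict_left_mono) (auto simp: q)
    also have "\<dots> = 1 / 2" using \<kappa>(1) \<beta>'(1) by simp
    finally show False using bound[of v] v(1) by (simp add: mult.assoc)
  qed
  then have "c * n v \<le> \<mu> * n v" using n0 by (intro mult_right_mono) auto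
  then show ?thesis using psd[of v] unfolding n_def Q_def by linarith
qed

definition coercive :: "nat \<Rightarrow> real \<Rightarrow> (nat \<Rightarrow> real) \<Rightarrow> bool" where
  "coercive p c s \<longleftrightarrow> (\<forall>v. c * (\<Sum>j<p. (v j)\<^sup>2) \<le> (\<Sum>j<p. v j * toep p s v j))"

text \<open>No number up to \<open>c\<close> is an eigenvalue, so each shifted matrix has a bounded
  inverse, which is the hypothesis of \<open>rayleigh\<close>.\<close>

lemma coercive_of_spectrum:
  assumes p: "p \<ge> 1" and c: "c < Min (spectrum (toeplitz p s))"
  shows "coercive p c s"
  unfolding coercive_def
proof
  fix v :: "nat \<Rightarrow> real"
  define a where "a j k = s (nat \<bar>int j - int k\<bar>)" for j k
  let ?A = "toeplitz p s"
  have "c * (\<Sum>j<p. (v j)\<^sup>2) \<le> (\<Sum>j<p. \<Sum>k<p. a j k * v j * v k)"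
  proof (rule rayleigh[OF p])
    show "a j k = a k j" for j k by (simp add: a_def abs_minus_commute)
    fix \<mu> assume \<mu>: "\<mu> \<le> c"
    have fin: "finite (spectrum ?A)" by (rule card_finite_spectrum(1)[of _ p]) simp
    have "\<mu> \<notin> spectrum ?A" using Min_le[OF fin, of \<mu>] \<mu> c by auto
    then have d: "Determinant.det (char_matrix ?A \<mu>) \<noteq> 0"
      using eigenvalue_det[of ?A p \<mu>] by (simp add: spectrum_def)
    have cA: "char_matrix ?A \<mu> \<in> carrier_mat p p" by simp
    obtain B where B: "B \<in> carrier_mat p p" "B * char_matrix ?A \<mu> = 1\<^sub>m p"
      using inverse_mat_exists[OF cA d] by blast
    obtain \<kappa> where \<kappa>: "\<kappa> > 0" "\<And>x. x \<in> carrier_vec p \<Longrightarrow> (\<Sum>j<p. ((B *\<^sub>v x) $ j)\<^sup>2) \<le> \<kappa> * (\<Sum>j<p. (x $ j)\<^sup>2)"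
      using mult_mat_vec_bounded[OF B(1)] by blast
    show "\<exists>\<kappa>>0. \<forall>v. (\<Sum>j<p. (v j)\<^sup>2) \<le> \<kappa> * (\<Sum>j<p. ((\<Sum>k<p. a j k * v k) - \<mu> * v j)\<^sup>2)"
    proof (intro exI[of _ \<kappa>] conjI allI \<kappa>(1))
      fix v :: "nat \<Rightarrow> real"
      define y where "y = Matrix.vec p v"
      define x where "x = char_matrix ?A \<mu> *\<^sub>v y"
      have y: "y \<in> carrier_vec p" by (simp add: y_def)
      have x: "x \<in> carrier_vec p" unfolding x_def by (rule mult_mat_vec_carrier[OF cA y])
      have "B *\<^sub>v x = (B * char_matrix ?A \<mu>) *\<^sub>v y"
        unfolding x_def by (rule assoc_mult_mat_vec[OF B(1) cA y, symmetric])
      then have "B *\<^sub>v x = y" using B(2) y by simp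
      moreover have "x $ j = (\<Sum>k<p. a j k * v k) - \<mu> * v j" if j: "j < p" for j
      proof -
        have "x = ?A *\<^sub>v y + (- \<mu>) \<cdot>\<^sub>v y"
          unfolding x_def char_matrix_def using y
          by (subst add_mult_distrib_mat_vec[of _ p p]) (auto simp: smult_one_mult_vec)
        then have "x $ j = (?A *\<^sub>v y) $ j - \<mu> * y $ j" using j y by simp
        also have "(?A *\<^sub>v y) $ j = toep p s (\<lambda>i. y $ i) j" by (rule toeplitz_mult_vec[OF y j])
        also have "\<dots> = (\<Sum>k<p. a j k * v k)" by (simp add: toep_def a_def y_def)
        finally show ?thesis using j by (simp add: y_def)
      qed
      ultimately show "(\<Sum>j<p. (v j)\<^sup>2) \<le> \<kappa> * (\<Sum>j<p. ((\<Sum>k<p. a j k * v k) - \<mu> * v j)\<^sup>2)"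
        using \<kappa>(2)[OF x] by (simp add: y_def)
    qed
  qed
  then show "c * (\<Sum>j<p. (v j)\<^sup>2) \<le> (\<Sum>j<p. v j * toep p s v j)"
    by (simp add: a_def toep_def sum_distrib_left mult_ac)
qed

lemma det_nonzero_of_positive:
  assumes pos: "\<And>v. (\<exists>j<p. v j \<noteq> 0) \<Longrightarrow> 0 < (\<Sum>j<p. v j * toep p s v j)"
  shows "Determinant.det (toeplitz p s) \<noteq> 0"
proof
  assume "Determinant.det (toeplitz p s) = 0"
  then obtain v where v: "v \<in> carrier_vec p" "v \<noteq> 0\<^sub>v p" "toeplitz p s *\<^sub>v v = 0\<^sub>v p"
    using det_0_iff_vec_prod_zero_field[of "toeplitz p s" p] by auto
  have "toep p s (\<lambda>i. v $ i) j = 0" if "j < p" for j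
    using toeplitz_mult_vec[OF v(1) that, of s] v(3) that by simp
  moreover have "\<exists>j<p. v $ j \<noteq> 0" using v(1,2) by (auto intro!: eq_vecI)
  ultimately show False using pos[of "\<lambda>i. v $ i"] by simp
qed

lemma coercive_det_nonzero:
  assumes "coercive p c s" "c > 0"
  shows "Determinant.det (toeplitz p s) \<noteq> 0"
proof (rule det_nonzero_of_positive)
  fix v :: "nat \<Rightarrow> real" assume "\<exists>j<p. v j \<noteq> 0"
  then obtain j where j: "j < p" "v j \<noteq> 0" by blast
  have "0 < (\<Sum>j<p. (v j)\<^sup>2)" by (rule sum_pos2[of _ j]) (use j in auto)
  then have "0 < c * (\<Sum>j<p. (v j)\<^sup>2)" using assms(2) by simp
  then show "0 < (\<Sum>j<p. v j * toep p s v j)" using assms(1) by (auto simp: coercive_def intro: less_le_trans)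
qed

lemma coercive_norm:
  assumes "coercive p c s"
  shows "c * L2_set v {..<p} \<le> L2_set (toep p s v) {..<p}"
proof (cases "L2_set v {..<p} = 0")
  case False
  then have pos: "L2_set v {..<p} > 0" using L2_set_nonneg[of v "{..<p}"] by linarith
  have "c * (L2_set v {..<p})\<^sup>2 \<le> (\<Sum>j<p. v j * toep p s v j)"
    using assms by (simp add: coercive_def L2_set_def sum_nonneg)
  also have "\<dots> \<le> (\<Sum>j<p. \<bar>v j\<bar> * \<bar>toep p s v j\<bar>)" by (intro sum_mono) (simp add: abs_mult[symmetric])
  also have "\<dots> \<le> L2_set v {..<p} * L2_set (toep p s v) {..<p}" by (rule L2_set_mult_ineq)
  finally have "L2_set v {..<p} * (c * L2_set v {..<p}) \<le> L2_set v {..<p} * L2_set (toep p s v) {..<p}"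
    by (simp add: power2_eq_square mult_ac)
  then show ?thesis using pos by simp
qed (simp add: L2_set_nonneg)

lemma L2_set_le_const:
  fixes f :: "nat \<Rightarrow> real"
  assumes "\<And>j. j < p \<Longrightarrow> \<bar>f j\<bar> \<le> B" shows "L2_set f {..<p} \<le> real p * B"
  using order_trans[OF L2_set_le_sum_abs sum_bounded_above[of "{..<p}" "\<lambda>j. \<bar>f j\<bar>" B]] assms by simp

lemma abs_le_L2_set: "(j :: nat) < p \<Longrightarrow> \<bar>f j\<bar> \<le> L2_set f {..<p}"
proof -
  assume "j < p"
  then have "\<bar>f j\<bar> \<le> L2_set (\<lambda>j. \<bar>f j\<bar>) {..<p}" by (intro member_le_L2_set) auto
  then show ?thesis by (simp add: L2_set_def)
qed

lemma toep_le:
  assumes "\<And>k. k < p \<Longrightarrow> \<bar>r k\<bar> \<le> R" "j < p"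
  shows "\<bar>toep p r v j\<bar> \<le> R * (real p * L2_set v {..<p})"
proof -
  have "\<bar>toep p r v j\<bar> \<le> (\<Sum>k<p. \<bar>r (nat \<bar>int j - int k\<bar>)\<bar> * \<bar>v k\<bar>)"
    unfolding toep_def by (rule order_trans[OF sum_abs]) (simp add: abs_mult)
  also have "\<dots> \<le> (\<Sum>k<p. R * L2_set v {..<p})"
    using assms by (intro sum_mono mult_mono abs_le_L2_set) (auto intro!: order_trans[OF abs_ge_zero assms(1)])
  finally show ?thesis by (simp add: mult_ac)
qed

lemma L2_toep_le:
  assumes "\<And>k. k < p \<Longrightarrow> \<bar>r k\<bar> \<le> R"
  shows "L2_set (toep p r v) {..<p} \<le> real p * (R * (real p * L2_set v {..<p}))"
  by (rule L2_set_le_const) (rule toep_le[OF assms])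


text \<open>Uniqueness comes from multiplying \<open>A * G * A = A\<close> by \<open>B\<close> on
  both sides.\<close>

lemma pseudo_inverse_eq:
  assumes A: "A \<in> carrier_mat n n" and B: "B \<in> carrier_mat n n" and AB: "A * B = 1\<^sub>m n" "B * A = 1\<^sub>m n"
  shows "pseudo_inverse A = B"
  unfolding pseudo_inverse_def
proof (rule the_equality)
  show "B \<in> carrier_mat (dim_col A) (dim_row A) \<and> A * B * A = A \<and> B * A * B = B \<and>
    transpose_mat (A * B) = A * B \<and> transpose_mat (B * A) = B * A"
    using A B AB by auto
  fix G assume G: "G \<in> carrier_mat (dim_col A) (dim_row A) \<and> A * G * A = A \<and> G * A * G = G \<and>
    transpose_mat (A * G) = A * G \<and> transpose_mat (G * A) = G * A"
  then have g: "G \<in> carrier_mat n n" using A by auto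
  have "B * (A * G * A) * B = (B * A) * G * (A * B)"
    using A B g by (simp add: assoc_mult_mat[of _ n n _ n _ n])
  moreover have "B * A * B = B" using AB B by simp
  ultimately show "G = B" using G AB g by simp
qed

text \<open>Needed for the outcome in which all observations vanish, where the sample matrix is
  zero.\<close>

lemma pseudo_inverse_zero: "pseudo_inverse (0\<^sub>m n n) = 0\<^sub>m n n"
  unfolding pseudo_inverse_def by (rule the_equality) auto

lemma yule_walker_zero:
  assumes "\<And>k. k \<le> p \<Longrightarrow> sample_acov T X \<omega> k = 0" "j \<in> {1..p}"
  shows "yule_walker T p X j \<omega> = 0"
proof -
  have "toeplitz p (sample_acov T X \<omega>) = 0\<^sub>m p p" "lag_vec p (sample_acov T X \<omega>) = 0\<^sub>v p"
    using assms(1) by (auto simp: toeplitz_def lag_vec_def intro!: eq_matI eq_vecI)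
  moreover have "0\<^sub>m p p *\<^sub>v 0\<^sub>v p = (0\<^sub>v p :: real vec)" by (rule eq_vecI) auto
  moreover have "j - 1 < p" using assms(2) by auto
  ultimately show ?thesis by (simp add: yule_walker_def pseudo_inverse_zero)
qed

lemma lag_vec_carrier [simp]: "lag_vec p s \<in> carrier_vec p" by (simp add: lag_vec_def)

text \<open>The pseudo-inverse is a definite description. Where the determinant is nonzero, the
  estimator is a quotient of polynomials in the sample autocovariances, from which measurability is
  read off, and it solves the sample equations.\<close>

lemma yule_walker_cramer:
  fixes X :: "int \<Rightarrow> 'a \<Rightarrow> real" and T p :: nat
  defines "s \<equiv> \<lambda>\<omega>. sample_acov T X \<omega>"
  assumes d: "Determinant.det (toeplitz p (s \<omega>)) \<noteq> 0" and j: "j \<in> {1..p}"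
  shows "yule_walker T p X j \<omega> = (adj_mat (toeplitz p (s \<omega>)) *\<^sub>v lag_vec p (s \<omega>)) $ (j - 1) / Determinant.det (toeplitz p (s \<omega>))"
    and "k < p \<Longrightarrow> toep p (s \<omega>) (\<lambda>i. yule_walker T p X (i + 1) \<omega>) k = s \<omega> (k + 1)"
proof -
  let ?A = "toeplitz p (s \<omega>)" and ?g = "lag_vec p (s \<omega>)"
  have j': "j - 1 < p" using j by auto
  obtain B where B: "B \<in> carrier_mat p p" "?A * B = 1\<^sub>m p" "B * ?A = 1\<^sub>m p"
    using inverse_mat_exists[OF toeplitz_carrier(1) d] by blast
  have pi: "pseudo_inverse ?A = B" by (rule pseudo_inverse_eq[OF _ B]) simp
  have y: "B *\<^sub>v ?g \<in> carrier_vec p" using B by auto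
  have Ay: "?A *\<^sub>v (B *\<^sub>v ?g) = ?g"
    using assoc_mult_mat_vec[of ?A p p B p ?g] B by simp
  have "adj_mat ?A *\<^sub>v ?g = (adj_mat ?A * ?A) *\<^sub>v (B *\<^sub>v ?g)"
    using assoc_mult_mat_vec[of "adj_mat ?A" p p ?A p "B *\<^sub>v ?g"] Ay y adj_mat(1)[of ?A p] by simp
  also have "\<dots> = Determinant.det ?A \<cdot>\<^sub>v (B *\<^sub>v ?g)"
    unfolding adj_mat(3)[OF toeplitz_carrier(1)] by (rule smult_one_mult_vec[OF y])
  finally have "(adj_mat ?A *\<^sub>v ?g) $ (j - 1) = Determinant.det ?A * (B *\<^sub>v ?g) $ (j - 1)"
    using j' B by simp
  then show "yule_walker T p X j \<omega> = (adj_mat ?A *\<^sub>v ?g) $ (j - 1) / Determinant.det ?A"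
    using d pi by (simp add: yule_walker_def s_def)
  assume k: "k < p"
  have "toep p (s \<omega>) (\<lambda>i. yule_walker T p X (i + 1) \<omega>) k = toep p (s \<omega>) (\<lambda>i. (B *\<^sub>v ?g) $ i) k"
    using pi by (simp add: yule_walker_def s_def)
  also have "\<dots> = (?A *\<^sub>v (B *\<^sub>v ?g)) $ k" by (rule toeplitz_mult_vec[OF y k, symmetric])
  also have "\<dots> = s \<omega> (k + 1)" unfolding Ay using k by (simp add: lag_vec_def)
  finally show "toep p (s \<omega>) (\<lambda>i. yule_walker T p X (i + 1) \<omega>) k = s \<omega> (k + 1)" .
qed

section \<open>Measurability of the estimator and positive definiteness of the sample matrix\<close>

lemma det_measurable:
  fixes A :: "'a \<Rightarrow> real mat"
  assumes A: "\<And>\<omega>. A \<omega> \<in> carrier_mat n n" and m: "\<And>i j. i < n \<Longrightarrow> j < n \<Longrightarrow> (\<lambda>\<omega>. A \<omega> $$ (i, j)) \<in> borel_measurable M"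
  shows "(\<lambda>\<omega>. Determinant.det (A \<omega>)) \<in> borel_measurable M"
  unfolding det_def'[OF A]
  by (intro borel_measurable_sum borel_measurable_times borel_measurable_const borel_measurable_prod m)
     (auto dest: permutes_in_image)

lemma adj_mult_measurable:
  fixes s :: "'a \<Rightarrow> nat \<Rightarrow> real"
  assumes m[measurable]: "\<And>k. (\<lambda>\<omega>. s \<omega> k) \<in> borel_measurable M" and j: "j < p"
  shows "(\<lambda>\<omega>. Determinant.det (toeplitz p (s \<omega>))) \<in> borel_measurable M"
    "(\<lambda>\<omega>. (adj_mat (toeplitz p (s \<omega>)) *\<^sub>v lag_vec p (s \<omega>)) $ j) \<in> borel_measurable M"
proof -
  show "(\<lambda>\<omega>. Determinant.det (toeplitz p (s \<omega>))) \<in> borel_measurable M"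
    by (rule det_measurable) (auto simp: toeplitz_def)
  have cof: "(\<lambda>\<omega>. cofactor (toeplitz p (s \<omega>)) i k) \<in> borel_measurable M" if "i < p" "k < p" for i k
    unfolding Determinant.cofactor_def
  proof (intro borel_measurable_times borel_measurable_const det_measurable[where n = "p - 1"])
    show "mat_delete (toeplitz p (s \<omega>)) i k \<in> carrier_mat (p - 1) (p - 1)" for \<omega>
      by (rule mat_delete_carrier) simp
    show "(\<lambda>\<omega>. mat_delete (toeplitz p (s \<omega>)) i k $$ (i', k')) \<in> borel_measurable M"
      if "i' < p - 1" "k' < p - 1" for i' k'
      using that by (simp add: mat_delete_def toeplitz_def)
  qed
  have "(adj_mat (toeplitz p (s \<omega>)) *\<^sub>v lag_vec p (s \<omega>)) $ j =
     (\<Sum>i<p. cofactor (toeplitz p (s \<omega>)) i j * s \<omega> (i + 1))" for \<omega>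
    using j by (auto simp: adj_mat_def scalar_prod_def lag_vec_def lessThan_atLeast0 intro!: sum.cong)
  moreover have "(\<lambda>\<omega>. \<Sum>i<p. cofactor (toeplitz p (s \<omega>)) i j * s \<omega> (i + 1)) \<in> borel_measurable M"
    using cof j by (intro borel_measurable_sum borel_measurable_times m) auto
  ultimately show "(\<lambda>\<omega>. (adj_mat (toeplitz p (s \<omega>)) *\<^sub>v lag_vec p (s \<omega>)) $ j) \<in> borel_measurable M" by simp
qed

text \<open>With \<open>x\<^sub>t\<close> set to \<open>0\<close> outside \<open>1, \<dots>, T\<close>, the quadratic form is \<open>\<Sum>\<^sub>t (\<Sum>\<^sub>j v\<^sub>j x\<^sub>t\<^sub>-\<^sub>j)\<^sup>2 / T\<close>. If it vanishes, so does
  the convolution of \<open>v\<close> and \<open>x\<close>, that is, the product of two polynomials.\<close>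

lemma sample_acov_positive:
  fixes X :: "int \<Rightarrow> 'a \<Rightarrow> real"
  assumes T: "T \<ge> 1" and nz: "\<exists>i\<in>{1..T}. X (int i) \<omega> \<noteq> 0" and v: "\<exists>j<p. v j \<noteq> 0"
  shows "0 < (\<Sum>j<p. v j * toep p (sample_acov T X \<omega>) v j)"
proof -
  define x where "x t = (if 1 \<le> t \<and> t \<le> int T then X t \<omega> else 0)" for t
  have acov: "sample_acov T X \<omega> (nat \<bar>int j - int k\<bar>) = 1 / real T * (\<Sum>t\<in>{1..int (T + p)}. x (t - int j) * x (t - int k))"
    if "j < p" "k < p" for j k
  proof -
    have *: "sample_acov T X \<omega> (k - j) = 1 / real T * (\<Sum>t\<in>{1..int (T + p)}. x (t - int j) * x (t - int k))"
      if jk: "j \<le> k" "k < p" for j k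
    proof -
      \<comment> \<open>The substitution \<open>t = i + j\<close> matches the truncated sum of the
        sample autocovariance with the times at which both shifted observations lie between 1 and
        \<open>T\<close>.\<close>
      let ?I = "{k - j + 1..T}" and ?h = "\<lambda>i. int i + int j" and ?F = "\<lambda>t. x (t - int j) * x (t - int k)"
      have "(\<Sum>t\<in>{1..int (T + p)}. ?F t) = (\<Sum>t\<in>?h ` ?I. ?F t)"
      proof (rule sum.mono_neutral_right)
        show "?h ` ?I \<subseteq> {1..int (T + p)}" using jk by auto
        show "\<forall>t\<in>{1..int (T + p)} - ?h ` ?I. ?F t = 0"
        proof (rule ballI, rule ccontr)
          fix t assume t: "t \<in> {1..int (T + p)} - ?h ` ?I" and "?F t \<noteq> 0"
          then have r: "1 \<le> t - int j" "t - int j \<le> int T" "1 \<le> t - int k"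
            unfolding x_def by (auto split: if_splits)
          then have "t = ?h (nat (t - int j))" "nat (t - int j) \<in> ?I" using jk by auto
          then show False using t by blast
        qed
      qed simp
      also have "\<dots> = (\<Sum>i\<in>?I. ?F (?h i))" by (subst sum.reindex) (auto simp: inj_on_def)
      also have "\<dots> = (\<Sum>i\<in>?I. X (int i) \<omega> * X (int i - int (k - j)) \<omega>)"
      proof (rule sum.cong)
        fix i assume i: "i \<in> ?I"
        then have h: "?h i - int j = int i" "?h i - int k = int i - int (k - j)" using jk by simp_all
        have x: "x (int i) = X (int i) \<omega>" "x (int i - int (k - j)) = X (int i - int (k - j)) \<omega>"
          using i by (auto simp: x_def)
        show "?F (?h i) = X (int i) \<omega> * X (int i - int (k - j)) \<omega>" unfolding h x ..
      qed simp
      finally show ?thesis by (simp add: sample_acov_def)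
    qed
    show ?thesis
    proof (cases "j \<le> k")
      case True
      then have eq: "nat \<bar>int j - int k\<bar> = k - j" by simp
      show ?thesis unfolding eq by (rule *[OF True that(2)])
    next
      case False
      then have eq: "nat \<bar>int j - int k\<bar> = j - k" by simp
      show ?thesis unfolding eq using *[OF _ that(1), of k] False by (simp add: mult.commute)
    qed
  qed
  define cv where "cv t = (\<Sum>j<p. v j * x (t - int j))" for t
  have "(\<Sum>j<p. v j * toep p (sample_acov T X \<omega>) v j) =
     (\<Sum>j<p. \<Sum>k<p. 1 / real T * (\<Sum>t\<in>{1..int (T + p)}. (v j * x (t - int j)) * (v k * x (t - int k))))"
    unfolding toep_def sum_distrib_left
    by (intro sum.cong refl) (simp add: acov sum_distrib_left mult_ac)
  also have "\<dots> = 1 / real T * (\<Sum>j<p. \<Sum>t\<in>{1..int (T + p)}. \<Sum>k<p. (v j * x (t - int j)) * (v k * x (t - int k)))"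
    unfolding sum_distrib_left by (rule sum.cong[OF refl], rule sum.swap)
  also have "\<dots> = 1 / real T * (\<Sum>t\<in>{1..int (T + p)}. (cv t)\<^sup>2)"
    unfolding cv_def power2_eq_square sum_product by (subst sum.swap) (rule refl)
  finally have eq: "(\<Sum>j<p. v j * toep p (sample_acov T X \<omega>) v j) = 1 / real T * (\<Sum>t\<in>{1..int (T + p)}. (cv t)\<^sup>2)" .
  \<comment> \<open>The lowest coefficient of a product of polynomials is the product of the lowest
    coefficients: at time \<open>t0 + j0\<close> a single term of the convolution survives.\<close>
  define j0 where "j0 = (LEAST j. j < p \<and> v j \<noteq> 0)"
  define t0 where "t0 = (LEAST i. i \<in> {1..T} \<and> X (int i) \<omega> \<noteq> 0)"
  have j0: "j0 < p" "v j0 \<noteq> 0" using LeastI_ex[OF v] unfolding j0_def by auto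
  have t0: "t0 \<in> {1..T}" "X (int t0) \<omega> \<noteq> 0" 
  proof -
    have "\<exists>i. i \<in> {1..T} \<and> X (int i) \<omega> \<noteq> 0" using nz by blast
    from LeastI_ex[OF this] show "t0 \<in> {1..T}" "X (int t0) \<omega> \<noteq> 0" unfolding t0_def by blast+
  qed
  have jmin: "v j = 0" if "j < j0" for j using not_less_Least[of j "\<lambda>j. j < p \<and> v j \<noteq> 0"] that j0 unfolding j0_def by auto
  have tmin: "x t = 0" if "t < int t0" for t
  proof (rule ccontr)
    assume "x t \<noteq> 0"
    then have t: "1 \<le> t" "t \<le> int T" "X t \<omega> \<noteq> 0" by (auto simp: x_def split: if_splits)
    then have "nat t \<in> {1..T} \<and> X (int (nat t)) \<omega> \<noteq> 0" by auto
    then have "t0 \<le> nat t" unfolding t0_def by (rule Least_le)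
    then show False using that t by linarith
  qed
  have "cv (int t0 + int j0) = (\<Sum>j<p. if j = j0 then v j0 * x (int t0) else 0)"
    unfolding cv_def
  proof (rule sum.cong[OF refl])
    fix j assume "j \<in> {..<p}"
    show "v j * x (int t0 + int j0 - int j) = (if j = j0 then v j0 * x (int t0) else 0)"
      using jmin[of j] tmin[of "int t0 + int j0 - int j"] by (cases "j < j0"; cases "j = j0") auto
  qed
  also have "\<dots> = v j0 * X (int t0) \<omega>" using j0 t0 by (simp add: x_def)
  finally have "cv (int t0 + int j0) \<noteq> 0" using j0 t0 by simp
  then have "0 < (\<Sum>t\<in>{1..int (T + p)}. (cv t)\<^sup>2)"
    by (intro sum_pos2[of _ "int t0 + int j0"]) (use t0 j0 in auto)
  then show ?thesis unfolding eq using T by simp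
qed

lemma sample_acov_cong:
  "(\<And>i. i \<in> {1..T} \<Longrightarrow> X (int i) \<omega> = 0) \<Longrightarrow> sample_acov T X \<omega> k = 0"
  by (simp add: sample_acov_def)

text \<open>The sample space splits into the event that all observations vanish, where the estimator
  is 0, and its complement, where the determinant is nonzero and Cramer's rule applies.\<close>

lemma yule_walker_measurable:
  fixes X :: "int \<Rightarrow> 'a \<Rightarrow> real"
  assumes [measurable]: "\<And>i. X i \<in> borel_measurable M" and T: "T \<ge> 1" and j: "j \<in> {1..p}"
  shows "yule_walker T p X j \<in> borel_measurable M"
proof -
  define Zr where "Zr = {\<omega>\<in>space M. \<forall>i\<in>{1..T}. X (int i) \<omega> = 0}"
  have Zr[measurable]: "Zr \<in> sets M" unfolding Zr_def by measurable
  have m: "(\<lambda>\<omega>. sample_acov T X \<omega> k) \<in> borel_measurable M" for k unfolding sample_acov_def by measurable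
  let ?f = "\<lambda>\<omega>. (adj_mat (toeplitz p (sample_acov T X \<omega>)) *\<^sub>v lag_vec p (sample_acov T X \<omega>)) $ (j - 1) /
     Determinant.det (toeplitz p (sample_acov T X \<omega>))"
  have f: "?f \<in> borel_measurable M"
    using adj_mult_measurable[OF m, of "j - 1" p] j by (intro borel_measurable_divide) auto
  have "yule_walker T p X j \<omega> = (if \<omega> \<in> Zr then 0 else ?f \<omega>)" if \<omega>: "\<omega> \<in> space M" for \<omega>
  proof (cases "\<omega> \<in> Zr")
    case True
    then have "sample_acov T X \<omega> k = 0" for k by (intro sample_acov_cong) (auto simp: Zr_def)
    then show ?thesis using True j by (simp add: yule_walker_zero)
  next
    case False
    then have nz: "\<exists>i\<in>{1..T}. X (int i) \<omega> \<noteq> 0" using \<omega> by (auto simp: Zr_def)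
    have "Determinant.det (toeplitz p (sample_acov T X \<omega>)) \<noteq> 0"
      by (rule det_nonzero_of_positive) (rule sample_acov_positive[where X = X and T = T and \<omega> = \<omega>, OF T nz])
    from yule_walker_cramer(1)[OF this j] False show ?thesis by simp
  qed
  then show ?thesis
    by (subst measurable_cong) (use f in measurable)
qed

subsection \<open>Linearisation of the Yule-Walker equations\<close>

lemma mult_inverse_eq:
  fixes A B :: "real mat"
  assumes "A \<in> carrier_mat n n" "B \<in> carrier_mat n n" "A * B = 1\<^sub>m n" "v \<in> carrier_vec n"
  shows "A *\<^sub>v (B *\<^sub>v v) = v"
  using assms assoc_mult_mat_vec[of A n n B n v] by simp

text \<open>Differentiating \<Sigma> \<alpha> = \<gamma> in the \<open>k\<close>-th autocovariance
  gives this equation for the column. One formula covers all three cases of the definition: the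
  lag-0 matrix is the identity, and no entry of a matrix of size \<open>p\<close> lies at lag
  \<open>p\<close>.\<close>

lemma b_col_equation:
  assumes d: "Determinant.det (toeplitz p s) \<noteq> 0" and k: "k \<le> p" and p: "p \<ge> 1"
    and \<alpha>: "\<And>j. j < p \<Longrightarrow> toep p s \<alpha> j = s (j + 1)" and j: "j < p"
  shows "toep p s (\<lambda>i. b_col p s k $ i) j =
    (if j + 1 = k then 1 else 0) - (\<Sum>i<p. if nat \<bar>int j - int i\<bar> = k then \<alpha> i else 0)"
proof -
  let ?A = "toeplitz p s" and ?g = "lag_vec p s"
  define a where "a = Matrix.vec p \<alpha>"
  have a: "a \<in> carrier_vec p" by (simp add: a_def)
  obtain B where B: "B \<in> carrier_mat p p" "?A * B = 1\<^sub>m p" "B * ?A = 1\<^sub>m p" "mat_inverse ?A = Some B"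
    using inverse_mat_exists[OF toeplitz_carrier(1) d] by blast
  have Aa: "?A *\<^sub>v a = ?g"
  proof (rule eq_vecI)
    fix i assume "i < dim_vec ?g"
    then have i: "i < p" by (simp add: lag_vec_def)
    have "(?A *\<^sub>v a) $ i = toep p s (\<lambda>i. a $ i) i" by (rule toeplitz_mult_vec[OF a i])
    also have "\<dots> = toep p s \<alpha> i" by (simp add: toep_def a_def)
    finally show "(?A *\<^sub>v a) $ i = ?g $ i" using \<alpha>[OF i] i by (simp add: lag_vec_def)
  qed (simp add: lag_vec_def)
  have Bg: "B *\<^sub>v ?g = a"
    unfolding Aa[symmetric] by (rule mult_inverse_eq[OF B(1) toeplitz_carrier(1) B(3) a])
  have sum0: "(\<Sum>i<p. if nat \<bar>int j - int i\<bar> = 0 then \<alpha> i else 0) = \<alpha> j"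
  proof -
    have "(\<Sum>i<p. if nat \<bar>int j - int i\<bar> = 0 then \<alpha> i else 0) = (\<Sum>i<p. if i = j then \<alpha> i else 0)"
      by (rule sum.cong) auto
    then show ?thesis using j by simp
  qed
  have diag: "(diag_mat_lag p k *\<^sub>v a) $ i = (\<Sum>i'<p. if nat \<bar>int i - int i'\<bar> = k then \<alpha> i' else 0)" if "i < p" for i
    using that by (auto simp: diag_mat_lag_def a_def scalar_prod_def lessThan_atLeast0 intro!: sum.cong)
  have dc: "diag_mat_lag p k \<in> carrier_mat p p" by (simp add: diag_mat_lag_def)
  define x where "x = (if k = 0 then - a else if k < p then unit_vec p (k - 1) - diag_mat_lag p k *\<^sub>v a else unit_vec p (p - 1))"
  have x: "x \<in> carrier_vec p" using a dc by (auto simp: x_def)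
  have "b_col p s k = B *\<^sub>v x"
  proof -
    have "(B * B) *\<^sub>v ?g = B *\<^sub>v a" using assoc_mult_mat_vec[of B p p B p ?g] B Bg by simp
    moreover have "(B * diag_mat_lag p k * B) *\<^sub>v ?g = B *\<^sub>v (diag_mat_lag p k *\<^sub>v a)"
      using assoc_mult_mat_vec[of "B * diag_mat_lag p k" p p B p ?g] assoc_mult_mat_vec[of B p p "diag_mat_lag p k" p a] B Bg dc a by simp
    moreover have "- (B *\<^sub>v a) = B *\<^sub>v (- a)"
      using B(1) a by (intro eq_vecI) (auto simp: scalar_prod_def sum_negf)
    moreover have "B *\<^sub>v u - B *\<^sub>v v = B *\<^sub>v (u - v)" if "u \<in> carrier_vec p" "v \<in> carrier_vec p" for u v
      using mult_minus_distrib_mat_vec[OF B(1) that] by simp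
    ultimately show ?thesis
      using dc a by (auto simp: b_col_def Let_def B(4) x_def)
  qed
  then have "?A *\<^sub>v b_col p s k = x" using mult_inverse_eq[OF toeplitz_carrier(1) B(1,2) x] by simp
  moreover have "b_col p s k \<in> carrier_vec p" using \<open>b_col p s k = B *\<^sub>v x\<close> B(1) x by simp
  ultimately have "toep p s (\<lambda>i. b_col p s k $ i) j = x $ j" using toeplitz_mult_vec[of "b_col p s k" p j s] j by simp
  also have "x $ j = (if j + 1 = k then 1 else 0) - (\<Sum>i<p. if nat \<bar>int j - int i\<bar> = k then \<alpha> i else 0)"
  proof (cases "k = 0")
    case True
    then show ?thesis using j a sum0 by (simp add: x_def a_def)
  next
    case k0: False
    show ?thesis
    proof (cases "k < p")
      case True
      have "x $ j = unit_vec p (k - 1) $ j - (diag_mat_lag p k *\<^sub>v a) $ j" using True k0 j dc by (simp add: x_def)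
      then show ?thesis using diag[OF j] j k0 True by (auto simp: unit_vec_def)
    next
      case False
      then have kp: "k = p" using k by simp
      have "(\<Sum>i<p. if nat \<bar>int j - int i\<bar> = k then \<alpha> i else 0) = 0"
        using j kp by (intro sum.neutral) auto
      then show ?thesis using kp k0 j by (auto simp: x_def unit_vec_def)
    qed
  qed
  finally show ?thesis .
qed

lemma ar_coeffs_toep:
  assumes "ar_coeffs p s a" "j < p"
  shows "toep p s (\<lambda>i. a (i + 1)) j = s (j + 1)"
proof -
  have "s (j + 1) = (\<Sum>i=1..p. a i * s (nat \<bar>int (j + 1) - int i\<bar>))"
    using assms by (auto simp: ar_coeffs_def)
  also have "\<dots> = (\<Sum>i<p. a (i + 1) * s (nat \<bar>int (j + 1) - int (i + 1)\<bar>))"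
    by (rule sum.reindex_bij_witness[where i = "\<lambda>i. i + 1" and j = "\<lambda>i. i - 1"]) auto
  finally show ?thesis by (simp add: toep_def mult.commute)
qed

text \<open>Coercivity gives \<open>c\<close> times the norm of the coefficients at most the norm of
  the right-hand side, which is at most \<open>K * S\<close>. The next constant bounds the columns
  \<open>b_col\<close> in the same way.\<close>

definition ar_bound :: "nat \<Rightarrow> real \<Rightarrow> real \<Rightarrow> real" where
  "ar_bound K c S = real K * S / c"

definition b_bound :: "nat \<Rightarrow> real \<Rightarrow> real \<Rightarrow> real" where
  "b_bound K c S = real K * (1 + real K * ar_bound K c S) / c"

context
  fixes p K :: nat and c S :: real and s :: "nat \<Rightarrow> real" and \<alpha> :: "nat \<Rightarrow> real"
  assumes p: "p \<ge> 1" "p \<le> K" and c: "c > 0" and co: "coercive p c s"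
    and S: "\<And>k. k \<le> p \<Longrightarrow> \<bar>s k\<bar> \<le> S"
    and \<alpha>: "\<And>j. j < p \<Longrightarrow> toep p s \<alpha> j = s (j + 1)"
begin

lemma S0: "S \<ge> 0" using S[of 0] by simp

lemma alpha_bound: "L2_set \<alpha> {..<p} \<le> ar_bound K c S"
proof -
  have "c * L2_set \<alpha> {..<p} \<le> L2_set (toep p s \<alpha>) {..<p}" by (rule coercive_norm[OF co])
  also have "\<dots> \<le> real p * S" by (rule L2_set_le_const) (use \<alpha> S in auto)
  also have "\<dots> \<le> real K * S" using p S0 by (intro mult_right_mono) auto
  finally show ?thesis using c by (simp add: ar_bound_def pos_le_divide_eq mult.commute)
qed

lemma b_coeff_bound:
  assumes k: "k \<le> p" and j: "j \<in> {1..p}"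
  shows "\<bar>b_coeff p s j k\<bar> \<le> b_bound K c S"
proof -
  let ?\<beta> = "\<lambda>i. b_col p s k $ i"
  have A0: "0 \<le> ar_bound K c S" using c S0 by (simp add: ar_bound_def)
  have "j - 1 < p" using j by auto
  have "\<bar>b_coeff p s j k\<bar> \<le> L2_set ?\<beta> {..<p}"
    unfolding b_coeff_def by (rule abs_le_L2_set) fact
  moreover have "c * L2_set ?\<beta> {..<p} \<le> real K * (1 + real K * ar_bound K c S)"
  proof -
    have "c * L2_set ?\<beta> {..<p} \<le> L2_set (toep p s ?\<beta>) {..<p}" by (rule coercive_norm[OF co])
    also have "\<dots> \<le> real p * (1 + real p * ar_bound K c S)"
    proof (rule L2_set_le_const)
      fix i assume i: "i < p"
      have "\<bar>\<Sum>i'<p. if nat \<bar>int i - int i'\<bar> = k then \<alpha> i' else 0\<bar> \<le> (\<Sum>i'<p. ar_bound K c S)"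
        by (intro order_trans[OF sum_abs] sum_mono)
          (use abs_le_L2_set[of _ p \<alpha>] alpha_bound A0 in \<open>auto intro: order_trans\<close>)
      then show "\<bar>toep p s ?\<beta> i\<bar> \<le> 1 + real p * ar_bound K c S"
        using b_col_equation[OF coercive_det_nonzero[OF co c] k p(1) \<alpha> i]
        by (simp split: if_splits)
    qed
    also have "\<dots> \<le> real K * (1 + real K * ar_bound K c S)"
      using p A0 by (intro mult_mono add_left_mono mult_right_mono) auto
    finally show ?thesis .
  qed
  ultimately show ?thesis using c unfolding b_bound_def
    by (simp add: pos_le_divide_eq mult.commute) (meson less_imp_le mult_left_mono order_trans)
qed

text \<open>The linear term solves the unperturbed system, its right-hand side being the first-order
  change of \<gamma> minus that of \<Sigma> applied to \<alpha>.\<close>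

lemma linearisation_equation:
  fixes r :: "nat \<Rightarrow> real"
  assumes j: "j < p"
  shows "toep p s (\<lambda>i. \<Sum>k\<le>p. b_coeff p s (i + 1) k * r k) j = r (j + 1) - toep p r \<alpha> j"
proof -
  have "toep p s (\<lambda>i. \<Sum>k\<le>p. b_coeff p s (i + 1) k * r k) j = (\<Sum>k\<le>p. r k * toep p s (\<lambda>i. b_col p s k $ i) j)"
    unfolding toep_sum toep_scale[symmetric] by (simp add: b_coeff_def mult.commute)
  also have "\<dots> = (\<Sum>k\<le>p. r k * ((if j + 1 = k then 1 else 0) - (\<Sum>i<p. if nat \<bar>int j - int i\<bar> = k then \<alpha> i else 0)))"
    by (intro sum.cong) (auto simp: b_col_equation[OF coercive_det_nonzero[OF co c] _ p(1) \<alpha> j])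
  also have "\<dots> = (\<Sum>k\<le>p. if k = j + 1 then r k else 0) - (\<Sum>k\<le>p. \<Sum>i<p. if k = nat \<bar>int j - int i\<bar> then r k * \<alpha> i else 0)"
    by (simp add: right_diff_distrib sum_subtractf sum_distrib_left if_distrib[of "\<lambda>x. _ * x"] eq_commute[of _ "nat _"] eq_commute[of "Suc j"] cong: if_cong)
  also have "(\<Sum>k\<le>p. if k = j + 1 then r k else 0) = r (j + 1)" using j by simp
  also have "(\<Sum>k\<le>p. \<Sum>i<p. if k = nat \<bar>int j - int i\<bar> then r k * \<alpha> i else 0) = (\<Sum>i<p. \<Sum>k\<le>p. if k = nat \<bar>int j - int i\<bar> then r k * \<alpha> i else 0)"
    by (rule sum.swap)
  also have "\<dots> = toep p r \<alpha> j"
    unfolding toep_def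
  proof (rule sum.cong[OF refl])
    fix i assume "i \<in> {..<p}"
    then have "nat \<bar>int j - int i\<bar> \<le> p" using j by auto
    then show "(\<Sum>k\<le>p. if k = nat \<bar>int j - int i\<bar> then r k * \<alpha> i else 0) = r (nat \<bar>int j - int i\<bar>) * \<alpha> i" by simp
  qed
  finally show ?thesis .
qed

text \<open>The error \<open>u = t (y - \<alpha>)\<close> and the linear term \<open>w\<close> are related by \<open>\<Sigma> (u - w) = - R u / t\<close> with \<open>R = (r\<^sub>|\<^sub>j\<^sub>-\<^sub>k\<^sub>|)\<close>.\<close>

lemma linearisation:
  fixes r y :: "nat \<Rightarrow> real" and t R :: real
  assumes y: "\<And>j. j < p \<Longrightarrow> toep p (\<lambda>k. s k + r k / t) y j = s (j + 1) + r (j + 1) / t"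
    and t: "t > 0" and R: "\<And>k. k \<le> p \<Longrightarrow> \<bar>r k\<bar> \<le> R" and small: "(real K)\<^sup>2 * R / t \<le> c / 2" and j: "j < p"
  shows "\<bar>t * (y j - \<alpha> j) - (\<Sum>k\<le>p. b_coeff p s (j + 1) k * r k)\<bar> \<le>
     (real K)\<^sup>2 / c * (2 / c) * (real K + (real K)\<^sup>2 * ar_bound K c S) * (R\<^sup>2 / t)"
proof -
  have R0: "R \<ge> 0" using R[of 0] by simp
  have A0: "0 \<le> ar_bound K c S" using c S0 by (simp add: ar_bound_def)
  define u where "u i = t * (y i - \<alpha> i)" for i
  define w where "w i = (\<Sum>k\<le>p. b_coeff p s (i + 1) k * r k)" for i
  define \<rho> where "\<rho> i = r (i + 1) - toep p r \<alpha> i" for i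
  \<comment> \<open>The scaled error \<open>u\<close> solves the perturbed system with the same
    right-hand side \<open>\<rho>\<close> for which \<open>w\<close> solves the unperturbed
    one.\<close>
  have u: "toep p s u i + (1 / t) * toep p r u i = \<rho> i" if i: "i < p" for i
  proof -
    have "toep p s u i + (1 / t) * toep p r u i = toep p (\<lambda>k. s k + (1 / t) * r k) u i"
      by (rule toep_linear_symbol[symmetric])
    also have "\<dots> = t * (toep p (\<lambda>k. s k + (1 / t) * r k) y i - toep p (\<lambda>k. s k + (1 / t) * r k) \<alpha> i)"
      unfolding u_def toep_scale toep_diff ..
    also have "toep p (\<lambda>k. s k + (1 / t) * r k) y i = s (i + 1) + r (i + 1) / t" using y[OF i] by simp
    also have "toep p (\<lambda>k. s k + (1 / t) * r k) \<alpha> i = s (i + 1) + (1 / t) * toep p r \<alpha> i"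
      unfolding toep_linear_symbol \<alpha>[OF i] ..
    also have "t * (s (i + 1) + r (i + 1) / t - (s (i + 1) + (1 / t) * toep p r \<alpha> i)) = \<rho> i"
      using t by (simp add: \<rho>_def field_simps)
    finally show ?thesis .
  qed
  have toep_r: "L2_set (toep p r v) {..<p} \<le> (real K)\<^sup>2 * R * L2_set v {..<p}" for v
  proof -
    have "L2_set (toep p r v) {..<p} \<le> real p * (R * (real p * L2_set v {..<p}))" by (rule L2_toep_le) (use R in auto)
    also have "\<dots> \<le> real K * (R * (real K * L2_set v {..<p}))"
      using p R0 by (intro mult_mono mult_left_mono mult_right_mono mult_nonneg_nonneg L2_set_nonneg) auto
    finally show ?thesis by (simp add: power2_eq_square mult_ac)
  qed
  have \<rho>: "L2_set \<rho> {..<p} \<le> (real K + (real K)\<^sup>2 * ar_bound K c S) * R"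
  proof -
    have "L2_set \<rho> {..<p} \<le> L2_set (\<lambda>i. r (i + 1)) {..<p} + L2_set (\<lambda>i. - toep p r \<alpha> i) {..<p}"
      unfolding \<rho>_def diff_conv_add_uminus by (rule L2_set_triangle_ineq)
    also have "L2_set (\<lambda>i. - toep p r \<alpha> i) {..<p} = L2_set (toep p r \<alpha>) {..<p}" by (simp add: L2_set_def)
    also have "L2_set (toep p r \<alpha>) {..<p} \<le> (real K)\<^sup>2 * R * ar_bound K c S"
      by (rule order_trans[OF toep_r mult_left_mono[OF alpha_bound]]) (use R0 in auto)
    also have "L2_set (\<lambda>i. r (i + 1)) {..<p} \<le> real p * R" by (rule L2_set_le_const) (use R in auto)
    also have "real p * R \<le> real K * R" using p R0 by (intro mult_right_mono) auto
    finally show ?thesis by (simp add: algebra_simps)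
  qed
  have nu: "L2_set u {..<p} \<le> 2 / c * L2_set \<rho> {..<p}"
  proof -
    have "c * L2_set u {..<p} \<le> L2_set (toep p s u) {..<p}" by (rule coercive_norm[OF co])
    also have "\<dots> = L2_set (\<lambda>i. \<rho> i + (- (1 / t)) * toep p r u i) {..<p}"
      by (rule L2_set_cong) (use u in \<open>auto simp: algebra_simps\<close>)
    also have "\<dots> \<le> L2_set \<rho> {..<p} + L2_set (\<lambda>i. (- (1 / t)) * toep p r u i) {..<p}"
      by (rule L2_set_triangle_ineq)
    also have "L2_set (\<lambda>i. (- (1 / t)) * toep p r u i) {..<p} = 1 / t * L2_set (toep p r u) {..<p}"
      using L2_set_left_distrib[of "1 / t" "toep p r u" "{..<p}"] t L2_set_right_distrib[of "1 / t" "toep p r u" "{..<p}"] by (simp add: L2_set_def)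
    also have "1 / t * L2_set (toep p r u) {..<p} \<le> 1 / t * ((real K)\<^sup>2 * R * L2_set u {..<p})"
      using t by (intro mult_left_mono toep_r) auto
    also have "\<dots> = (real K)\<^sup>2 * R / t * L2_set u {..<p}" by simp
    also have "\<dots> \<le> c / 2 * L2_set u {..<p}" by (intro mult_right_mono small L2_set_nonneg)
    \<comment> \<open>By \<open>small\<close> the perturbation uses up at most half of the
      coercivity and is absorbed on the left.\<close>
    finally have "c / 2 * L2_set u {..<p} \<le> L2_set \<rho> {..<p}" by simp
    then show ?thesis using c by (simp add: field_simps)
  qed
  have "c * L2_set (\<lambda>i. u i - w i) {..<p} \<le> L2_set (toep p s (\<lambda>i. u i - w i)) {..<p}" by (rule coercive_norm[OF co])
  also have "\<dots> = L2_set (\<lambda>i. (- (1 / t)) * toep p r u i) {..<p}"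
  proof (rule L2_set_cong)
    fix i assume "i \<in> {..<p}"
    then show "toep p s (\<lambda>i. u i - w i) i = (- (1 / t)) * toep p r u i"
      unfolding toep_diff using u[of i] linearisation_equation[of i r] by (simp add: w_def[abs_def] \<rho>_def)
  qed simp
  also have "\<dots> = 1 / t * L2_set (toep p r u) {..<p}"
    using L2_set_right_distrib[of "1 / t" "toep p r u" "{..<p}"] t by (simp add: L2_set_def)
  also have "\<dots> \<le> 1 / t * ((real K)\<^sup>2 * R * (2 / c * ((real K + (real K)\<^sup>2 * ar_bound K c S) * R)))"
    by (intro mult_left_mono order_trans[OF toep_r] order_trans[OF nu] \<rho>) (use t R0 c in auto)
  finally have "c * L2_set (\<lambda>i. u i - w i) {..<p} \<le> c * ((real K)\<^sup>2 / c * (2 / c) * (real K + (real K)\<^sup>2 * ar_bound K c S) * (R\<^sup>2 / t))"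
    using c by (simp add: power2_eq_square mult_ac)
  then have "L2_set (\<lambda>i. u i - w i) {..<p} \<le> (real K)\<^sup>2 / c * (2 / c) * (real K + (real K)\<^sup>2 * ar_bound K c S) * (R\<^sup>2 / t)"
    using c by (simp only: mult_le_cancel_left_pos)
  then show ?thesis using abs_le_L2_set[OF j, of "\<lambda>i. u i - w i"] by (simp add: u_def w_def)
qed

end

subsection \<open>The Yule-Walker error for one sample size\<close>

lemma (in prob_space) Markov_Lp_le_1:
  assumes f: "Lp_le M 1 f K" and R: "R > 0"
  shows "prob {\<omega>\<in>space M. R < \<bar>f \<omega>\<bar>} \<le> K / R"
proof -
  have [measurable]: "f \<in> borel_measurable M" using f by (rule Lp_le_measurable)
  have i: "integrable M (\<lambda>\<omega>. \<bar>f \<omega>\<bar>)" and le: "(\<integral>\<omega>. \<bar>f \<omega>\<bar> \<partial>M) \<le> K"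
    using f by (auto simp: Lp_le_def)
  have "prob {\<omega>\<in>space M. R < \<bar>f \<omega>\<bar>} \<le> prob {\<omega>\<in>space M. R \<le> \<bar>f \<omega>\<bar>}"
    by (intro finite_measure_mono) auto
  also have "\<dots> \<le> (\<integral>\<omega>. \<bar>f \<omega>\<bar> \<partial>M) / R"
    by (rule integral_Markov_inequality_measure[where A = "{}"]) (use i R in auto)
  also have "\<dots> \<le> K / R" using le R by (intro divide_right_mono) auto
  finally show ?thesis .
qed

text \<open>\<open>mom_bound\<close> and \<open>dec_bound\<close> are the constants of
  \<open>weakly_dependent_products\<close> for coefficients bounded by \<open>B\<close>,
  \<open>var_bound\<close> is the variance constant of \<open>U_square_le\<close>, and
  \<open>lin_bound\<close> the remainder constant of \<open>linearisation\<close>. None involves the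
  sample size.\<close>

definition mom_bound :: "nat \<Rightarrow> real \<Rightarrow> real \<Rightarrow> real" where
  "mom_bound K B C = (1 + real K) * (B * (2 * C * C))"

definition dec_bound :: "nat \<Rightarrow> real \<Rightarrow> real \<Rightarrow> real \<Rightarrow> real" where
  "dec_bound K B C D = (1 + real K) * (B * (2 * C * D * (1 + real K)\<^sup>2))"

definition var_bound :: "nat \<Rightarrow> real \<Rightarrow> real \<Rightarrow> real \<Rightarrow> real" where
  "var_bound K B C D = 4 * mom_bound K B C * dec_bound K B C D"

definition lin_bound :: "nat \<Rightarrow> real \<Rightarrow> real \<Rightarrow> real" where
  "lin_bound K c S = (real K)\<^sup>2 / c * (2 / c) * (real K + (real K)\<^sup>2 * ar_bound K c S)"

locale yule_walker_setting = prob_space M for M :: "'a measure" +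
  fixes X e :: "int \<Rightarrow> 'a \<Rightarrow> real" and g :: "int \<Rightarrow> (nat \<Rightarrow> real) \<Rightarrow> real" and a :: "nat \<Rightarrow> real"
    and p K T :: nat and c C D :: real
  assumes T: "T \<ge> 1" and p: "p \<ge> 1" "p \<le> K" and c: "c > 0"
    and stat: "weakly_stationary M X" and rep: "causal_representation M X e g"
    and srd: "short_range (distr M seqs (\<lambda>\<omega> j. e j \<omega>)) (recentre g) C D"
    and ar: "ar_coeffs p (acov M X) a" and co: "coercive p c (acov M X)"
begin

section \<open>Transfer between the given space and the law of the innovations\<close>

definition E where "E = (\<lambda>\<omega> j. e j \<omega>)"
definition P where "P = distr M seqs E"
definition Xh where "Xh = recentre g"
definition \<sigma> where "\<sigma> = acov M X"

sublocale srd: short_range P Xh C D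
  using srd by (simp add: P_def E_def Xh_def)

lemma E_measurable[measurable]: "E \<in> measurable M seqs"
proof -
  have "e j \<in> borel_measurable M" for j
    using rep by (auto simp: causal_representation_def indep_vars_def2)
  then show ?thesis unfolding E_def by (intro measurable_PiM_single') auto
qed

lemma sets_P_seqs[measurable_cong]: "sets P = sets seqs" by (simp add: P_def)

lemma E_measurable_P[measurable]: "E \<in> measurable M P" by measurable

lemma X_eq: "\<omega> \<in> space M \<Longrightarrow> X i \<omega> = Xh i (E \<omega>)"
  using rep by (auto simp: causal_representation_def Xh_def recentre_def E_def)

lemma X_measurable[measurable]: "X i \<in> borel_measurable M"
  by (subst measurable_cong[OF X_eq]) auto

lemma integral_P:
  fixes f :: "_ \<Rightarrow> 'b::{banach, second_countable_topology}"
  assumes "f \<in> borel_measurable P"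
  shows "(\<integral>x. f x \<partial>P) = (\<integral>\<omega>. f (E \<omega>) \<partial>M)"
proof -
  have "f \<in> borel_measurable seqs" using assms by simp
  then show ?thesis unfolding P_def by (intro integral_distr) auto
qed

lemma Lp_le_P: "Lp_le P n f B \<Longrightarrow> Lp_le M n (\<lambda>\<omega>. f (E \<omega>)) B"
proof -
  assume L: "Lp_le P n f B"
  then have "f \<in> borel_measurable P" by (rule Lp_le_measurable)
  then have "f \<in> borel_measurable seqs" by simp
  then show ?thesis using Lp_le_distr[OF E_measurable, of f n B] L by (simp add: P_def)
qed

lemma sigma_eq: "(\<integral>x. Xh i x * Xh (i - int k) x \<partial>P) = \<sigma> k"
proof -
  have "(\<integral>x. Xh i x * Xh (i - int k) x \<partial>P) = (\<integral>\<omega>. Xh i (E \<omega>) * Xh (i - int k) (E \<omega>) \<partial>M)"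
    by (rule integral_P) measurable
  also have "\<dots> = (\<integral>\<omega>. X i \<omega> * X (i - int k) \<omega> \<partial>M)"
    by (rule Bochner_Integration.integral_cong) (auto simp: X_eq)
  also have "\<dots> = (\<integral>\<omega>. X 0 \<omega> * X (0 - int k) \<omega> \<partial>M)"
    using stat unfolding weakly_stationary_def by blast
  finally show ?thesis by (simp add: \<sigma>_def acov_def)
qed

lemma sigma_bound: "\<bar>\<sigma> k\<bar> \<le> C * C"
  using srd.product_integral(2)[of 0 "0 - int k"] sigma_eq[of 0 k] by simp

text \<open>One statistic with free coefficients: unit coefficients give the full-range
  autocovariance errors, \<open>b_coeff\<close> gives the linear terms, and sums give their
  combinations, so a single limit theorem serves all.\<close>

definition L :: "(nat \<Rightarrow> real) \<Rightarrow> 'a \<Rightarrow> real" where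
  "L \<beta> \<omega> = 1 / sqrt (real T) * (\<Sum>i=1..T. \<Sum>k\<le>p. \<beta> k * (X (int i) \<omega> * X (int i - int k) \<omega> - \<sigma> k))"

lemma L_measurable[measurable]: "L \<beta> \<in> borel_measurable M"
  unfolding L_def by measurable

lemma L_sum: "L (\<lambda>k. \<Sum>j\<in>J. t j * \<beta> j k) \<omega> = (\<Sum>j\<in>J. t j * L (\<beta> j) \<omega>)"
proof -
  have "(\<Sum>j\<in>J. t j * L (\<beta> j) \<omega>) = 1 / sqrt (real T) *
      (\<Sum>j\<in>J. \<Sum>i=1..T. \<Sum>k\<le>p. t j * \<beta> j k * (X (int i) \<omega> * X (int i - int k) \<omega> - \<sigma> k))"
    by (simp add: L_def sum_distrib_left mult_ac)
  also have "(\<Sum>j\<in>J. \<Sum>i=1..T. \<Sum>k\<le>p. t j * \<beta> j k * (X (int i) \<omega> * X (int i - int k) \<omega> - \<sigma> k)) =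
      (\<Sum>i=1..T. \<Sum>k\<le>p. \<Sum>j\<in>J. t j * \<beta> j k * (X (int i) \<omega> * X (int i - int k) \<omega> - \<sigma> k))"
    by (subst sum.swap, rule sum.cong[OF refl], rule sum.swap)
  finally show ?thesis by (simp add: L_def sum_distrib_right)
qed

lemma weakly_dependent_L:
  assumes "\<And>k. k \<le> p \<Longrightarrow> \<bar>\<beta> k\<bar> \<le> B"
  shows "weakly_dependent P (\<lambda>i x. \<Sum>k\<le>p. \<beta> k * (Xh i x * Xh (i - int k) x - \<sigma> k)) (mom_bound K B C) (dec_bound K B C D)"
  unfolding mom_bound_def dec_bound_def
  by (rule srd.weakly_dependent_products) (use sigma_eq p assms in auto)

lemma L_eq_U:
  assumes "\<And>k. k \<le> p \<Longrightarrow> \<bar>\<beta> k\<bar> \<le> B" "\<omega> \<in> space M"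
  shows "L \<beta> \<omega> = weakly_dependent.U (\<lambda>i x. \<Sum>k\<le>p. \<beta> k * (Xh i x * Xh (i - int k) x - \<sigma> k)) {1..int T} (E \<omega>) / sqrt (real T)"
proof -
  interpret W: weakly_dependent P "\<lambda>i x. \<Sum>k\<le>p. \<beta> k * (Xh i x * Xh (i - int k) x - \<sigma> k)" "mom_bound K B C" "dec_bound K B C D"
    by (rule weakly_dependent_L[OF assms(1)])
  have "(\<Sum>i=1..T. \<Sum>k\<le>p. \<beta> k * (X (int i) \<omega> * X (int i - int k) \<omega> - \<sigma> k)) =
     (\<Sum>i\<in>{1..int T}. \<Sum>k\<le>p. \<beta> k * (X i \<omega> * X (i - int k) \<omega> - \<sigma> k))"
    by (rule sum.reindex_bij_witness[where i = nat and j = int]) auto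
  then show ?thesis using assms(2) by (simp add: L_def W.U_def X_eq)
qed

text \<open>The Gaussian term is real, so the cosine estimate is the real part of
  \<open>clt\<close>, carried over from the law of the noise.\<close>

lemma L_clt:
  assumes \<beta>: "\<And>k. k \<le> p \<Longrightarrow> \<bar>\<beta> k\<bar> \<le> B"
  shows "\<bar>(\<integral>\<omega>. cos (L \<beta> \<omega>) \<partial>M) - exp (- (\<integral>\<omega>. (L \<beta> \<omega>)\<^sup>2 \<partial>M) / 2)\<bar> \<le> clt_err (mom_bound K B C) (dec_bound K B C D) (real T)"
    and "Lp_le M 2 (L \<beta>) (sqrt (var_bound K B C D))"
proof -
  let ?Y = "\<lambda>i x. \<Sum>k\<le>p. \<beta> k * (Xh i x * Xh (i - int k) x - \<sigma> k)"
  interpret W: weakly_dependent P ?Y "mom_bound K B C" "dec_bound K B C D"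
    by (rule weakly_dependent_L[OF \<beta>])
  let ?u = "\<lambda>x. W.U {1..int T} x / sqrt (real T)"
  note Lu = L_eq_U[OF \<beta>]
  have sq: "(\<integral>\<omega>. (L \<beta> \<omega>)\<^sup>2 \<partial>M) = (\<integral>x. (W.U {1..int T} x)\<^sup>2 \<partial>P) / real T"
  proof -
    have "(\<integral>\<omega>. (L \<beta> \<omega>)\<^sup>2 \<partial>M) = (\<integral>\<omega>. (?u (E \<omega>))\<^sup>2 \<partial>M)"
      by (rule Bochner_Integration.integral_cong[OF refl]) (simp only: Lu)
    also have "\<dots> = (\<integral>x. (?u x)\<^sup>2 \<partial>P)" by (rule integral_P[symmetric]) measurable
    finally show ?thesis by (simp add: power_divide)
  qed
  have i: "integrable P (\<lambda>x. iexp (?u x))" by (rule srd.integrable_const_bound[where B = 1]) auto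
  have "(\<integral>\<omega>. cos (L \<beta> \<omega>) \<partial>M) = (\<integral>\<omega>. cos (?u (E \<omega>)) \<partial>M)"
    by (rule Bochner_Integration.integral_cong[OF refl]) (simp only: Lu)
  also have "\<dots> = (\<integral>x. cos (?u x) \<partial>P)" by (rule integral_P[symmetric]) measurable
  also have "\<dots> = (\<integral>x. Re (iexp (?u x)) \<partial>P)" by (simp add: cis_conv_exp[symmetric] del: of_real_divide)
  also have "\<dots> = Re (\<integral>x. iexp (?u x) \<partial>P)" using i by (rule integral_Re)
  finally have A: "(\<integral>\<omega>. cos (L \<beta> \<omega>) \<partial>M) - exp (- (\<integral>\<omega>. (L \<beta> \<omega>)\<^sup>2 \<partial>M) / 2) =
     Re ((\<integral>x. iexp (?u x) \<partial>P) - exp (- ((\<integral>x. (W.U {1..int T} x)\<^sup>2 \<partial>P) / (2 * real T))))"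
    unfolding sq by (simp add: mult.commute)
  show "\<bar>(\<integral>\<omega>. cos (L \<beta> \<omega>) \<partial>M) - exp (- (\<integral>\<omega>. (L \<beta> \<omega>)\<^sup>2 \<partial>M) / 2)\<bar> \<le> clt_err (mom_bound K B C) (dec_bound K B C D) (real T)"
    unfolding A by (rule order_trans[OF abs_Re_le_cmod W.clt[OF T]])
  have LP: "Lp_le P 2 (\<lambda>x. 1 / sqrt (real T) * W.U {1..int T} x) (\<bar>1 / sqrt (real T)\<bar> * sqrt (4 * mom_bound K B C * dec_bound K B C D * real (card {1..int T})))"
    by (intro Lp_le_cmult W.U2) auto
  have eq: "\<bar>1 / sqrt (real T)\<bar> * sqrt (4 * mom_bound K B C * dec_bound K B C D * real (card {1..int T})) = sqrt (var_bound K B C D)"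
    using T by (simp add: var_bound_def real_sqrt_mult)
  have "Lp_le M 2 (\<lambda>\<omega>. 1 / sqrt (real T) * W.U {1..int T} (E \<omega>)) (sqrt (var_bound K B C D))"
    using Lp_le_P[OF LP] unfolding eq .
  then show "Lp_le M 2 (L \<beta>) (sqrt (var_bound K B C D))"
    by (rule Lp_le_cong[THEN iffD1, rotated]) (simp add: Lu)
qed

definition r where "r k \<omega> = sqrt (real T) * (sample_acov T X \<omega> k - \<sigma> k)"

text \<open>The first \<open>k\<close> products, which the sample autocovariance at lag \<open>k\<close> leaves out.\<close>

definition d where "d k \<omega> = 1 / sqrt (real T) * (\<Sum>i=1..min k T. X (int i) \<omega> * X (int i - int k) \<omega>)"

lemma r_decomp:
  assumes k: "k \<le> p"
  shows "r k \<omega> = L (\<lambda>k'. if k' = k then 1 else 0) \<omega> - d k \<omega>"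
proof -
  let ?x = "\<lambda>i. X (int i) \<omega> * X (int i - int k) \<omega>"
  have Tp: "real T > 0" using T by simp
  have "L (\<lambda>k'. if k' = k then 1 else 0) \<omega> = 1 / sqrt (real T) * (\<Sum>i=1..T. ?x i - \<sigma> k)"
    using k by (simp add: L_def if_distrib[of "\<lambda>x. x * _"] cong: if_cong)
  also have "\<dots> = 1 / sqrt (real T) * ((\<Sum>i=1..T. ?x i) - real T * \<sigma> k)" by (simp add: sum_subtractf)
  \<comment> \<open>The \<open>min\<close> covers sample sizes not exceeding the lag, where the
    second interval is empty.\<close>
  also have "{1..T} = {1..min k T} \<union> {k+1..T}" by auto
  also have "(\<Sum>i\<in>{1..min k T} \<union> {k+1..T}. ?x i) = (\<Sum>i=1..min k T. ?x i) + (\<Sum>i=k+1..T. ?x i)"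
    by (rule sum.union_disjoint) auto
  finally have "L (\<lambda>k'. if k' = k then 1 else 0) \<omega> - d k \<omega> = 1 / sqrt (real T) * ((\<Sum>i=k+1..T. ?x i) - real T * \<sigma> k)"
    by (simp add: d_def algebra_simps)
  also have "\<dots> = (real T / sqrt (real T)) * (1 / real T * (\<Sum>i=k+1..T. ?x i) - \<sigma> k)"
    using Tp by (simp add: algebra_simps)
  also have "real T / sqrt (real T) = sqrt (real T)" using Tp by (simp add: real_div_sqrt)
  finally show ?thesis by (simp add: r_def sample_acov_def)
qed

lemma d_Lp: 
  assumes "k \<le> p" shows "Lp_le M 1 (d k) (real K * (C * C) / sqrt (real T))"
proof (rule Lp_le_mono)
  have XX: "Lp_le M 1 (\<lambda>\<omega>. X i \<omega> * X j \<omega>) (C * C)" for i j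
  proof -
    have "Lp_le M 1 (\<lambda>\<omega>. Xh i (E \<omega>) * Xh j (E \<omega>)) (C * C)"
      using Lp_le_2_1[OF Lp_le_4_2[OF Lp_le_P[OF srd.product_moment[of i j]]]] .
    then show ?thesis by (rule Lp_le_cong[THEN iffD1, rotated]) (simp add: X_eq)
  qed
  show "Lp_le M 1 (d k) (\<bar>1 / sqrt (real T)\<bar> * (\<Sum>i=1..min k T. C * C))"
    unfolding d_def by (intro Lp_le_cmult Lp_le_sum XX) simp
  have "real (min k T) * (C * C) \<le> real K * (C * C)" using assms p by (intro mult_right_mono) auto
  then show "\<bar>1 / sqrt (real T)\<bar> * (\<Sum>i=1..min k T. C * C) \<le> real K * (C * C) / sqrt (real T)"
    by (simp add: divide_right_mono)
qed

lemma r_Lp: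
  assumes "k \<le> p" shows "Lp_le M 1 (r k) (sqrt (var_bound K 1 C D) + real K * (C * C) / sqrt (real T))"
proof -
  have "Lp_le M 2 (L (\<lambda>k'. if k' = k then 1 else 0)) (sqrt (var_bound K 1 C D))" by (rule L_clt(2)) auto
  from Lp_le_diff[OF Lp_le_2_1[OF this] d_Lp[OF assms]] show ?thesis
    by (rule Lp_le_cong[THEN iffD1, rotated]) (simp add: r_decomp[OF assms])
qed

definition S where "S j \<omega> = L (b_coeff p \<sigma> j) \<omega>"

lemma S_eq: "S j \<omega> = 1 / sqrt (real T) * (\<Sum>i=1..T. Z_lin M X p (int i) j \<omega>)"
  by (simp add: S_def L_def Z_lin_def \<sigma>_def atMost_atLeast0)

lemma S_measurable[measurable]: "S j \<in> borel_measurable M" unfolding S_def[abs_def] by measurable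

lemma alpha: "j < p \<Longrightarrow> toep p \<sigma> (\<lambda>i. a (i + 1)) j = \<sigma> (j + 1)"
  unfolding \<sigma>_def by (rule ar_coeffs_toep[OF ar])

lemma coercive_sigma: "coercive p c \<sigma>" using co by (simp add: \<sigma>_def)

lemma b_le: "k \<le> p \<Longrightarrow> j \<in> {1..p} \<Longrightarrow> \<bar>b_coeff p \<sigma> j k\<bar> \<le> b_bound K c (C * C)"
  by (rule b_coeff_bound[OF p c coercive_sigma _ alpha]) (use sigma_bound in auto)

lemma b_bound_nonneg: "b_bound K c (C * C) \<ge> 0"
  using b_le[of 0 1] p by auto

lemma S_decomp: "S j \<omega> = (\<Sum>k\<le>p. b_coeff p \<sigma> j k * r k \<omega>) + (\<Sum>k\<le>p. b_coeff p \<sigma> j k * d k \<omega>)"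
proof -
  have "S j \<omega> = L (\<lambda>k'. \<Sum>k\<le>p. b_coeff p \<sigma> j k * (if k' = k then 1 else 0)) \<omega>"
    unfolding S_def L_def
    by (intro arg_cong2[where f = "(*)"] sum.cong refl) (simp add: if_distrib[of "\<lambda>x. _ * x"] cong: if_cong)
  also have "\<dots> = (\<Sum>k\<le>p. b_coeff p \<sigma> j k * L (\<lambda>k'. if k' = k then 1 else 0) \<omega>)" by (rule L_sum)
  also have "\<dots> = (\<Sum>k\<le>p. b_coeff p \<sigma> j k * (r k \<omega> + d k \<omega>))"
    by (intro sum.cong) (auto simp: r_decomp)
  finally show ?thesis by (simp add: distrib_left sum.distrib)
qed

text \<open>The sample equations hold for every outcome. The sample matrix is positive definite
  unless all observations vanish, and then both sides are 0.\<close>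

lemma yule_walker_solves:
  assumes j: "j < p"
  shows "toep p (\<lambda>k. \<sigma> k + r k \<omega> / sqrt (real T)) (\<lambda>i. yule_walker T p X (i + 1) \<omega>) j = \<sigma> (j + 1) + r (j + 1) \<omega> / sqrt (real T)"
proof -
  have Tp: "sqrt (real T) > 0" using T by simp
  have eq: "\<sigma> k + r k \<omega> / sqrt (real T) = sample_acov T X \<omega> k" for k using Tp by (simp add: r_def)
  show ?thesis unfolding eq
  proof (cases "\<exists>i\<in>{1..T}. X (int i) \<omega> \<noteq> 0")
    case True
    have "Determinant.det (toeplitz p (sample_acov T X \<omega>)) \<noteq> 0"
      by (rule det_nonzero_of_positive) (rule sample_acov_positive[where X = X and T = T and \<omega> = \<omega>, OF T True])
    from yule_walker_cramer(2)[OF this _ j, of 1] p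
    show "toep p (sample_acov T X \<omega>) (\<lambda>i. yule_walker T p X (i + 1) \<omega>) j = sample_acov T X \<omega> (j + 1)" by simp
  next
    case False
    then have "sample_acov T X \<omega> k = 0" for k by (intro sample_acov_cong) auto
    then show "toep p (sample_acov T X \<omega>) (\<lambda>i. yule_walker T p X (i + 1) \<omega>) j = sample_acov T X \<omega> (j + 1)" by (simp add: toep_def)
  qed
qed

definition W where "W j \<omega> = sqrt (real T) * (yule_walker T p X j \<omega> - a j)"

lemma W_measurable: "j \<in> {1..p} \<Longrightarrow> W j \<in> borel_measurable M"
  unfolding W_def[abs_def] using yule_walker_measurable[of X M T j p] T by measurable

text \<open>Where all \<open>r k\<close> stay below \<open>R\<close> the deterministic linearisation
  applies, and the omitted products \<open>d\<close> are the only other discrepancy. Each receives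
  half of \<open>\<eta>\<close>, and the exceptional events are bounded by Markov's
  inequality.\<close>

lemma W_close:
  assumes R: "R > 0" and small: "(real K)\<^sup>2 * R / sqrt (real T) \<le> c / 2"
    and \<eta>: "\<eta> > 0" "lin_bound K c (C * C) * (R\<^sup>2 / sqrt (real T)) \<le> \<eta> / 2"
  shows "prob {\<omega>\<in>space M. \<exists>j\<in>{1..p}. \<eta> < \<bar>W j \<omega> - S j \<omega>\<bar>} \<le>
    (1 + real K) * ((sqrt (var_bound K 1 C D) + real K * (C * C)) / R)
      + b_bound K c (C * C) * ((1 + real K) * (real K * (C * C) / sqrt (real T))) / (\<eta> / 2)"
proof -
  let ?A = "\<lambda>k. {\<omega>\<in>space M. R < \<bar>r k \<omega>\<bar>}"
  let ?h = "\<lambda>\<omega>. b_bound K c (C * C) * (\<Sum>k\<le>p. \<bar>d k \<omega>\<bar>)"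
  let ?B = "{\<omega>\<in>space M. \<eta> / 2 < \<bar>?h \<omega>\<bar>}"
  have dm[measurable]: "d k \<in> borel_measurable M" "r k \<in> borel_measurable M" for k
    unfolding d_def[abs_def] r_def[abs_def] sample_acov_def by measurable
  have hL: "Lp_le M 1 ?h (b_bound K c (C * C) * ((1 + real K) * (real K * (C * C) / sqrt (real T))))"
  proof -
    have "Lp_le M 1 (\<lambda>\<omega>. \<bar>d k \<omega>\<bar>) (real K * (C * C) / sqrt (real T))" if "k \<le> p" for k
      using d_Lp[OF that] by (simp add: Lp_le_def)
    then have "Lp_le M 1 (\<lambda>\<omega>. \<Sum>k\<le>p. \<bar>d k \<omega>\<bar>) (\<Sum>k\<le>p. real K * (C * C) / sqrt (real T))"
      by (intro Lp_le_sum) auto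
    moreover have "(\<Sum>k\<le>p. real K * (C * C) / sqrt (real T)) \<le> (1 + real K) * (real K * (C * C) / sqrt (real T))"
      using p by (simp add: mult_right_mono divide_right_mono)
    ultimately have "Lp_le M 1 (\<lambda>\<omega>. \<Sum>k\<le>p. \<bar>d k \<omega>\<bar>) ((1 + real K) * (real K * (C * C) / sqrt (real T)))"
      by (rule Lp_le_mono)
    from Lp_le_cmult[OF this, of "b_bound K c (C * C)"] show ?thesis using b_bound_nonneg by simp
  qed
  have sub: "{\<omega>\<in>space M. \<exists>j\<in>{1..p}. \<eta> < \<bar>W j \<omega> - S j \<omega>\<bar>} \<subseteq> (\<Union>k\<in>{..p}. ?A k) \<union> ?B"
  proof
    fix \<omega> assume "\<omega> \<in> {\<omega>\<in>space M. \<exists>j\<in>{1..p}. \<eta> < \<bar>W j \<omega> - S j \<omega>\<bar>}"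
    then obtain j where \<omega>: "\<omega> \<in> space M" and j: "j \<in> {1..p}" and big: "\<eta> < \<bar>W j \<omega> - S j \<omega>\<bar>" by auto
    show "\<omega> \<in> (\<Union>k\<in>{..p}. ?A k) \<union> ?B"
    proof (rule ccontr)
      assume "\<omega> \<notin> (\<Union>k\<in>{..p}. ?A k) \<union> ?B"
      then have rR: "\<And>k. k \<le> p \<Longrightarrow> \<bar>r k \<omega>\<bar> \<le> R" and h: "\<bar>?h \<omega>\<bar> \<le> \<eta> / 2" using \<omega> by (auto simp: not_less)
      have j1: "j - 1 < p" "j - 1 + 1 = j" using j by auto
      have "\<bar>sqrt (real T) * (yule_walker T p X (j - 1 + 1) \<omega> - a (j - 1 + 1)) - (\<Sum>k\<le>p. b_coeff p \<sigma> (j - 1 + 1) k * r k \<omega>)\<bar> \<le>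
        lin_bound K c (C * C) * (R\<^sup>2 / sqrt (real T))"
        unfolding lin_bound_def
        by (rule linearisation[OF p c coercive_sigma _ alpha yule_walker_solves _ rR small j1(1)]) (use sigma_bound T in auto)
      then have 1: "\<bar>W j \<omega> - (\<Sum>k\<le>p. b_coeff p \<sigma> j k * r k \<omega>)\<bar> \<le> \<eta> / 2"
        unfolding j1(2) W_def using \<eta>(2) by linarith
      have "\<bar>\<Sum>k\<le>p. b_coeff p \<sigma> j k * d k \<omega>\<bar> \<le> (\<Sum>k\<le>p. b_bound K c (C * C) * \<bar>d k \<omega>\<bar>)"
        by (intro order_trans[OF sum_abs] sum_mono) (use b_le j in \<open>auto simp: abs_mult intro!: mult_right_mono\<close>)
      also have "\<dots> \<le> \<eta> / 2" using h by (simp add: sum_distrib_left)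
      finally show False using 1 big unfolding S_decomp by linarith
    qed
  qed
  have mA: "?A k \<in> events" "?B \<in> events" for k by measurable
  have "prob {\<omega>\<in>space M. \<exists>j\<in>{1..p}. \<eta> < \<bar>W j \<omega> - S j \<omega>\<bar>} \<le> prob ((\<Union>k\<in>{..p}. ?A k) \<union> ?B)"
    by (rule finite_measure_mono[OF sub]) (use mA in auto)
  also have "\<dots> \<le> prob (\<Union>k\<in>{..p}. ?A k) + prob ?B"
    by (rule measure_Un_le) (use mA in auto)
  also have "prob (\<Union>k\<in>{..p}. ?A k) \<le> (\<Sum>k\<le>p. prob (?A k))"
    by (rule finite_measure_subadditive_finite) (use mA in auto)
  also have "(\<Sum>k\<le>p. prob (?A k)) \<le> (\<Sum>k\<le>p. (sqrt (var_bound K 1 C D) + real K * (C * C)) / R)"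
  proof (rule sum_mono)
    fix k assume "k \<in> {..p}"
    then have "prob (?A k) \<le> (sqrt (var_bound K 1 C D) + real K * (C * C) / sqrt (real T)) / R"
      by (intro Markov_Lp_le_1 r_Lp R) auto
    also have "real K * (C * C) / sqrt (real T) \<le> real K * (C * C) / 1"
      using T by (intro divide_left_mono) auto
    finally show "prob (?A k) \<le> (sqrt (var_bound K 1 C D) + real K * (C * C)) / R"
      using R by (simp add: divide_right_mono)
  qed
  also have "\<dots> \<le> (1 + real K) * ((sqrt (var_bound K 1 C D) + real K * (C * C)) / R)"
  proof -
    have "0 \<le> sqrt (var_bound K 1 C D)" using Lp_le_nonneg[OF L_clt(2)[of "\<lambda>_. 1" 1]] by simp
    then have "0 \<le> (sqrt (var_bound K 1 C D) + real K * (C * C)) / R" using R by simp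
    then show ?thesis using p by (simp del: times_divide_eq_right) (intro mult_right_mono, auto)
  qed
  also have "prob ?B \<le> b_bound K c (C * C) * ((1 + real K) * (real K * (C * C) / sqrt (real T))) / (\<eta> / 2)"
    by (rule Markov_Lp_le_1[OF hL]) (use \<eta> in simp)
  finally show ?thesis by simp
qed

end

subsection \<open>Comparison with the normal limit\<close>

text \<open>The bound of \<open>W_close\<close> at the truncation level \<open>T powr (1/8)\<close>:
  the level must diverge, while its square divided by \<open>sqrt T\<close> must vanish.\<close>

definition close_bound :: "nat \<Rightarrow> real \<Rightarrow> real \<Rightarrow> real \<Rightarrow> real \<Rightarrow> nat \<Rightarrow> real" where
  "close_bound K c C D \<eta> T = (1 + real K) * ((sqrt (var_bound K 1 C D) + real K * (C * C)) / real T powr (1/8))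
      + b_bound K c (C * C) * ((1 + real K) * (real K * (C * C) / sqrt (real T))) / (\<eta> / 2)"

lemma close_bound_tendsto: "(\<lambda>T. close_bound K c C D \<eta> T) \<longlonglongrightarrow> 0"
proof -
  have "(\<lambda>T. 1 / real T powr (1/8)) \<longlonglongrightarrow> 0" "(\<lambda>T. 1 / sqrt (real T)) \<longlonglongrightarrow> 0"
    by real_asymp+
  then have "(\<lambda>T. (1 + real K) * ((sqrt (var_bound K 1 C D) + real K * (C * C)) * (1 / real T powr (1/8)))
      + b_bound K c (C * C) * ((1 + real K) * (real K * (C * C) * (1 / sqrt (real T)))) / (\<eta> / 2)) \<longlonglongrightarrow>
      (1 + real K) * ((sqrt (var_bound K 1 C D) + real K * (C * C)) * 0)
      + b_bound K c (C * C) * ((1 + real K) * (real K * (C * C) * 0)) / (\<eta> / 2)"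
    unfolding divide_inverse[of _ "\<eta> / 2"] by (intro tendsto_intros)
  then show ?thesis by (simp add: close_bound_def)
qed

lemma close_conditions:
  assumes c: "c > 0" and \<eta>: "\<eta> > 0"
  shows "\<forall>\<^sub>F T in sequentially. (real K)\<^sup>2 * (real T powr (1/8)) / sqrt (real T) \<le> c / 2 \<and>
    lin_bound K c S * ((real T powr (1/8))\<^sup>2 / sqrt (real T)) \<le> \<eta> / 2"
proof -
  have "(\<lambda>T. real T powr (1/8) / sqrt (real T)) \<longlonglongrightarrow> 0" "(\<lambda>T. (real T powr (1/8))\<^sup>2 / sqrt (real T)) \<longlonglongrightarrow> 0"
    by real_asymp+
  then have l: "(\<lambda>T. (real K)\<^sup>2 * (real T powr (1/8) / sqrt (real T))) \<longlonglongrightarrow> 0"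
    "(\<lambda>T. lin_bound K c S * ((real T powr (1/8))\<^sup>2 / sqrt (real T))) \<longlonglongrightarrow> 0"
    by (auto intro: tendsto_mult_right_zero simp del: times_divide_eq_right)
  have "\<forall>\<^sub>F T in sequentially. (real K)\<^sup>2 * (real T powr (1/8) / sqrt (real T)) < c / 2"
    by (rule order_tendstoD(2)[OF l(1)]) (use c in simp)
  moreover have "\<forall>\<^sub>F T in sequentially. lin_bound K c S * ((real T powr (1/8))\<^sup>2 / sqrt (real T)) < \<eta> / 2"
    by (rule order_tendstoD(2)[OF l(2)]) (use \<eta> in simp)
  ultimately show ?thesis by eventually_elim auto
qed

lemma (in prob_space) Chebyshev_Lp_le_2:
  assumes f: "Lp_le M 2 f K" and R: "R > 0"
  shows "prob {\<omega>\<in>space M. R < \<bar>f \<omega>\<bar>} \<le> K / R"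
  by (rule Markov_Lp_le_1[OF Lp_le_2_1[OF f] R])

locale yule_walker_normal = yule_walker_setting M X e g a p K T c C D + N: prob_space N
  for M :: "'a measure" and X e g a p K T c C D and N :: "'b measure" +
  fixes \<xi> :: "nat \<Rightarrow> 'b \<Rightarrow> real" and c0 :: real
  assumes c0: "c0 > 0"
    and normal: "jointly_normal N p \<xi>"
    and mean: "\<And>j. j \<in> {1..p} \<Longrightarrow> (\<integral>\<omega>. \<xi> j \<omega> \<partial>N) = 0"
    and cov: "\<And>i j. i \<in> {1..p} \<Longrightarrow> j \<in> {1..p} \<Longrightarrow> (\<integral>\<omega>. \<xi> i \<omega> * \<xi> j \<omega> \<partial>N) =
        1 / real T * (\<Sum>i\<^sub>1=1..T. \<Sum>i\<^sub>2=1..T. (\<integral>\<omega>. Z_lin M X p (int i\<^sub>1) i \<omega> * Z_lin M X p (int i\<^sub>2) j \<omega> \<partial>M))"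
    and nondeg: "\<And>j. j \<in> {1..p} \<Longrightarrow> Lnorm M 2 (\<lambda>\<omega>. 1 / sqrt (real T) * (\<Sum>i=1..T. Z_lin M X p (int i) j \<omega>)) > ennreal c0"
begin

section \<open>Matching second moments and cosine expectations of the error and the normal
  vector\<close>

lemma xi_normal: "j \<in> {1..p} \<Longrightarrow> normal_rv N (\<xi> j)"
proof -
  assume j: "j \<in> {1..p}"
  have "normal_rv N (\<lambda>\<omega>. \<Sum>i=1..p. (if i = j then 1 else 0) * \<xi> i \<omega>)"
    using normal by (simp only: jointly_normal_def)
  also have "(\<lambda>\<omega>. \<Sum>i=1..p. (if i = j then 1 else 0) * \<xi> i \<omega>) = \<xi> j"
    using j by (simp add: fun_eq_iff if_distrib[of "\<lambda>x. x * _"] cong: if_cong)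
  finally show ?thesis .
qed

lemma xi_moments:
  assumes "j \<in> {1..p}"
  shows "\<xi> j \<in> borel_measurable N" "integrable N (\<xi> j)" "integrable N (\<lambda>\<omega>. (\<xi> j \<omega>)\<^sup>2)"
  using normal_rv_moments[OF N.prob_space_axioms xi_normal[OF assms]] by auto

text \<open>The covariance hypothesis equates integrals only. Integrability, needed to expand
  squares of linear combinations, comes from normality of the coordinates.\<close>

lemma xi_product_integrable:
  assumes "i \<in> {1..p}" "j \<in> {1..p}"
  shows "integrable N (\<lambda>\<omega>. \<xi> i \<omega> * \<xi> j \<omega>)"
proof -
  have L: "Lp_le N 2 (\<xi> j) (sqrt (\<integral>\<omega>. (\<xi> j \<omega>)\<^sup>2 \<partial>N))" if "j \<in> {1..p}" for j
    using xi_moments[OF that] by (simp add: Lp_le_def)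
  have "Lp_le N 1 (\<lambda>\<omega>. \<xi> i \<omega> * \<xi> j \<omega>) (sqrt (\<integral>\<omega>. (\<xi> i \<omega>)\<^sup>2 \<partial>N) * sqrt (\<integral>\<omega>. (\<xi> j \<omega>)\<^sup>2 \<partial>N))"
    by (rule Lp_le_mult) (use L[OF assms(1)] L[OF assms(2)] in simp_all)
  then show ?thesis by (rule Lp_le_integrable)
qed

lemma Z_product_integrable:
  assumes "j\<^sub>1 \<in> {1..p}" "j\<^sub>2 \<in> {1..p}"
  shows "integrable M (\<lambda>\<omega>. Z_lin M X p i\<^sub>1 j\<^sub>1 \<omega> * Z_lin M X p i\<^sub>2 j\<^sub>2 \<omega>)"
proof -
  let ?B = "b_bound K c (C * C)"
  have L: "Lp_le M 2 (Z_lin M X p i j) (mom_bound K ?B C)" if j: "j \<in> {1..p}" for i j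
  proof -
    have "Lp_le M 2 (\<lambda>\<omega>. \<Sum>k\<le>p. b_coeff p \<sigma> j k * (Xh i (E \<omega>) * Xh (i - int k) (E \<omega>) - \<sigma> k)) (mom_bound K ?B C)"
      using Lp_le_P[OF weakly_dependent.Y2[OF weakly_dependent_L[of "b_coeff p \<sigma> j" ?B]]] b_le j by auto
    then show ?thesis
      by (rule Lp_le_cong[THEN iffD1, rotated]) (simp add: Z_lin_def X_eq \<sigma>_def atMost_atLeast0)
  qed
  have "Lp_le M 1 (\<lambda>\<omega>. Z_lin M X p i\<^sub>1 j\<^sub>1 \<omega> * Z_lin M X p i\<^sub>2 j\<^sub>2 \<omega>) (mom_bound K ?B C * mom_bound K ?B C)"
    by (rule Lp_le_mult) (use L[OF assms(1)] L[OF assms(2)] in simp_all)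
  then show ?thesis by (rule Lp_le_integrable)
qed

lemma S_Lp2:
  assumes "j \<in> {1..p}"
  shows "Lp_le M 2 (S j) (sqrt (var_bound K (b_bound K c (C * C)) C D))"
  using L_clt(2)[of "b_coeff p \<sigma> j" "b_bound K c (C * C)"] b_le[OF _ assms] by (simp add: S_def[abs_def])

lemma S_product_integrable:
  assumes "i \<in> {1..p}" "j \<in> {1..p}"
  shows "integrable M (\<lambda>\<omega>. S i \<omega> * S j \<omega>)"
proof (rule Lp_le_integrable, rule Lp_le_mult)
  show "Lp_le M (2 * 1) (S i) (sqrt (var_bound K (b_bound K c (C * C)) C D))"
    "Lp_le M (2 * 1) (S j) (sqrt (var_bound K (b_bound K c (C * C)) C D))" using S_Lp2 assms by simp_all
qed

lemma cov_S:
  assumes "i \<in> {1..p}" "j \<in> {1..p}"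
  shows "(\<integral>\<omega>. \<xi> i \<omega> * \<xi> j \<omega> \<partial>N) = (\<integral>\<omega>. S i \<omega> * S j \<omega> \<partial>M)"
proof -
  have Tp: "real T > 0" using T by simp
  have "S i \<omega> * S j \<omega> = 1 / real T * (\<Sum>i\<^sub>1=1..T. \<Sum>i\<^sub>2=1..T. Z_lin M X p (int i\<^sub>1) i \<omega> * Z_lin M X p (int i\<^sub>2) j \<omega>)" for \<omega>
    unfolding S_eq sum_product[symmetric] using Tp by (simp add: mult_ac)
  then show ?thesis unfolding cov[OF assms]
    by (simp add: Bochner_Integration.integral_sum Bochner_Integration.integrable_sum Z_product_integrable[OF assms])
qed

lemma combination_second_moment:
  "(\<integral>\<omega>. (\<Sum>j=1..p. t j * \<xi> j \<omega>)\<^sup>2 \<partial>N) = (\<integral>\<omega>. (\<Sum>j=1..p. t j * S j \<omega>)\<^sup>2 \<partial>M)"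
proof -
  have "(\<integral>\<omega>. (\<Sum>j=1..p. t j * \<xi> j \<omega>)\<^sup>2 \<partial>N) = (\<integral>\<omega>. (\<Sum>i=1..p. \<Sum>j=1..p. (t i * t j) * (\<xi> i \<omega> * \<xi> j \<omega>)) \<partial>N)"
    by (simp add: power2_eq_square sum_product mult_ac)
  also have "\<dots> = (\<Sum>i=1..p. \<Sum>j=1..p. (t i * t j) * (\<integral>\<omega>. \<xi> i \<omega> * \<xi> j \<omega> \<partial>N))"
    by (subst Bochner_Integration.integral_sum, (auto intro!: Bochner_Integration.integrable_sum integrable_mult_right xi_product_integrable)[1])
      (intro sum.cong refl, subst Bochner_Integration.integral_sum, auto intro!: integrable_mult_right xi_product_integrable)
  also have "\<dots> = (\<Sum>i=1..p. \<Sum>j=1..p. (t i * t j) * (\<integral>\<omega>. S i \<omega> * S j \<omega> \<partial>M))"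
    by (intro sum.cong refl) (simp add: cov_S)
  also have "\<dots> = (\<integral>\<omega>. (\<Sum>i=1..p. \<Sum>j=1..p. (t i * t j) * (S i \<omega> * S j \<omega>)) \<partial>M)"
    by (subst Bochner_Integration.integral_sum, (auto intro!: Bochner_Integration.integrable_sum integrable_mult_right S_product_integrable)[1])
      (intro sum.cong refl, subst Bochner_Integration.integral_sum, auto intro!: integrable_mult_right S_product_integrable)
  also have "\<dots> = (\<integral>\<omega>. (\<Sum>j=1..p. t j * S j \<omega>)\<^sup>2 \<partial>M)"
    by (simp add: power2_eq_square sum_product mult_ac)
  finally show ?thesis .
qed

lemma xi_cos:
  "(\<integral>\<omega>. cos (\<Sum>j=1..p. t j * \<xi> j \<omega>) \<partial>N) = exp (- (\<integral>\<omega>. (\<Sum>j=1..p. t j * S j \<omega>)\<^sup>2 \<partial>M) / 2)"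
proof -
  have "(\<integral>\<omega>. (\<Sum>j=1..p. t j * \<xi> j \<omega>) \<partial>N) = 0"
    by (subst Bochner_Integration.integral_sum) (auto intro!: integrable_mult_right xi_moments sum.neutral simp: mean)
  moreover have "normal_rv N (\<lambda>\<omega>. \<Sum>j=1..p. t j * \<xi> j \<omega>)"
    using normal by (simp only: jointly_normal_def)
  ultimately show ?thesis
    using normal_rv_cos[OF N.prob_space_axioms, of "\<lambda>\<omega>. \<Sum>j=1..p. t j * \<xi> j \<omega>"]
    unfolding combination_second_moment by blast
qed

text \<open>A combination of the \<open>S j\<close> is again a statistic \<open>L\<close>, and the
  normal side equals the exponential of minus half its variance. The weights are summed up to
  \<open>K\<close> instead of \<open>p\<close>, so \<open>B t\<close> is the same for all sample
  sizes.\<close>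

lemma S_xi_cos:
  defines "B t \<equiv> (\<Sum>j=1..K. \<bar>t j\<bar>) * b_bound K c (C * C)"
  shows "\<bar>(\<integral>\<omega>. cos (\<Sum>j=1..p. t j * S j \<omega>) \<partial>M) - (\<integral>\<omega>. cos (\<Sum>j=1..p. t j * \<xi> j \<omega>) \<partial>N)\<bar>
    \<le> clt_err (mom_bound K (B t) C) (dec_bound K (B t) C D) (real T)"
proof -
  let ?\<gamma> = "\<lambda>k. \<Sum>j=1..p. t j * b_coeff p \<sigma> j k"
  have \<gamma>: "\<bar>?\<gamma> k\<bar> \<le> B t" if k: "k \<le> p" for k
  proof -
    have "\<bar>?\<gamma> k\<bar> \<le> (\<Sum>j=1..p. \<bar>t j\<bar> * b_bound K c (C * C))"
      by (intro order_trans[OF sum_abs] sum_mono) (use b_le[OF k] in \<open>auto simp: abs_mult intro!: mult_left_mono\<close>)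
    also have "\<dots> \<le> (\<Sum>j=1..K. \<bar>t j\<bar> * b_bound K c (C * C))"
      by (rule sum_mono2) (use p b_bound_nonneg in auto)
    finally show ?thesis by (simp add: B_def sum_distrib_right)
  qed
  have "L ?\<gamma> \<omega> = (\<Sum>j=1..p. t j * S j \<omega>)" for \<omega> unfolding L_sum S_def ..
  then show ?thesis using L_clt(1)[where \<beta> = ?\<gamma> and B = "B t", OF \<gamma>] unfolding xi_cos by simp
qed

text \<open>Zero coordinates for \<open>p < j \<le> K\<close> make the dimension independent of the sample size.\<close>

definition padded_error where "padded_error j = (if j \<in> {1..p} then W j else (\<lambda>_. 0))"
definition padded_limit where "padded_limit j = (if j \<in> {1..p} then \<xi> j else (\<lambda>_. 0))"

lemma padded_error_measurable: "padded_error j \<in> borel_measurable M" using W_measurable by (simp add: padded_error_def)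
lemma padded_limit_measurable: "padded_limit j \<in> borel_measurable N" using xi_moments by (simp add: padded_limit_def)

lemma sum_padded_error: "(\<Sum>j=1..K. t j * padded_error j \<omega>) = (\<Sum>j=1..p. t j * W j \<omega>)"
  by (rule sum.mono_neutral_cong_right) (use p in \<open>auto simp: padded_error_def\<close>)

lemma sum_padded_limit: "(\<Sum>j=1..K. t j * padded_limit j \<omega>) = (\<Sum>j=1..p. t j * \<xi> j \<omega>)"
  by (rule sum.mono_neutral_cong_right) (use p in \<open>auto simp: padded_limit_def\<close>)

lemma W_S_distance:
  assumes small: "(real K)\<^sup>2 * (real T powr (1/8)) / sqrt (real T) \<le> c / 2"
    and \<eta>: "\<eta> > 0" "lin_bound K c (C * C) * ((real T powr (1/8))\<^sup>2 / sqrt (real T)) \<le> \<eta> / 2"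
  shows "prob {\<omega>\<in>space M. \<exists>j\<in>{1..p}. \<eta> < \<bar>W j \<omega> - S j \<omega>\<bar>} \<le> close_bound K c C D \<eta> T"
  unfolding close_bound_def using W_close[OF _ small \<eta>] T by simp

text \<open>Off an event of small probability the two combinations differ by at most
  \<open>\<eta>\<close> times the total weight, and the cosine is 1-Lipschitz; on that event the
  difference is at most 2. \<open>S_xi_cos\<close> does the rest.\<close>

lemma cos_padded_difference:
  assumes small: "(real K)\<^sup>2 * (real T powr (1/8)) / sqrt (real T) \<le> c / 2"
    and \<eta>: "\<eta> > 0" "lin_bound K c (C * C) * ((real T powr (1/8))\<^sup>2 / sqrt (real T)) \<le> \<eta> / 2"
  defines "B t \<equiv> (\<Sum>j=1..K. \<bar>t j\<bar>) * b_bound K c (C * C)"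
  shows "\<bar>(\<integral>\<omega>. cos (\<Sum>j=1..K. t j * padded_error j \<omega>) \<partial>M) - (\<integral>\<omega>. cos (\<Sum>j=1..K. t j * padded_limit j \<omega>) \<partial>N)\<bar>
    \<le> \<eta> * (\<Sum>j=1..K. \<bar>t j\<bar>) + 2 * close_bound K c C D \<eta> T + clt_err (mom_bound K (B t) C) (dec_bound K (B t) C D) (real T)"
proof -
  let ?A = "{\<omega>\<in>space M. \<exists>j\<in>{1..p}. \<eta> < \<bar>W j \<omega> - S j \<omega>\<bar>}"
  let ?w = "\<lambda>\<omega>. \<Sum>j=1..p. t j * W j \<omega>" and ?s = "\<lambda>\<omega>. \<Sum>j=1..p. t j * S j \<omega>"
  have wm[measurable]: "?w \<in> borel_measurable M" using W_measurable by measurable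
  have sm[measurable]: "?s \<in> borel_measurable M" by measurable
  have A: "?A \<in> events"
  proof -
    have "?A = (\<Union>j\<in>{1..p}. {\<omega>\<in>space M. \<eta> < \<bar>W j \<omega> - S j \<omega>\<bar>})" by auto
    moreover have "{\<omega>\<in>space M. \<eta> < \<bar>W j \<omega> - S j \<omega>\<bar>} \<in> events" if "j \<in> {1..p}" for j
      using W_measurable[OF that] by measurable
    ultimately show ?thesis by (auto intro: sets.finite_UN)
  qed
  have iA: "integrable M (indicator ?A :: _ \<Rightarrow> real)"
    using A by (intro integrable_real_indicator) (auto simp: less_top[symmetric])
  have ic: "integrable M (\<lambda>\<omega>. cos (f \<omega>))" if [measurable]: "f \<in> borel_measurable M" for f :: "'a \<Rightarrow> real"
    by (rule integrable_const_bound[where B = 1]) auto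
  have lip: "\<bar>cos x - cos y\<bar> \<le> \<bar>x - y\<bar>" for x y :: real
  proof -
    have "cos x - cos y = Re (iexp x - iexp y)" by (simp add: cis_conv_exp[symmetric])
    also have "\<bar>\<dots>\<bar> \<le> \<bar>x - y\<bar>" by (rule order_trans[OF abs_Re_le_cmod iexp_diff_le])
    finally show ?thesis .
  qed
  have "\<bar>(\<integral>\<omega>. cos (?w \<omega>) \<partial>M) - (\<integral>\<omega>. cos (?s \<omega>) \<partial>M)\<bar> = \<bar>\<integral>\<omega>. cos (?w \<omega>) - cos (?s \<omega>) \<partial>M\<bar>"
    by (subst Bochner_Integration.integral_diff) (intro ic wm sm refl)+
  also have "\<dots> \<le> (\<integral>\<omega>. \<bar>cos (?w \<omega>) - cos (?s \<omega>)\<bar> \<partial>M)" by (rule integral_abs_bound)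
  also have "\<dots> \<le> (\<integral>\<omega>. \<eta> * (\<Sum>j=1..K. \<bar>t j\<bar>) + 2 * indicator ?A \<omega> \<partial>M)"
  proof (rule integral_mono)
    show "integrable M (\<lambda>\<omega>. \<bar>cos (?w \<omega>) - cos (?s \<omega>)\<bar>)"
      by (intro integrable_abs Bochner_Integration.integrable_diff ic wm sm)
    show "integrable M (\<lambda>\<omega>. \<eta> * (\<Sum>j=1..K. \<bar>t j\<bar>) + 2 * indicator ?A \<omega> :: real)" using iA by auto
    fix \<omega> assume \<omega>: "\<omega> \<in> space M"
    show "\<bar>cos (?w \<omega>) - cos (?s \<omega>)\<bar> \<le> \<eta> * (\<Sum>j=1..K. \<bar>t j\<bar>) + 2 * indicator ?A \<omega>"
    proof (cases "\<omega> \<in> ?A")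
      case True
      have "\<bar>cos (?w \<omega>) - cos (?s \<omega>)\<bar> \<le> 2"
        using abs_cos_le_one[of "?w \<omega>"] abs_cos_le_one[of "?s \<omega>"] by linarith
      moreover have "0 \<le> \<eta> * (\<Sum>j=1..K. \<bar>t j\<bar>)" using \<eta>(1) by (intro mult_nonneg_nonneg sum_nonneg) auto
      ultimately show ?thesis using True by simp
    next
      case False
      have "\<bar>cos (?w \<omega>) - cos (?s \<omega>)\<bar> \<le> \<bar>?w \<omega> - ?s \<omega>\<bar>" by (rule lip)
      also have "?w \<omega> - ?s \<omega> = (\<Sum>j=1..p. t j * (W j \<omega> - S j \<omega>))" by (simp add: sum_subtractf right_diff_distrib)
      also have "\<bar>\<dots>\<bar> \<le> (\<Sum>j=1..p. \<bar>t j\<bar> * \<eta>)"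
        by (intro order_trans[OF sum_abs] sum_mono)
          (use False \<omega> in \<open>auto simp: abs_mult not_less intro!: mult_left_mono\<close>)
      also have "\<dots> \<le> (\<Sum>j=1..K. \<bar>t j\<bar> * \<eta>)" by (rule sum_mono2) (use p \<eta> in auto)
      finally show ?thesis using False by (simp add: sum_distrib_left mult.commute)
    qed
  qed
  also have "\<dots> = \<eta> * (\<Sum>j=1..K. \<bar>t j\<bar>) + 2 * prob ?A"
    using iA A by (simp add: prob_space)
  also have "prob ?A \<le> close_bound K c C D \<eta> T" by (rule W_S_distance[OF small \<eta>])
  finally have "\<bar>(\<integral>\<omega>. cos (?w \<omega>) \<partial>M) - (\<integral>\<omega>. cos (?s \<omega>) \<partial>M)\<bar> \<le> \<eta> * (\<Sum>j=1..K. \<bar>t j\<bar>) + 2 * close_bound K c C D \<eta> T"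
    by simp
  then show ?thesis unfolding sum_padded_error sum_padded_limit using S_xi_cos[of t] unfolding B_def by linarith
qed

lemma tail_padded_limit:
  assumes R: "R > 0"
  shows "measure N {\<omega>\<in>space N. R < \<bar>padded_limit j \<omega>\<bar>} \<le> sqrt (var_bound K (b_bound K c (C * C)) C D) / R"
proof (cases "j \<in> {1..p}")
  case True
  have "(\<integral>\<omega>. (\<xi> j \<omega>)\<^sup>2 \<partial>N) = (\<integral>\<omega>. (S j \<omega>)\<^sup>2 \<partial>M)" using cov_S[OF True True] by (simp add: power2_eq_square)
  then have "Lp_le N 2 (\<xi> j) (sqrt (var_bound K (b_bound K c (C * C)) C D))"
    using S_Lp2[OF True] xi_moments[OF True] by (simp only: Lp_le_def power2_abs)
  from N.Chebyshev_Lp_le_2[OF this R] show ?thesis using True by (simp add: padded_limit_def)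
next
  case False
  have "0 \<le> sqrt (var_bound K (b_bound K c (C * C)) C D)" using Lp_le_nonneg[OF S_Lp2[of 1]] p by simp
  moreover have "{\<omega>\<in>space N. R < \<bar>padded_limit j \<omega>\<bar>} = {}" using False R by (auto simp: padded_limit_def)
  ultimately show ?thesis using R by (simp only: measure_empty) (rule divide_nonneg_nonneg, auto)
qed

lemma tail_padded_error:
  assumes small: "(real K)\<^sup>2 * (real T powr (1/8)) / sqrt (real T) \<le> c / 2"
    and one: "lin_bound K c (C * C) * ((real T powr (1/8))\<^sup>2 / sqrt (real T)) \<le> 1 / 2"
    and R: "R > 0"
  shows "prob {\<omega>\<in>space M. R + 1 < \<bar>padded_error j \<omega>\<bar>} \<le> sqrt (var_bound K (b_bound K c (C * C)) C D) / R + close_bound K c C D 1 T"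
proof (cases "j \<in> {1..p}")
  case True
  let ?A = "{\<omega>\<in>space M. R < \<bar>S j \<omega>\<bar>}" and ?B = "{\<omega>\<in>space M. \<exists>j\<in>{1..p}. 1 < \<bar>W j \<omega> - S j \<omega>\<bar>}"
  have B: "?B \<in> events"
  proof -
    have "?B = (\<Union>j\<in>{1..p}. {\<omega>\<in>space M. 1 < \<bar>W j \<omega> - S j \<omega>\<bar>})" by auto
    moreover have "{\<omega>\<in>space M. 1 < \<bar>W j \<omega> - S j \<omega>\<bar>} \<in> events" if "j \<in> {1..p}" for j
      using W_measurable[OF that] by measurable
    ultimately show ?thesis by (auto intro: sets.finite_UN)
  qed
  have "prob {\<omega>\<in>space M. R + 1 < \<bar>padded_error j \<omega>\<bar>} \<le> prob (?A \<union> ?B)"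
  proof (rule finite_measure_mono)
    show "{\<omega>\<in>space M. R + 1 < \<bar>padded_error j \<omega>\<bar>} \<subseteq> ?A \<union> ?B"
    proof
      fix \<omega> assume "\<omega> \<in> {\<omega>\<in>space M. R + 1 < \<bar>padded_error j \<omega>\<bar>}"
      then have "\<omega> \<in> space M" "R + 1 < \<bar>W j \<omega>\<bar>" using True by (auto simp: padded_error_def)
      then have "R < \<bar>S j \<omega>\<bar> \<or> 1 < \<bar>W j \<omega> - S j \<omega>\<bar>" by linarith
      then show "\<omega> \<in> ?A \<union> ?B" using \<open>\<omega> \<in> space M\<close> True by blast
    qed
  qed (use B in measurable)
  also have "\<dots> \<le> prob ?A + prob ?B" by (rule measure_Un_le) (use B in auto)
  also have "prob ?A \<le> sqrt (var_bound K (b_bound K c (C * C)) C D) / R" by (rule Chebyshev_Lp_le_2[OF S_Lp2[OF True] R])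
  also have "prob ?B \<le> close_bound K c C D 1 T" by (rule W_S_distance[OF small]) (use one in auto)
  finally show ?thesis by simp
next
  case False
  have "0 \<le> sqrt (var_bound K (b_bound K c (C * C)) C D)" using Lp_le_nonneg[OF S_Lp2[of 1]] p by simp
  moreover have "0 \<le> close_bound K c C D 1 T" by (rule order_trans[OF measure_nonneg W_S_distance[OF small]]) (use one in auto)
  moreover have "{\<omega>\<in>space M. R + 1 < \<bar>padded_error j \<omega>\<bar>} = {}" using False R by (auto simp: padded_error_def)
  ultimately show ?thesis using R by (simp only: measure_empty) (intro add_nonneg_nonneg divide_nonneg_nonneg, auto)
qed

lemma variance_lower:
  assumes j: "j \<in> {1..p}"
  shows "c0\<^sup>2 \<le> (\<integral>\<omega>. (\<xi> j \<omega>)\<^sup>2 \<partial>N)"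
proof -
  have i: "integrable M (\<lambda>\<omega>. (S j \<omega>)\<^sup>2)" using S_Lp2[OF j] by (simp add: Lp_le_def)
  define v where "v = (\<integral>\<omega>. (S j \<omega>)\<^sup>2 \<partial>M)"
  have v0: "v \<ge> 0" by (simp add: v_def)
  have "(\<integral>\<^sup>+\<omega>. ennreal (\<bar>S j \<omega>\<bar> powr 2) \<partial>M) = ennreal v"
    using nn_integral_eq_integral[OF i] by (simp add: v_def)
  then have "Lnorm M 2 (S j) = ennreal (v powr (1/2))" using v0 by (simp add: Lnorm_def)
  moreover have "Lnorm M 2 (S j) > ennreal c0" using nondeg[OF j] by (simp add: S_eq[abs_def])
  ultimately have "c0 < sqrt v" using c0 v0 by (simp add: powr_half_sqrt ennreal_less_iff)
  then have "c0\<^sup>2 \<le> (sqrt v)\<^sup>2" using c0 by (intro power_mono) auto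
  then show ?thesis using v0 cov_S[OF j j] by (simp add: v_def power2_eq_square)
qed

text \<open>Between the two cubes some coordinate has modulus in the interval from \<open>x\<close>
  to \<open>y\<close>; a union bound over the coordinates needs only one-dimensional densities, so
  the joint covariance may be singular.\<close>

lemma padded_limit_lipschitz:
  assumes xy: "x \<le> y" "0 \<le> y"
  shows "measure N {\<omega>\<in>space N. \<forall>j\<in>{1..K}. \<bar>padded_limit j \<omega>\<bar> \<le> y} - measure N {\<omega>\<in>space N. \<forall>j\<in>{1..K}. \<bar>padded_limit j \<omega>\<bar> \<le> x} \<le> real K / c0 * (y - x)"
proof -
  note [measurable] = padded_limit_measurable
  let ?G = "\<lambda>x. {\<omega>\<in>space N. \<forall>j\<in>{1..K}. \<bar>padded_limit j \<omega>\<bar> \<le> x}" and ?D = "\<lambda>j. {\<omega>\<in>space N. x < \<bar>\<xi> j \<omega>\<bar> \<and> \<bar>\<xi> j \<omega>\<bar> \<le> y}"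
  have D: "?D j \<in> sets N" if "j \<in> {1..p}" for j using xi_moments(1)[OF that] by measurable
  have "measure N (?G y) - measure N (?G x) = measure N (?G y - ?G x)"
    using xy by (subst N.finite_measure_Diff) (auto intro: order_trans)
  also have "\<dots> \<le> measure N (\<Union>j\<in>{1..p}. ?D j)"
  proof (rule N.finite_measure_mono)
    show "?G y - ?G x \<subseteq> (\<Union>j\<in>{1..p}. ?D j)"
    proof
      fix \<omega> assume \<omega>: "\<omega> \<in> ?G y - ?G x"
      then obtain j where j: "j \<in> {1..K}" "x < \<bar>padded_limit j \<omega>\<bar>" by (auto simp: not_le)
      \<comment> \<open>If the coordinate that exceeds \<open>x\<close> is a padded zero, then
        \<open>x\<close> is negative and any genuine coordinate, here the first, exceeds it as
        well.\<close>
      define i where "i = (if j \<in> {1..p} then j else 1)"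
      have i: "i \<in> {1..p}" using p by (auto simp: i_def)
      have "x < \<bar>\<xi> i \<omega>\<bar>" using j unfolding i_def padded_limit_def by (auto split: if_splits intro: less_le_trans)
      moreover have "\<bar>\<xi> i \<omega>\<bar> \<le> y" using \<omega> i p by (force simp: padded_limit_def)
      ultimately show "\<omega> \<in> (\<Union>j\<in>{1..p}. ?D j)" using i \<omega> by blast
    qed
  qed (use D in auto)
  also have "\<dots> \<le> (\<Sum>j=1..p. measure N (?D j))" by (rule N.finite_measure_subadditive_finite) (use D in auto)
  also have "\<dots> \<le> (\<Sum>j=1..p. (y - x) / c0)"
    by (intro sum_mono normal_rv_anticoncentration[OF N.prob_space_axioms xi_normal mean c0 variance_lower xy(1)])
  also have "\<dots> = real p * ((y - x) / c0)" by simp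
  also have "\<dots> \<le> real K * ((y - x) / c0)" using p xy c0 by (intro mult_right_mono) auto
  finally show ?thesis by simp
qed

lemma box_padded_error: 
  assumes "x \<ge> 0"
  shows "prob {\<omega>\<in>space M. (MAX j\<in>{1..p}. \<bar>sqrt (real T) * (yule_walker T p X j \<omega> - a j)\<bar>) \<le> x} = prob {\<omega>\<in>space M. \<forall>j\<in>{1..K}. \<bar>padded_error j \<omega>\<bar> \<le> x}"
proof -
  have "(MAX j\<in>{1..p}. \<bar>sqrt (real T) * (yule_walker T p X j \<omega> - a j)\<bar>) \<le> x \<longleftrightarrow> (\<forall>j\<in>{1..K}. \<bar>padded_error j \<omega>\<bar> \<le> x)" for \<omega>
    using p assms by (subst Max_le_iff) (auto simp: padded_error_def W_def)
  then show ?thesis by simp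
qed

lemma box_padded_limit: 
  assumes "x \<ge> 0"
  shows "measure N {\<omega>\<in>space N. (MAX j\<in>{1..p}. \<bar>\<xi> j \<omega>\<bar>) \<le> x} = measure N {\<omega>\<in>space N. \<forall>j\<in>{1..K}. \<bar>padded_limit j \<omega>\<bar> \<le> x}"
proof -
  have "(MAX j\<in>{1..p}. \<bar>\<xi> j \<omega>\<bar>) \<le> x \<longleftrightarrow> (\<forall>j\<in>{1..K}. \<bar>padded_limit j \<omega>\<bar> \<le> x)" for \<omega>
    using p assms by (subst Max_le_iff) (auto simp: padded_limit_def)
  then show ?thesis by simp
qed

end

theorem theorem3:
  fixes M :: "nat \<Rightarrow> 'a measure"
    and X :: "nat \<Rightarrow> int \<Rightarrow> 'a \<Rightarrow> real"
    and p :: "nat \<Rightarrow> nat"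
    and m \<alpha> c C :: real
    and a :: "nat \<Rightarrow> nat \<Rightarrow> real"
    and N :: "nat \<Rightarrow> 'b measure"
    and \<xi> :: "nat \<Rightarrow> nat \<Rightarrow> 'b \<Rightarrow> real"
  assumes "\<And>T. T \<ge> 1 \<Longrightarrow> prob_space (M T)"
    and "m \<ge> 8" and "\<alpha> > 2"
    and "short_range_dependent M X m \<alpha>"
    and "\<And>T. T \<ge> 1 \<Longrightarrow> weakly_stationary (M T) (X T)"
    and "\<And>T. T \<ge> 1 \<Longrightarrow> p T \<ge> 1"
    and "(\<lambda>T. real (p T)) \<in> O(\<lambda>_. 1)"
    and "c > 0"
    and "\<And>T. T \<ge> 1 \<Longrightarrow> Min (spectrum (toeplitz (p T) (acov (M T) (X T)))) > c"
    and "C > 0"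
    and "\<And>T j. T \<ge> 1 \<Longrightarrow> j \<in> {1..p T} \<Longrightarrow>
          Lnorm (M T) 2 (\<lambda>\<omega>. 1 / sqrt (real T) * (\<Sum>i=1..T. Z_lin (M T) (X T) (p T) (int i) j \<omega>))
            > ennreal C"
    and "\<And>T. T \<ge> 1 \<Longrightarrow> ar_coeffs (p T) (acov (M T) (X T)) (a T)"
    and "\<And>T. T \<ge> 1 \<Longrightarrow> prob_space (N T)"
    and "\<And>T. T \<ge> 1 \<Longrightarrow> jointly_normal (N T) (p T) (\<xi> T)"
    and "\<And>T j. T \<ge> 1 \<Longrightarrow> j \<in> {1..p T} \<Longrightarrow> (\<integral>\<omega>. \<xi> T j \<omega> \<partial>N T) = 0"
    and "\<And>T j\<^sub>1 j\<^sub>2. T \<ge> 1 \<Longrightarrow> j\<^sub>1 \<in> {1..p T} \<Longrightarrow> j\<^sub>2 \<in> {1..p T} \<Longrightarrow>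
          (\<integral>\<omega>. \<xi> T j\<^sub>1 \<omega> * \<xi> T j\<^sub>2 \<omega> \<partial>N T) =
            1 / real T * (\<Sum>i\<^sub>1=1..T. \<Sum>i\<^sub>2=1..T.
              (\<integral>\<omega>. Z_lin (M T) (X T) (p T) (int i\<^sub>1) j\<^sub>1 \<omega> *
                    Z_lin (M T) (X T) (p T) (int i\<^sub>2) j\<^sub>2 \<omega> \<partial>M T))"
  shows "(\<lambda>T. SUP x::real.
            \<bar>\<P>(\<omega> in M T. (MAX j\<in>{1..p T}. \<bar>sqrt (real T) * (yule_walker T (p T) (X T) j \<omega> - a T j)\<bar>) \<le> x)
             - \<P>(\<omega> in N T. (MAX j\<in>{1..p T}. \<bar>\<xi> T j \<omega>\<bar>) \<le> x)\<bar>) \<in> o(\<lambda>_. 1)"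
proof -
  obtain K0 where K0: "\<forall>\<^sub>F T in sequentially. norm (real (p T)) \<le> K0 * norm (1 :: real)"
    using assms(7) by (auto elim!: landau_o.bigE)
  define K where "K = nat \<lceil>K0\<rceil>"
  obtain C1 C2 e g where C1: "\<forall>\<^sub>F T in sequentially. (SUP i. Lnorm (M T) m (X T i)) \<le> ennreal C1"
    and rep: "\<And>T. T \<ge> 1 \<Longrightarrow> causal_representation (M T) (X T) (e T) (g T)"
    and C2: "\<forall>\<^sub>F T in sequentially. (SUP k. ennreal ((1 + real k) powr \<alpha>) * (\<Sum>l. dep_measure (M T) (X T) (e T) (g T) m (k + l))) \<le> ennreal C2"
    using assms(4) unfolding short_range_dependent_def by blast
  \<comment> \<open>Later bounds ask for nonnegative constants. Replacing a negative one by 0 is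
    harmless, since \<open>ennreal\<close> sends it to 0.\<close>
  define D1 D2 where "D1 = max 0 C1" and "D2 = max 0 C2"
  have D: "0 \<le> D1" "0 \<le> D2" "ennreal C1 \<le> ennreal D1" "ennreal C2 \<le> ennreal D2"
    by (auto simp: D1_def D2_def intro!: ennreal_leI)
  have "\<forall>\<^sub>F T in sequentially. T \<ge> 1 \<and> p T \<le> K \<and> (SUP i. Lnorm (M T) m (X T i)) \<le> ennreal D1 \<and>
     (SUP k. ennreal ((1 + real k) powr \<alpha>) * (\<Sum>l. dep_measure (M T) (X T) (e T) (g T) m (k + l))) \<le> ennreal D2"
    using K0 C1 C2 eventually_ge_at_top[of 1]
  proof eventually_elim
    case (elim T)
    have "real (p T) \<le> K0" using elim(1) by simp
    then have "p T \<le> K" unfolding K_def by linarith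
    then show ?case using elim D by (auto intro: order_trans)
  qed
  then obtain T0 where T0: "\<And>T. T \<ge> T0 \<Longrightarrow> T \<ge> 1" "\<And>T. T \<ge> T0 \<Longrightarrow> p T \<le> K"
      "\<And>T. T \<ge> T0 \<Longrightarrow> (SUP i. Lnorm (M T) m (X T i)) \<le> ennreal D1"
      "\<And>T. T \<ge> T0 \<Longrightarrow> (SUP k. ennreal ((1 + real k) powr \<alpha>) * (\<Sum>l. dep_measure (M T) (X T) (e T) (g T) m (k + l))) \<le> ennreal D2"
    unfolding eventually_sequentially by blast
  have setting: "yule_walker_normal (M T) (X T) (e T) (g T) (a T) (p T) K T c D1 D2 (N T) (\<xi> T) C" if T: "T \<ge> T0" for T
  proof -
    note T1 = T0(1)[OF T]
    have "short_range (distr (M T) seqs (\<lambda>\<omega> j. e T j \<omega>)) (recentre (g T)) D1 D2"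
      by (rule short_range_of_representation[OF assms(1)[OF T1] rep[OF T1] assms(2) _ D(1,2) T0(3,4)[OF T]]) (use assms(3) in simp)
    then show ?thesis
      using assms(1,5,6,8,10-16) T1 T0(2)[OF T] rep[OF T1] coercive_of_spectrum[OF assms(6)[OF T1] assms(9)[OF T1]]
      by (intro yule_walker_normal.intro yule_walker_setting.intro yule_walker_setting_axioms.intro yule_walker_normal_axioms.intro) auto
  qed
  define U where "U T = yule_walker_normal.padded_error (X T) (a T) (p T) T" for T
  define V where "V T = yule_walker_normal.padded_limit (p T) (\<xi> T)" for T
  define bB where "bB = b_bound K c (D1 * D1)"
  have cos: "(\<lambda>T. (\<integral>\<omega>. cos (\<Sum>j=1..K. t j * U T j \<omega>) \<partial>M T) - (\<integral>\<omega>. cos (\<Sum>j=1..K. t j * V T j \<omega>) \<partial>N T)) \<longlonglongrightarrow> 0" for t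
  proof (rule tendstoI)
    fix \<epsilon> :: real assume \<epsilon>: "\<epsilon> > 0"
    define s where "s = (\<Sum>j=1..K. \<bar>t j\<bar>)"
    have s: "s \<ge> 0" by (auto simp: s_def intro!: sum_nonneg)
    \<comment> \<open>Half of the error is reserved for the distance between the estimator and its
      linear term; the \<open>+ 1\<close> covers weights that are all zero.\<close>
    define \<eta> where "\<eta> = \<epsilon> / (2 * (s + 1))"
    have \<eta>: "\<eta> > 0" using \<epsilon> s by (simp add: \<eta>_def)
    have \<eta>s: "\<eta> * s \<le> \<epsilon> / 2"
    proof -
      have "\<eta> * s \<le> \<eta> * (s + 1)" using \<eta> by simp
      also have "\<dots> = \<epsilon> / 2" using s by (simp add: \<eta>_def field_simps)
      finally show ?thesis .
    qed
    have "(\<lambda>T. 2 * close_bound K c D1 D2 \<eta> T + clt_err (mom_bound K (s * bB) D1) (dec_bound K (s * bB) D1 D2) (real T)) \<longlonglongrightarrow> 2 * 0 + 0"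
      by (intro tendsto_intros close_bound_tendsto clt_err_tendsto)
    then have "\<forall>\<^sub>F T in sequentially. 2 * close_bound K c D1 D2 \<eta> T + clt_err (mom_bound K (s * bB) D1) (dec_bound K (s * bB) D1 D2) (real T) < \<epsilon> / 2"
      by (rule order_tendstoD(2)) (use \<epsilon> in simp)
    with close_conditions[OF assms(8) \<eta>, of K "D1 * D1"] eventually_ge_at_top[of T0]
    show "\<forall>\<^sub>F T in sequentially. dist ((\<integral>\<omega>. cos (\<Sum>j=1..K. t j * U T j \<omega>) \<partial>M T) - (\<integral>\<omega>. cos (\<Sum>j=1..K. t j * V T j \<omega>) \<partial>N T)) 0 < \<epsilon>"
    proof eventually_elim
      case (elim T)
      interpret yule_walker_normal "M T" "X T" "e T" "g T" "a T" "p T" K T c D1 D2 "N T" "\<xi> T" C by (rule setting[OF elim(2)])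
      show ?case
        using cos_padded_difference[OF elim(1)[THEN conjunct1] \<eta> elim(1)[THEN conjunct2], of t] elim(3) \<eta>s
        unfolding U_def V_def s_def bB_def dist_real_def by linarith
    qed
  qed
  define v where "v = sqrt (var_bound K bB D1 D2)"
  \<comment> \<open>The constant does not involve the sample size, so interpreting the locale at
    \<open>T0\<close> alone is enough.\<close>
  have v: "v \<ge> 0"
  proof -
    interpret yule_walker_normal "M T0" "X T0" "e T0" "g T0" "a T0" "p T0" K T0 c D1 D2 "N T0" "\<xi> T0" C by (rule setting) simp
    show ?thesis using Lp_le_nonneg[OF S_Lp2[of 1]] p by (simp add: v_def bB_def)
  qed
  have K1: "K \<ge> 1" using assms(6)[OF T0(1), of T0] T0(2)[of T0] by simp
  have approx: "cosine_approx M N U V K T0 (real K / C)"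
  proof (rule cosine_approx.intro)
    fix T assume T: "T \<ge> T0"
    interpret yule_walker_normal "M T" "X T" "e T" "g T" "a T" "p T" K T c D1 D2 "N T" "\<xi> T" C by (rule setting[OF T])
    show "prob_space (M T)" "prob_space (N T)" by unfold_locales
    show "U T j \<in> borel_measurable (M T)" "V T j \<in> borel_measurable (N T)" for j
      using padded_error_measurable padded_limit_measurable by (auto simp: U_def V_def)
    show "measure (N T) {\<omega>\<in>space (N T). \<forall>j\<in>{1..K}. \<bar>V T j \<omega>\<bar> \<le> y} - measure (N T) {\<omega>\<in>space (N T). \<forall>j\<in>{1..K}. \<bar>V T j \<omega>\<bar> \<le> x} \<le> real K / C * (y - x)"
      if "x \<le> y" "0 \<le> y" for x y
      using padded_limit_lipschitz[OF that] by (simp only: V_def)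
  next
    show "(\<lambda>T. (\<integral>\<omega>. cos (\<Sum>j=1..K. t j * U T j \<omega>) \<partial>M T) - (\<integral>\<omega>. cos (\<Sum>j=1..K. t j * V T j \<omega>) \<partial>N T)) \<longlonglongrightarrow> 0" for t
      by (rule cos)
    show "real K / C > 0" using K1 assms(10) by simp
  next
    fix \<eta> :: real assume \<eta>: "\<eta> > 0"
    \<comment> \<open>This makes \<open>v / R\<close> at most \<open>\<eta> / 2\<close>, the
      \<open>+ 1\<close> keeping \<open>R\<close> positive. The estimation errors are cut at
      \<open>R + 1\<close>, since they may differ from their linear terms by 1.\<close>
    define R where "R = 2 * (v + 1) / \<eta>"
    have R: "R > 0" "v / R \<le> \<eta> / 2" using \<eta> v by (auto simp: R_def field_simps)
    have "\<forall>\<^sub>F T in sequentially. \<forall>j\<in>{1..K}. measure (N T) {\<omega>\<in>space (N T). R < \<bar>V T j \<omega>\<bar>} \<le> \<eta>"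
      using eventually_ge_at_top[of T0]
    proof eventually_elim
      case (elim T)
      interpret yule_walker_normal "M T" "X T" "e T" "g T" "a T" "p T" K T c D1 D2 "N T" "\<xi> T" C by (rule setting[OF elim])
      show ?case using tail_padded_limit[OF R(1)] R(2) \<eta> unfolding V_def v_def bB_def by (intro ballI) (rule order_trans, assumption, linarith)
    qed
    then show "\<exists>L. \<forall>\<^sub>F T in sequentially. \<forall>j\<in>{1..K}. measure (N T) {\<omega>\<in>space (N T). L < \<bar>V T j \<omega>\<bar>} \<le> \<eta>" by blast
    have one: "(0 :: real) < 1" by simp
    have "\<forall>\<^sub>F T in sequentially. close_bound K c D1 D2 1 T < \<eta> / 2"
      by (rule order_tendstoD(2)[OF close_bound_tendsto]) (use \<eta> in simp)
    with close_conditions[OF assms(8) one, of K "D1 * D1"] eventually_ge_at_top[of T0]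
    have "\<forall>\<^sub>F T in sequentially. \<forall>j\<in>{1..K}. measure (M T) {\<omega>\<in>space (M T). R + 1 < \<bar>U T j \<omega>\<bar>} \<le> \<eta>"
    proof eventually_elim
      case (elim T)
      interpret yule_walker_normal "M T" "X T" "e T" "g T" "a T" "p T" K T c D1 D2 "N T" "\<xi> T" C by (rule setting[OF elim(2)])
      show ?case
      proof
        fix j
        show "measure (M T) {\<omega>\<in>space (M T). R + 1 < \<bar>U T j \<omega>\<bar>} \<le> \<eta>"
          using tail_padded_error[OF elim(1)[THEN conjunct1] elim(1)[THEN conjunct2] R(1), of j] elim(3) R(2)
          unfolding U_def v_def bB_def by linarith
      qed
    qed
    then show "\<exists>L. \<forall>\<^sub>F T in sequentially. \<forall>j\<in>{1..K}. measure (M T) {\<omega>\<in>space (M T). L < \<bar>U T j \<omega>\<bar>} \<le> \<eta>" by blast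
  qed
  interpret approx: cosine_approx M N U V K T0 "real K / C" by (rule approx)
  let ?F = "\<lambda>T x. \<P>(\<omega> in M T. (MAX j\<in>{1..p T}. \<bar>sqrt (real T) * (yule_walker T (p T) (X T) j \<omega> - a T j)\<bar>) \<le> x)"
  let ?G = "\<lambda>T x. \<P>(\<omega> in N T. (MAX j\<in>{1..p T}. \<bar>\<xi> T j \<omega>\<bar>) \<le> x)"
  have "(\<lambda>T. SUP x. \<bar>?F T x - ?G T x\<bar>) \<longlonglongrightarrow> 0"
  proof (rule tendstoI)
    fix \<epsilon> :: real assume \<epsilon>: "\<epsilon> > 0"
    have "\<epsilon> / 2 > 0" using \<epsilon> by simp
    from approx.uniform[OF this] eventually_ge_at_top[of T0]
    show "\<forall>\<^sub>F T in sequentially. dist (SUP x. \<bar>?F T x - ?G T x\<bar>) 0 < \<epsilon>"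
    proof eventually_elim
      case (elim T)
      interpret yule_walker_normal "M T" "X T" "e T" "g T" "a T" "p T" K T c D1 D2 "N T" "\<xi> T" C by (rule setting[OF elim(2)])
      have b: "\<bar>?F T x - ?G T x\<bar> \<le> \<epsilon> / 2" for x
      proof (cases "x \<ge> 0")
        case True
        show ?thesis unfolding box_padded_error[OF True] box_padded_limit[OF True]
          using elim(1) True by (simp add: approx.F_def approx.G_def U_def V_def)
      next
        case False
        \<comment> \<open>For negative \<open>x\<close> both events are empty, because a maximum of
          absolute values over a nonempty index set is nonnegative.\<close>
        have "\<not> (MAX j\<in>{1..p T}. \<bar>f j\<bar>) \<le> x" for f :: "nat \<Rightarrow> real"
        proof -
          have "\<bar>f 1\<bar> \<le> (MAX j\<in>{1..p T}. \<bar>f j\<bar>)" using p by (intro Max_ge) auto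
          then show ?thesis using False by linarith
        qed
        then show ?thesis using \<epsilon> by simp
      qed
      have "(SUP x. \<bar>?F T x - ?G T x\<bar>) \<le> \<epsilon> / 2" by (rule cSUP_least) (use b in auto)
      moreover have "0 \<le> (SUP x. \<bar>?F T x - ?G T x\<bar>)"
        by (rule cSUP_upper2[of _ _ 0]) (use b in \<open>auto intro!: bdd_aboveI2[where M = "\<epsilon> / 2"]\<close>)
      ultimately show ?case using \<epsilon> by simp
    qed
  qed
  then show ?thesis by (intro smalloI_tendsto) simp_all
qed

end
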